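(* Fix $\theta\in(0,1)$, an integer $n\ge3$, integers $\alpha_2,\dots,\alpha_n$ with $\alpha_n\ne0$, and positive coprime integers $p,q$; put $t_r=2\pi p/q$. Let $z_0\in L^2(0,2\pi)$ and let $z$ be the $L^2$ solution of the periodic problem (PP) with initial datum $z_0$. Then: (i) If $\theta\in\mathbb{Q}$, then $z(\cdot,t_r)$ is a finite linear combination of periodically translated copies of $z_0$: there exist $N\in\mathbb{N}$, $c_1,\dots,c_N\in\mathbb{C}$ and $\sigma_1,\dots,\sigma_N\in\mathbb{R}$ with $z(x,t_r)=\sum_{j=1}^N c_j z_0^*(x-\sigma_j)$ for a.e. $x$. (ii) If $\theta\notin\mathbb{Q}$ and $z_0$ is of bounded variation on $[0,2\pi]$, then $x\mapsto z(x,t_r)$ (has a representative which) is continuous on $[0,2\pi]$ and $z(0,t_r)=z(2\pi,t_r)$.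
   Context: Let $A(\lambda)=\sum_{m=2}^n\alpha_m\sum_{k=2}^m\binom{m}{k}\theta^{m-k}\lambda^k$. The periodic problem (PP) on $[0,2\pi]\times[0,\infty)$ is $\partial_t z=-iA(-i\partial_x)z$, $z(x,0)=z_0(x)$, $\partial_x^m z(0,t)=\partial_x^m z(2\pi,t)$ for $m=0,\dots,n-1$. For $z_0\in L^2(0,2\pi)$ its solution is $z(x,t)=\sum_{j\in\mathbb{Z}}\widehat{z_0}(j)e^{-iA(j)t}e_j(x)$, where $e_j(x)=e^{ijx}/\sqrt{2\pi}$ and $\widehat{z_0}(j)=\int_0^{2\pi}z_0(x)\overline{e_j(x)}\,dx$. For a function $f$ on $[0,2\pi)$, $f^*$ denotes its $2\pi$-periodic extension: $f^*(x)=f(x-2\pi m)$ for $2\pi m\le x<2\pi(m+1)$, $m\in\mathbb{Z}$. *)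

theory Defs
  imports "HOL-Analysis.Analysis"
begin

definition A_sym :: "(nat \<Rightarrow> int) \<Rightarrow> real \<Rightarrow> nat \<Rightarrow> real \<Rightarrow> real" where
  "A_sym \<alpha> \<theta> n lam =
     (\<Sum>m=2..n. real_of_int (\<alpha> m) * (\<Sum>k=2..m. real (m choose k) * \<theta> ^ (m - k) * lam ^ k))"

definition e_basis :: "int \<Rightarrow> real \<Rightarrow> complex" where
  "e_basis j x = exp (\<i> * of_int j * of_real x) / of_real (sqrt (2 * pi))"

definition fourier_coeff :: "(real \<Rightarrow> complex) \<Rightarrow> int \<Rightarrow> complex" where
  "fourier_coeff f j = integral {0..2*pi} (\<lambda>x. f x * cnj (e_basis j x))"

definition L2_on :: "real set \<Rightarrow> (real \<Rightarrow> complex) \<Rightarrow> bool" where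
  "L2_on S f \<longleftrightarrow> f measurable_on S \<and> (\<lambda>x. (norm (f x))\<^sup>2) integrable_on S"

definition PP_partial :: "(nat \<Rightarrow> int) \<Rightarrow> real \<Rightarrow> nat \<Rightarrow> (real \<Rightarrow> complex) \<Rightarrow> real \<Rightarrow> nat \<Rightarrow> real \<Rightarrow> complex" where
  "PP_partial \<alpha> \<theta> n z0 t N x =
     (\<Sum>j\<in>{-int N..int N}. fourier_coeff z0 j * exp (- \<i> * of_real (A_sym \<alpha> \<theta> n (of_int j) * t)) * e_basis j x)"

text \<open>g is a representative of the L^2 solution z(., t) of (PP): the series
  sum_j hat z0(j) e^{-iA(j)t} e_j converges to g in L^2(0,2pi).\<close>
definition PP_solution_at :: "(nat \<Rightarrow> int) \<Rightarrow> real \<Rightarrow> nat \<Rightarrow> (real \<Rightarrow> complex) \<Rightarrow> real \<Rightarrow> (real \<Rightarrow> complex) \<Rightarrow> bool" where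
  "PP_solution_at \<alpha> \<theta> n z0 t g \<longleftrightarrow>
     L2_on {0..2*pi} g \<and>
     ((\<lambda>N. integral {0..2*pi} (\<lambda>x. (norm (PP_partial \<alpha> \<theta> n z0 t N x - g x))\<^sup>2)) \<longlonglongrightarrow> 0)"

definition per_ext :: "(real \<Rightarrow> complex) \<Rightarrow> real \<Rightarrow> complex" where
  "per_ext f x = f (x - 2 * pi * of_int \<lfloor>x / (2 * pi)\<rfloor>)"

definition bounded_variation_on :: "(real \<Rightarrow> complex) \<Rightarrow> real \<Rightarrow> real \<Rightarrow> bool" where
  "bounded_variation_on f a b \<longleftrightarrow>
     (\<exists>B. \<forall>(k::nat) (xs::nat \<Rightarrow> real).
        xs 0 = a \<and> xs k = b \<and> (\<forall>i<k. xs i \<le> xs (Suc i)) \<longrightarrow>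
        (\<Sum>i<k. norm (f (xs (Suc i)) - f (xs i))) \<le> B)"

end

theory Submission
  imports Defs "HOL-Real_Asymp.Real_Asymp"
begin

text \<open>
  Expanding \<open>A\<close> in powers of \<open>j\<close>, the multiplier \<open>exp (-i A(j) t)\<close> at \<open>t = 2 \<pi> p / q\<close> is
  \<open>exp (2 \<pi> i P(j))\<close> for a real polynomial \<open>P\<close>. If \<open>\<theta>\<close> is rational, this is periodic in \<open>j\<close>,
  hence a finite combination of characters \<open>exp (2 \<pi> i s j / M)\<close>, each of which acts as a translation.

  If \<open>\<theta>\<close> is irrational, the coefficient of \<open>j^(n-1)\<close> in \<open>P\<close> is irrational and \<open>n - 1 \<ge> 2\<close>. It suffices to
  bound the dyadic blocks \<open>B_k(u)\<close> of the symmetric series of \<open>exp (2 \<pi> i P(l) + i l u) / l\<close>: summation by parts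
  against \<open>dz_0\<close> then shows that the dyadic partial sums of the solution are uniformly Cauchy.
  By the inverse theorem for Weyl sums, \<open>|B_k(u)| \<ge> \<delta>\<close> forces all coefficients of \<open>P(l) + l u / (2 \<pi>)\<close>
  to be close at scale \<open>2^k\<close> to fractions with a common denominator bounded by a power of \<open>1 / \<delta>\<close>. Deep inside such a
  major arc \<open>l\<close> and \<open>-l\<close> cancel. So the \<open>k\<close> with \<open>|B_k(u)| \<ge> \<delta>\<close> lie in two windows of length
  \<open>O(log (1 / \<delta>))\<close>, and by irrationality they are bounded uniformly in \<open>u\<close>. Summing over \<open>\<delta> = 2^-s\<close> gives
  uniform smallness of the tails.
\<close>

section \<open>The inverse theorem for Weyl sums\<close>

text \<open>No Diophantine condition on \<theta> is available: if \<theta> is extremely well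
  approximable, one rational approximation governs arbitrarily many consecutive dyadic scales, and
  there the one-sided sums of exp (2 \<pi> i P(l)) / l need not decay. Pairing l with -l removes
  these scales, because the complete sums over residues of the two halves agree. What remains are
  the scales below a power of 1 / \<delta> and those where the approximation breaks off, hence two
  windows. Losses polynomial in 1 / \<delta> are essential: they make the windows O(s) long at level
  2^-s, and the sum of s 2^-s converges. The exact exponents never matter, so constants are absorbed
  generously. Irrationality enters only qualitatively, to confine the blocks above a fixed level to
  scales below some \<open>j0\<close> independent of u. Uniform convergence is obtained only along
  dyadic partial sums; the limit is then identified through its Fourier coefficients, and
  mean-square convergence of Fourier series accounts for all the partial sums in
  \<open>PP_solution_at\<close>. The same identification settles the rational case.\<close>

definition ue :: "real \<Rightarrow> complex" where
  "ue x = cis (2 * pi * x)"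

lemma ue_add: "ue (x + y) = ue x * ue y"
  by (simp add: ue_def cis_mult distrib_left)

lemma ue_diff: "ue (x - y) = ue x * cnj (ue y)"
  by (simp add: ue_def cis_cnj cis_mult right_diff_distrib)

lemma ue_0 [simp]: "ue 0 = 1"
  by (simp add: ue_def)

lemma norm_ue [simp]: "norm (ue x) = 1"
  by (simp add: ue_def)

lemma cnj_ue: "cnj (ue x) = ue (- x)"
  by (simp add: ue_def cis_cnj)

lemma ue_of_int [simp]: "ue (of_int z) = 1"
  unfolding ue_def by (metis cis_multiple_2pi Ints_of_int)

lemma ue_power: "ue x ^ n = ue (of_nat n * x)"
  by (simp add: ue_def Complex.DeMoivre mult_ac)

lemma ue_cong_int: "x - y \<in> \<int> \<Longrightarrow> ue x = ue y"
  by (metis Ints_cases add.commute diff_add_cancel mult_1 ue_add ue_of_int mult.commute)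

lemma norm_ue_minus_1: "norm (ue x - 1) = 2 * \<bar>sin (pi * x)\<bar>"
  using dist_exp_i_1[of "2 * pi * x"] by (simp add: ue_def cis_conv_exp)

lemma norm_ue_diff_le: "norm (ue x - ue y) \<le> 2 * pi * \<bar>x - y\<bar>"
proof -
  have "ue x - ue y = ue y * (ue (x - y) - 1)"
    by (simp add: right_diff_distrib flip: ue_add)
  hence "norm (ue x - ue y) = 2 * \<bar>sin (pi * (x - y))\<bar>"
    by (simp add: norm_mult norm_ue_minus_1)
  also have "\<dots> \<le> 2 * \<bar>pi * (x - y)\<bar>"
    using abs_sin_x_le_abs_x by auto
  finally show ?thesis by (simp add: abs_mult)
qed

lemma norm_ue_minus_1_ge:
  assumes "\<bar>x\<bar> \<le> 1/2"
  shows "norm (ue x - 1) \<ge> \<bar>x\<bar>"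
proof -
  define t where "t = pi * \<bar>x\<bar>"
  \<comment> \<open>1.6 exceeds \<pi> / 2 and keeps t^2 / 6 below 1 / 2, so the cubic Taylor bound
    gives sin t >= t / 2.\<close>
  have t: "0 \<le> t" "t \<le> 1.6"
    using assms pi_approx mult_mono[of pi "3.2" "\<bar>x\<bar>" "1/2"] by (auto simp: t_def)
  have "\<bar>sin t - t\<bar> \<le> inverse (fact 3) * \<bar>t\<bar> ^ 3"
    using Maclaurin_sin_bound[of t 3] by (simp add: eval_nat_numeral sin_coeff_def)
  hence "\<bar>sin t - t\<bar> * 6 \<le> t * (t * t)"
    using t by (simp add: eval_nat_numeral)
  hence "sin t \<ge> t - t * (t * t / 6)"
    by (simp add: abs_if split: if_splits)
  moreover have "t * (t * t / 6) \<le> t * (1/2)"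
    using t mult_mono[of t "1.6" t "1.6"] by (intro mult_left_mono) auto
  ultimately have "sin t \<ge> t / 2" by linarith
  moreover have "\<bar>sin (pi * x)\<bar> = \<bar>sin t\<bar>"
    by (cases "x \<ge> 0") (auto simp: t_def)
  moreover have "t \<ge> \<bar>x\<bar>"
    using pi_ge_two mult_right_mono[of 1 pi "\<bar>x\<bar>"] unfolding t_def by simp
  ultimately show ?thesis
    using t by (auto simp: norm_ue_minus_1)
qed

text \<open>The sum telescopes after multiplication by \<open>ue t - 1\<close>. The factor |t|
  stands on the left so that t = 0 is covered.\<close>

lemma norm_sum_ue_linear:
  fixes a b :: nat
  assumes "a \<le> b" "\<bar>t\<bar> \<le> 1/2"
  shows "norm (\<Sum>n=a..<b. ue (t * of_nat n)) * \<bar>t\<bar> \<le> 2"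
proof -
  have "(\<Sum>n=a..<b. ue (t * of_nat n)) * (ue t - 1) = (\<Sum>n=a..<b. ue (t * of_nat (Suc n)) - ue (t * of_nat n))"
    unfolding sum_distrib_right by (intro sum.cong) (auto simp: algebra_simps ue_add)
  also have "\<dots> = ue (t * of_nat b) - ue (t * of_nat a)"
    using assms(1) by (rule sum_Suc_diff')
  also have "norm \<dots> \<le> 2"
    using norm_triangle_ineq4[of "ue (t * of_nat b)" "ue (t * of_nat a)"] by simp
  finally have "norm (\<Sum>n=a..<b. ue (t * of_nat n)) * norm (ue t - 1) \<le> 2"
    by (simp add: norm_mult)
  moreover have "norm (\<Sum>n=a..<b. ue (t * of_nat n)) * \<bar>t\<bar> \<le> norm (\<Sum>n=a..<b. ue (t * of_nat n)) * norm (ue t - 1)"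
    using norm_ue_minus_1_ge[OF assms(2)] by (intro mult_left_mono) auto
  ultimately show ?thesis by linarith
qed

text \<open>Summation by parts, with the boundary weight taken at b, one past the range, so that the
  variation is that of w on [a, b].\<close>

lemma abel_summation_bound:
  fixes g w :: "nat \<Rightarrow> complex"
  assumes "a \<le> b" and M: "\<And>c. a \<le> c \<Longrightarrow> c \<le> b \<Longrightarrow> norm (\<Sum>n=a..<c. g n) \<le> M"
  shows "norm (\<Sum>n=a..<b. g n * w n) \<le> M * (norm (w b) + (\<Sum>n=a..<b. norm (w (Suc n) - w n)))"
proof -
  define G where "G = (\<lambda>c. \<Sum>n=a..<c. g n)"
  have eq: "(\<Sum>n=a..<c. g n * w n) = G c * w c - (\<Sum>n=a..<c. G (Suc n) * (w (Suc n) - w n))"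
    if "a \<le> c" for c
    using that by (induction c rule: dec_induct) (auto simp: G_def algebra_simps)
  have GM: "norm (G c) \<le> M" if "a \<le> c" "c \<le> b" for c
    using M[OF that] by (simp add: G_def)
  have "norm (\<Sum>n=a..<b. g n * w n) \<le> norm (G b * w b) + norm (\<Sum>n=a..<b. G (Suc n) * (w (Suc n) - w n))"
    unfolding eq[OF assms(1)] by (rule norm_triangle_ineq4)
  also have "norm (G b * w b) \<le> M * norm (w b)"
    unfolding norm_mult using GM assms(1) by (intro mult_right_mono) auto
  also have "norm (\<Sum>n=a..<b. G (Suc n) * (w (Suc n) - w n)) \<le> (\<Sum>n=a..<b. M * norm (w (Suc n) - w n))"
    by (rule sum_norm_le) (auto simp: norm_mult intro!: mult_right_mono GM)
  finally show ?thesis by (simp add: algebra_simps flip: sum_distrib_left)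
qed

text \<open>Pigeonhole: \<open>L + 1\<close> translates of H inside an interval of
  \<open>N + t * L\<close> numbers cannot be disjoint once their total size exceeds its
  length.\<close>

lemma translates_meet:
  fixes H :: "nat set"
  assumes H: "H \<subseteq> {..<N}" and card: "N + t * L < (L + 1) * card H"
  obtains h h' i where "h \<in> H" "h' \<in> H" "1 \<le> i" "i \<le> L" "h' = h + t * i"
proof -
  have fin: "finite H" using H finite_subset by blast
  have "\<not> inj_on (\<lambda>(i, h). h + t * i) ({..L} \<times> H)"
  proof
    assume "inj_on (\<lambda>(i, h). h + t * i) ({..L} \<times> H)"
    moreover have "(\<lambda>(i, h). h + t * i) ` ({..L} \<times> H) \<subseteq> {..<N + t * L}"
    proof (clarsimp)
      fix i h assume "i \<le> L" "h \<in> H"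
      then have "t * i \<le> t * L" "h < N" using H by auto
      then show "h + t * i < N + t * L" by linarith
    qed
    ultimately have "card ({..L} \<times> H) \<le> N + t * L"
      using card_inj_on_le[of _ "{..L} \<times> H" "{..<N + t * L}"] by fastforce
    with card show False by (simp add: card_cartesian_product)
  qed
  then obtain i h i' h' where *: "i \<le> L" "i' \<le> L" "h \<in> H" "h' \<in> H" "h + t * i = h' + t * i'" "(i, h) \<noteq> (i', h')"
    unfolding inj_on_def by auto
  show thesis
  proof (cases "i < i'")
    case True
    with * have "h = h' + t * (i' - i)" by (simp add: diff_mult_distrib2)
    with True * that[of h' h "i' - i"] show thesis by auto
  next
    case False
    with * have "i' < i" by (metis add_right_cancel linorder_neqE_nat)
    with * have "h' = h + t * (i - i')" by (simp add: diff_mult_distrib2)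
    with \<open>i' < i\<close> * that[of h h' "i - i'"] show thesis by auto
  qed
qed

text \<open>
  Both conclusions come from translates of \<open>H\<close> that are too numerous to be disjoint: steps of length 1
  produce \<open>q\<close>, and if \<open>q \<gamma>\<close> had too large a distance \<open>\<kappa>\<close> to the integers, the translates by multiples of
  \<open>s q\<close> with \<open>s \<kappa>\<close> just above \<open>2 \<epsilon>\<close> would be disjoint.
\<close>

lemma dense_almost_integral_multiples:
  fixes \<gamma> \<epsilon> K :: real
  assumes H: "H \<subseteq> {..<N}" and K: "K \<ge> 1" and dens: "real N \<le> K * real (card H)"
    and close: "\<And>h. h \<in> H \<Longrightarrow> \<exists>z::int. \<bar>\<gamma> * real h - of_int z\<bar> \<le> \<epsilon>"
    and small: "14 * K * \<epsilon> < 1" and large: "real N \<ge> 3 * K"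
  obtains q :: nat and z :: int where "1 \<le> q" "real q \<le> 3 * K"
    "\<bar>real q * \<gamma> - of_int z\<bar> * real N \<le> 36 * K\<^sup>2 * \<epsilon>"
proof -
  define L where "L = nat \<lceil>2 * K\<rceil>"
  have L: "real L \<ge> 2 * K" "real L \<le> 3 * K"
    using K unfolding L_def by linarith+
  have N0: "real N > 0" using large K by linarith
  have "card H > 0"
  proof (rule ccontr)
    assume "\<not> card H > 0"
    with dens N0 show False by simp
  qed
  then obtain h0 where "h0 \<in> H" by fastforce
  from close[OF this] have eps0: "\<epsilon> \<ge> 0" by force
  \<comment> \<open>The bound 2 N leaves N free for the spread \<open>t * L\<close> of the
    translates; both applications of \<open>translates_meet\<close> use it.\<close>
  have dens': "(real L + 1) * real (card H) > 2 * real N"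
  proof -
    have "2 * real N \<le> 2 * K * real (card H)" using dens by simp
    also have "\<dots> < (real L + 1) * real (card H)"
      using L \<open>card H > 0\<close> by (intro mult_strict_right_mono) auto
    finally show ?thesis .
  qed
  have "N + 1 * L < (L + 1) * card H"
  proof -
    have "real (N + 1 * L) \<le> 2 * real N" using L large by simp
    also note dens'
    also have "(real L + 1) * real (card H) = real ((L + 1) * card H)" by (simp add: algebra_simps)
    finally show ?thesis by linarith
  qed
  from translates_meet[OF H this] obtain h1 h2 q
    where q: "h1 \<in> H" "h2 \<in> H" "1 \<le> q" "q \<le> L" "h2 = h1 + 1 * q" by metis
  obtain z1 z2 :: int where z12: "\<bar>\<gamma> * real h1 - of_int z1\<bar> \<le> \<epsilon>" "\<bar>\<gamma> * real h2 - of_int z2\<bar> \<le> \<epsilon>"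
    using close q by metis
  define \<kappa> where "\<kappa> = real q * \<gamma> - of_int (z2 - z1)"
  have \<kappa>2: "\<bar>\<kappa>\<bar> \<le> 2 * \<epsilon>"
    using z12 q(5) unfolding \<kappa>_def by (auto simp: algebra_simps abs_if split: if_splits)
  have "\<bar>\<kappa>\<bar> * real N \<le> 36 * K\<^sup>2 * \<epsilon>"
  proof (cases "\<kappa> = 0")
    case True
    then show ?thesis using eps0 by simp
  next
    case False
    define s where "s = nat \<lfloor>2 * \<epsilon> / \<bar>\<kappa>\<bar>\<rfloor> + 1"
    have k0: "\<bar>\<kappa>\<bar> > 0" using False by simp
    have ge1: "1 \<le> 2 * \<epsilon> / \<bar>\<kappa>\<bar>" using \<kappa>2 k0 by simp
    have s1: "2 * \<epsilon> / \<bar>\<kappa>\<bar> < real s" and s2: "real s \<le> 4 * \<epsilon> / \<bar>\<kappa>\<bar>"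
      using ge1 unfolding s_def by linarith+
    have s1': "2 * \<epsilon> < real s * \<bar>\<kappa>\<bar>" using s1 k0 by (simp add: pos_divide_less_eq)
    have s2': "real s * \<bar>\<kappa>\<bar> \<le> 4 * \<epsilon>" using s2 k0 by (simp add: pos_le_divide_eq)
    have "real N < real (s * q * L)"
    proof (rule ccontr)
      assume "\<not> real N < real (s * q * L)"
      then have "N + s * q * L \<le> 2 * N" by linarith
      then have "real (N + (s * q) * L) \<le> 2 * real N" by linarith
      also note dens'
      also have "(real L + 1) * real (card H) = real ((L + 1) * card H)" by (simp add: algebra_simps)
      finally have "N + (s * q) * L < (L + 1) * card H" by linarith
      from translates_meet[OF H this] obtain h h' i
        where i: "h \<in> H" "h' \<in> H" "1 \<le> i" "i \<le> L" "h' = h + (s * q) * i" by metis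
      obtain z z' :: int where z: "\<bar>\<gamma> * real h - of_int z\<bar> \<le> \<epsilon>" "\<bar>\<gamma> * real h' - of_int z'\<bar> \<le> \<epsilon>"
        using close i by metis
      define y where "y = real s * real i * \<kappa>"
      have "\<gamma> * real h' - \<gamma> * real h = y + of_int (int s * int i * (z2 - z1))"
        by (simp add: i(5) y_def \<kappa>_def algebra_simps)
      then have "\<bar>y - of_int (z' - z - int s * int i * (z2 - z1))\<bar> \<le> 2 * \<epsilon>"
        using z by auto
      moreover have "\<bar>y\<bar> > 2 * \<epsilon>"
      proof -
        have "2 * \<epsilon> < real s * \<bar>\<kappa>\<bar>" by (rule s1')
        also have "\<dots> \<le> real i * (real s * \<bar>\<kappa>\<bar>)"
          using i(3) mult_right_mono[of 1 "real i" "real s * \<bar>\<kappa>\<bar>"] by auto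
        finally show ?thesis by (simp add: y_def abs_mult mult_ac)
      qed
      moreover have "\<bar>y\<bar> \<le> 12 * (K * \<epsilon>)"
      proof -
        have "\<bar>y\<bar> = real i * (real s * \<bar>\<kappa>\<bar>)" by (simp add: y_def abs_mult mult_ac)
        also have "\<dots> \<le> (3 * K) * (4 * \<epsilon>)"
          using i L s2' K by (intro mult_mono s2') auto
        finally show ?thesis by simp
      qed
      moreover have "\<epsilon> \<le> K * \<epsilon>" using K eps0 mult_right_mono[of 1 K \<epsilon>] by simp
      \<comment> \<open>The integer within 2 \<epsilon> of y is nonzero because |y| > 2 \<epsilon>,
        but |y| + 2 \<epsilon> <= 14 K \<epsilon> < 1 makes it smaller than 1; hence the constant
        14.\<close>
      ultimately have "\<bar>of_int (z' - z - int s * int i * (z2 - z1))\<bar> < (1::real)"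
        and "z' - z - int s * int i * (z2 - z1) \<noteq> 0"
        using small by fastforce+
      then show False by linarith
    qed
    then have "\<bar>\<kappa>\<bar> * real N \<le> \<bar>\<kappa>\<bar> * real (s * q * L)"
      by (intro mult_left_mono) auto
    also have "\<dots> = (real s * \<bar>\<kappa>\<bar>) * (real q * real L)" by simp
    also have "\<dots> \<le> (4 * \<epsilon>) * ((3 * K) * (3 * K))"
      using q L K eps0 by (intro mult_mono[OF s2'] mult_mono[of "real q" _ "real L"]) auto
    finally show ?thesis by (simp add: power2_eq_square mult_ac)
  qed
  then show thesis
    using that[of q "z2 - z1"] q L unfolding \<kappa>_def by auto
qed

text \<open>The squared sum is a sum over pairs (m, n), sorted by the lag h = m - n. Negative lags
  are conjugate to positive ones, whence the factor 2.\<close>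

lemma weyl_differencing:
  fixes f :: "nat \<Rightarrow> complex"
  assumes "b \<le> N"
  shows "(norm (\<Sum>n=a..<b. f n))\<^sup>2 \<le> 2 * (\<Sum>h<N. norm (\<Sum>n=a..<b-h. f (n + h) * cnj (f n)))"
proof -
  let ?I = "{a..<b}"
  define S where "S = (\<lambda>h. \<Sum>n=a..<b-h. f (n + h) * cnj (f n))"
  define U where "U = (\<Sum>(m, n) | m \<in> ?I \<and> n \<in> ?I \<and> n \<le> m. f m * cnj (f n))"
  define V where "V = (\<Sum>(m, n) | m \<in> ?I \<and> n \<in> ?I \<and> n < m. f m * cnj (f n))"
  have fin: "finite {(m, n). m \<in> ?I \<and> n \<in> ?I \<and> Q m n}" for Q :: "nat \<Rightarrow> nat \<Rightarrow> bool"
    by (rule finite_subset[of _ "?I \<times> ?I"]) auto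
  \<comment> \<open>Truncated subtraction empties the inner range for h >= b, so lags up to any N >=
    b may be included.\<close>
  have U: "U = (\<Sum>h<N. S h)"
    unfolding U_def S_def sum.Sigma[OF finite_lessThan ballI[OF finite_atLeastLessThan]]
    by (rule sum.reindex_bij_witness[of _ "\<lambda>(h, n). (n + h, n)" "\<lambda>(m, n). (m - n, n)"])
       (use assms in auto)
  have V: "V = (\<Sum>h=1..<N. S h)"
    unfolding V_def S_def sum.Sigma[OF finite_atLeastLessThan ballI[OF finite_atLeastLessThan]]
    by (rule sum.reindex_bij_witness[of _ "\<lambda>(h, n). (n + h, n)" "\<lambda>(m, n). (m - n, n)"])
       (use assms in auto)
  have "of_real ((norm (\<Sum>n\<in>?I. f n))\<^sup>2) = (\<Sum>n\<in>?I. f n) * cnj (\<Sum>n\<in>?I. f n)"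
    by (rule complex_norm_square)
  also have "\<dots> = (\<Sum>(m, n)\<in>?I \<times> ?I. f m * cnj (f n))"
    by (simp add: sum_product sum.cartesian_product)
  also have "?I \<times> ?I = {(m, n). m \<in> ?I \<and> n \<in> ?I \<and> n \<le> m} \<union> {(m, n). m \<in> ?I \<and> n \<in> ?I \<and> m < n}"
    by auto
  also have "(\<Sum>(m, n)\<in>\<dots>. f m * cnj (f n)) = U + (\<Sum>(m, n) | m \<in> ?I \<and> n \<in> ?I \<and> m < n. f m * cnj (f n))"
    unfolding U_def by (intro sum.union_disjoint fin) auto
  also have "(\<Sum>(m, n) | m \<in> ?I \<and> n \<in> ?I \<and> m < n. f m * cnj (f n)) = cnj V"
    unfolding V_def cnj_sum
    by (rule sum.reindex_bij_witness[of _ "\<lambda>(m, n). (n, m)" "\<lambda>(m, n). (n, m)"]) auto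
  finally have "(norm (\<Sum>n\<in>?I. f n))\<^sup>2 = norm (U + cnj V)"
    by (metis norm_of_real abs_power2 power2_abs)
  also have "\<dots> \<le> norm U + norm V"
    using norm_triangle_ineq[of U "cnj V"] by simp
  also have "norm U \<le> (\<Sum>h<N. norm (S h))" unfolding U by (rule norm_sum)
  also have "norm V \<le> (\<Sum>h=1..<N. norm (S h))" unfolding V by (rule norm_sum)
  also have "\<dots> \<le> (\<Sum>h<N. norm (S h))" by (rule sum_mono2) auto
  finally show ?thesis by (simp add: S_def)
qed

text \<open>Of the difference polynomial only the leading coefficient is recorded: it is the one
  coefficient for which \<open>weyl_inverse_top\<close> uses the induction hypothesis.\<close>

lemma poly_difference:
  fixes x :: "nat \<Rightarrow> real"
  obtains y where "\<And>u. (\<Sum>k\<le>Suc d. x k * (u + h) ^ k) - (\<Sum>k\<le>Suc d. x k * u ^ k) = (\<Sum>k\<le>d. y k * u ^ k)"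
    "y d = x (Suc d) * real (Suc d) * h"
proof -
  define y where "y = (\<lambda>k. \<Sum>m\<le>Suc d. if k < m then x m * (of_nat (m choose k) * h ^ (m - k)) else 0)"
  have "(\<Sum>k\<le>Suc d. x k * (u + h) ^ k) - (\<Sum>k\<le>Suc d. x k * u ^ k) = (\<Sum>k\<le>d. y k * u ^ k)" for u
  proof -
    have 1: "(u + h) ^ m - u ^ m = (\<Sum>k\<le>d. if k < m then of_nat (m choose k) * u ^ k * h ^ (m - k) else 0)"
      if "m \<le> Suc d" for m
    proof -
      have "(u + h) ^ m = (\<Sum>k\<le>m. of_nat (m choose k) * u ^ k * h ^ (m - k))"
        by (rule binomial_ring)
      also have "\<dots> = (\<Sum>k<m. of_nat (m choose k) * u ^ k * h ^ (m - k)) + u ^ m"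
        by (simp add: lessThan_Suc_atMost[symmetric])
      also have "(\<Sum>k<m. of_nat (m choose k) * u ^ k * h ^ (m - k)) =
        (\<Sum>k\<le>d. if k < m then of_nat (m choose k) * u ^ k * h ^ (m - k) else 0)"
        using that by (intro sum.mono_neutral_cong_left) auto
      finally show ?thesis by simp
    qed
    have "(\<Sum>k\<le>Suc d. x k * (u + h) ^ k) - (\<Sum>k\<le>Suc d. x k * u ^ k) = (\<Sum>m\<le>Suc d. x m * ((u + h) ^ m - u ^ m))"
      by (simp only: sum_subtractf right_diff_distrib)
    also have "\<dots> = (\<Sum>m\<le>Suc d. \<Sum>k\<le>d. (if k < m then x m * (of_nat (m choose k) * h ^ (m - k)) else 0) * u ^ k)"
      by (rule sum.cong[OF refl]) (subst 1, simp, auto simp: sum_distrib_left intro!: sum.cong)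
    also have "\<dots> = (\<Sum>k\<le>d. y k * u ^ k)"
      unfolding y_def sum_distrib_right by (rule sum.swap)
    finally show ?thesis .
  qed
  moreover have "y d = x (Suc d) * real (Suc d) * h"
  proof -
    have "y d = (\<Sum>m\<in>{Suc d}. x m * (of_nat (m choose d) * h ^ (m - d)))"
      unfolding y_def by (rule sum.mono_neutral_cong_right) auto
    then show ?thesis by simp
  qed
  ultimately show thesis using that by blast
qed

lemma ue_eq_1_iff: "ue t = 1 \<longleftrightarrow> t \<in> \<int>"
proof
  assume "ue t = 1"
  then obtain n :: int where "2 * pi * t = of_int (2 * n) * pi"
    by (auto simp: ue_def cis_conv_exp exp_eq_1)
  then show "t \<in> \<int>" by auto
qed (auto elim!: Ints_cases)

lemma sum_roots_of_unity:
  fixes Q :: nat and m :: int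
  assumes "Q > 0"
  shows "(\<Sum>s<Q. ue (real s * of_int m / real Q)) = (if int Q dvd m then of_nat Q else 0)"
proof -
  define w where "w = ue (of_int m / real Q)"
  have eq: "(\<Sum>s<Q. ue (real s * of_int m / real Q)) = (\<Sum>s<Q. w ^ s)"
    by (simp add: w_def ue_power)
  show ?thesis
  proof (cases "int Q dvd m")
    case True
    then obtain k where "m = int Q * k" by blast
    then have "w = 1" using assms by (simp add: w_def)
    then show ?thesis using True by (simp add: eq)
  next
    case False
    have "w \<noteq> 1"
    proof
      assume "w = 1"
      then obtain k :: int where "of_int m / real Q = of_int k"
        unfolding w_def ue_eq_1_iff by (auto elim: Ints_cases)
      then have "of_int m = (of_int (k * int Q) :: real)"
        using assms by (simp add: field_simps)
      then have "m = k * int Q" by (simp only: of_int_eq_iff)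
      with False show False by simp
    qed
    moreover have "w ^ Q = 1"
      using assms by (simp add: w_def ue_power)
    ultimately show ?thesis
      using False by (simp add: eq geometric_sum)
  qed
qed

lemma periodic_int_add_mult:
  fixes f :: "int \<Rightarrow> 'a"
  assumes "\<And>l. f (l + q) = f l"
  shows "f (l + k * q) = f l"
proof (induction k rule: int_induct[where k = 0])
  case (step1 i)
  then show ?case using assms[of "l + i * q"] by (simp add: algebra_simps)
next
  case (step2 i)
  then show ?case using assms[of "l + (i - 1) * q"] by (simp add: algebra_simps)
qed simp

text \<open>Discrete Fourier inversion modulo Q, by orthogonality of the characters. Since the
  coefficients are averages of values of norm at most 1, replacing f by its expansion costs only a
  factor Q in norm estimates.\<close>

lemma finite_fourier_expansion:
  fixes f :: "int \<Rightarrow> complex"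
  assumes Q: "Q > 0" and per: "\<And>l. f (l + int Q) = f l" and bound: "\<And>l. norm (f l) \<le> 1"
  obtains c where "\<And>l. f l = (\<Sum>s<Q. c s * ue (real s * of_int l / real Q))" "\<And>s. norm (c s) \<le> 1"
proof -
  define c where "c = (\<lambda>s. (\<Sum>r<Q. f (int r) * ue (- (real s * real r / real Q))) / of_nat Q)"
  have "f l = (\<Sum>s<Q. c s * ue (real s * of_int l / real Q))" for l
  proof -
    define r0 where "r0 = nat (l mod int Q)"
    have r0: "r0 < Q" "int r0 = l mod int Q" using Q by (auto simp: r0_def nat_less_iff)
    have dvd: "int Q dvd l - int r \<longleftrightarrow> r = r0" if "r < Q" for r
    proof -
      have "int Q dvd l - int r \<longleftrightarrow> l mod int Q = int r mod int Q"
        by (simp add: mod_eq_dvd_iff)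
      then show ?thesis using that r0 by auto
    qed
    have "(\<Sum>s<Q. c s * ue (real s * of_int l / real Q)) =
       (\<Sum>s<Q. \<Sum>r<Q. f (int r) / of_nat Q * ue (real s * of_int (l - int r) / real Q))"
      unfolding c_def
      by (intro sum.cong refl)
         (simp add: sum_divide_distrib sum_distrib_right sum_distrib_left right_diff_distrib diff_divide_distrib ue_diff cnj_ue mult_ac)
    also have "\<dots> = (\<Sum>r<Q. f (int r) / of_nat Q * (\<Sum>s<Q. ue (real s * of_int (l - int r) / real Q)))"
      by (subst sum.swap) (simp add: sum_distrib_left)
    also have "\<dots> = (\<Sum>r<Q. if r = r0 then f (int r) else 0)"
      using Q by (intro sum.cong) (auto simp: sum_roots_of_unity dvd simp del: of_int_diff)
    also have "\<dots> = f (l mod int Q)" using r0 by simp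
    also have "\<dots> = f l"
      using periodic_int_add_mult[of f "int Q" "l mod int Q" "l div int Q"] per by simp
    finally show ?thesis by simp
  qed
  moreover have "norm (c s) \<le> 1" for s
  proof -
    have "norm (\<Sum>r<Q. f (int r) * ue (- (real s * real r / real Q))) \<le> (\<Sum>r<Q. 1)"
      using bound by (intro sum_norm_le) (auto simp: norm_mult)
    then show ?thesis using Q by (simp add: c_def norm_divide divide_le_eq)
  qed
  ultimately show thesis using that by blast
qed

lemma rational_power_shift_in_Ints:
  fixes l z :: int
  assumes "Q > 0"
  shows "of_int z / real Q * (of_int (l + int Q) ^ k - of_int l ^ k) \<in> \<int>"
proof -
  have "int Q dvd (l + int Q) ^ k - l ^ k"
    using power_diff_sumr2[of "l + int Q" k l] by simp
  then obtain j where j: "(l + int Q) ^ k - l ^ k = int Q * j" by (rule dvdE)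
  have "(of_int (l + int Q) ^ k - of_int l ^ k :: real) = of_int ((l + int Q) ^ k - l ^ k)"
    by simp
  also have "\<dots> = real Q * of_int j" unfolding j by simp
  finally have "of_int z / real Q * (of_int (l + int Q) ^ k - of_int l ^ k) = (of_int (z * j) :: real)"
    using assms by simp
  then show ?thesis by (metis Ints_of_int)
qed

text \<open>The parameter \<open>D \<ge> 2\<close> is the reciprocal of the density; all constants are absorbed into powers of it.\<close>

definition weyl_inverse :: "nat \<Rightarrow> nat \<Rightarrow> bool" where
  "weyl_inverse d C \<longleftrightarrow>
     (\<forall>x (D::real) N a b. 2 \<le> D \<longrightarrow> b \<le> N \<longrightarrow> 1 \<le> N \<longrightarrow>
        real N \<le> D * norm (\<Sum>n=a..<b. ue (\<Sum>k\<le>d. x k * real n ^ k)) \<longrightarrow>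
        (\<exists>Q::nat. 1 \<le> Q \<and> real Q \<le> D ^ C \<and>
           (\<forall>k\<in>{1..d}. \<exists>z::int. \<bar>real Q * x k - of_int z\<bar> * real N ^ k \<le> D ^ C)))"

text \<open>With t the signed distance of \<open>x 1\<close> to the nearest integer, the geometric
  sum is at most 2 / |t|. So Q = 1 works, and 2 D <= D^2 gives the exponent 2.\<close>

lemma weyl_inverse_linear: "weyl_inverse 1 2"
  unfolding weyl_inverse_def
proof (intro allI impI)
  fix x :: "nat \<Rightarrow> real" and D :: real and N a b :: nat
  assume D: "2 \<le> D" and "b \<le> N" "1 \<le> N"
    and big: "real N \<le> D * norm (\<Sum>n=a..<b. ue (\<Sum>k\<le>1. x k * real n ^ k))"
  have "a \<le> b"
  proof (rule ccontr)
    assume "\<not> a \<le> b"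
    with big \<open>1 \<le> N\<close> show False by simp
  qed
  define t where "t = x 1 - of_int (round (x 1))"
  have t: "\<bar>t\<bar> \<le> 1/2"
    using of_int_round_abs_le[of "x 1"] by (simp add: t_def abs_minus_commute)
  have "ue (\<Sum>k\<le>1. x k * real n ^ k) = ue (x 0) * ue (t * real n)" for n
    unfolding ue_add[symmetric] by (intro ue_cong_int) (simp add: t_def algebra_simps)
  then have "(\<Sum>n=a..<b. ue (\<Sum>k\<le>1. x k * real n ^ k)) = ue (x 0) * (\<Sum>n=a..<b. ue (t * real n))"
    by (simp only: sum_distrib_left)
  then have "real N \<le> D * norm (\<Sum>n=a..<b. ue (t * real n))"
    using big by (simp add: norm_mult)
  then have "real N * \<bar>t\<bar> \<le> D * norm (\<Sum>n=a..<b. ue (t * real n)) * \<bar>t\<bar>"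
    by (rule mult_right_mono) simp
  also have "\<dots> \<le> D * 2"
    unfolding mult.assoc using D norm_sum_ue_linear[OF \<open>a \<le> b\<close> t] by (intro mult_left_mono) auto
  also have "\<dots> \<le> D ^ 2" using D by (simp add: power2_eq_square)
  finally have "\<bar>x 1 - of_int (round (x 1))\<bar> * real N \<le> D ^ 2"
    by (simp add: t_def mult.commute)
  then show "\<exists>Q::nat. 1 \<le> Q \<and> real Q \<le> D ^ 2 \<and>
      (\<forall>k\<in>{1..1}. \<exists>z::int. \<bar>real Q * x k - of_int z\<bar> * real N ^ k \<le> D ^ 2)"
    using D one_le_power[of D 2] by (intro exI[of _ 1]) auto
qed

section \<open>The induction on the degree in the inverse theorem\<close>

lemma numeral_le_power:
  fixes D :: real
  assumes "2 \<le> D" "n \<le> 2 ^ m"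
  shows "real n \<le> D ^ m"
proof -
  have "real n \<le> 2 ^ m" using assms(2) by (metis of_nat_le_iff of_nat_numeral of_nat_power)
  also have "\<dots> \<le> D ^ m" using assms(1) by (intro power_mono) auto
  finally show ?thesis .
qed

text \<open>Differencing gives many lags h whose correlation sums, of degree d, are large; the
  induction hypothesis makes a bounded multiple of (d + 1) h x_(d+1) integral up to O(N^-d).
  Pigeonhole yields one multiplier for many h, and \<open>dense_almost_integral_multiples\<close>
  trades these many h for the missing factor N.\<close>

lemma weyl_inverse_top:
  fixes D :: real
  assumes IH: "weyl_inverse d C" and d: "1 \<le> d" and D: "2 \<le> D" and bN: "b \<le> N"
    and N: "D ^ (8 * C + 8) \<le> real N"
    and big: "real N \<le> D * norm (\<Sum>n=a..<b. ue (\<Sum>k\<le>Suc d. x k * real n ^ k))"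
  obtains Q :: nat and z :: int where "1 \<le> Q" "real Q \<le> D ^ (12 * C + d + 14)"
    "\<bar>real Q * x (Suc d) - of_int z\<bar> * real N ^ Suc d \<le> D ^ (12 * C + d + 14)"
proof -
  define f where "f = (\<lambda>n::nat. ue (\<Sum>k\<le>Suc d. x k * real n ^ k))"
  define S where "S = (\<lambda>h. norm (\<Sum>n=a..<b-h. f (n + h) * cnj (f n)))"
  \<comment> \<open>The threshold is D^-4: the lags outside H contribute at most 2 N / D^2 <= N / 2
    to the final inequality, so H has density at least 1 / (4 D^2) >= D^-4.\<close>
  define H where "H = {h\<in>{..<N}. real N \<le> D ^ 4 * S h}"
  have D1: "1 \<le> D" using D by simp
  have pow_mono: "D ^ i \<le> D ^ j" if "i \<le> j" for i j
    using D1 that by (rule power_increasing[rotated])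
  have pow1: "1 \<le> D ^ i" for i using D1 by (rule one_le_power)
  have N1: "1 \<le> real N" using N pow1 by (rule order_trans[rotated])
  have HN: "H \<subseteq> {..<N}" and finH: "finite H" by (auto simp: H_def)
  have S_le: "S h \<le> real N" for h
  proof -
    have "S h \<le> (\<Sum>n=a..<b-h. 1)"
      unfolding S_def by (rule sum_norm_le) (simp add: f_def norm_mult)
    also have "\<dots> \<le> real N" using bN by simp
    finally show ?thesis .
  qed
  have cardH: "real N \<le> D ^ 4 * real (card H)"
  proof -
    have "(real N)\<^sup>2 \<le> (D * norm (\<Sum>n=a..<b. f n))\<^sup>2"
      using big by (intro power_mono) (auto simp: f_def)
    also have "\<dots> \<le> D\<^sup>2 * (2 * (\<Sum>h<N. S h))"
      unfolding power_mult_distrib S_def using weyl_differencing[OF bN, of f a]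
      by (intro mult_left_mono) auto
    also have "(\<Sum>h<N. S h) \<le> (\<Sum>h<N. (if h \<in> H then real N else 0) + real N / D ^ 4)"
    proof (rule sum_mono)
      fix h assume "h \<in> {..<N}"
      show "S h \<le> (if h \<in> H then real N else 0) + real N / D ^ 4"
      proof (cases "h \<in> H")
        case True
        have "0 \<le> real N / D ^ 4" using D1 by simp
        with S_le[of h] show ?thesis unfolding if_P[OF True] by linarith
      next
        case False
        then have "D ^ 4 * S h \<le> real N" using \<open>h \<in> {..<N}\<close> by (auto simp: H_def)
        with False D1 show ?thesis by (simp add: pos_le_divide_eq mult.commute)
      qed
    qed
    also have "\<dots> = real (card H) * real N + real N * (real N / D ^ 4)"
      using HN by (simp add: sum.distrib sum.If_cases Int_absorb1)
    finally have "(real N)\<^sup>2 \<le> D\<^sup>2 * (2 * (real (card H) * real N + real N * (real N / D ^ 4)))"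
      using D1 by simp
    also have "\<dots> = real N * (2 * D\<^sup>2 * real (card H) + 2 * real N / D\<^sup>2)"
      using D1 by (simp add: field_simps power2_eq_square eval_nat_numeral)
    finally have "real N \<le> 2 * D\<^sup>2 * real (card H) + 2 * real N / D\<^sup>2"
      using N1 by (simp add: power2_eq_square)
    also have "2 * real N / D\<^sup>2 \<le> real N / 2"
    proof -
      have "4 \<le> D\<^sup>2" using D power_mono[of 2 D 2] by simp
      then have "4 * real N \<le> D\<^sup>2 * real N" by (intro mult_right_mono) auto
      then show ?thesis using D1 by (simp add: field_simps)
    qed
    finally have "real N \<le> 4 * D\<^sup>2 * real (card H)" by simp
    also have "\<dots> \<le> D ^ 2 * D\<^sup>2 * real (card H)"
      using numeral_le_power[OF D, of 4 2] by (intro mult_right_mono) simp_all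
    finally show ?thesis by (simp flip: power_add)
  qed
  define M where "M = nat \<lfloor>D ^ (4 * C)\<rfloor>"
  have M: "real M \<le> D ^ (4 * C)" "1 \<le> M" and M': "\<And>q. real q \<le> D ^ (4 * C) \<Longrightarrow> q \<le> M"
    using pow1[of "4 * C"] unfolding M_def by (simp_all add: le_nat_floor le_floor_iff)
  \<comment> \<open>The precision that the hypothesis for degree d, applied with D^4 in place of D,
    gives for the top coefficient.\<close>
  define \<epsilon> where "\<epsilon> = D ^ (4 * C) / real N ^ d"
  define x' where "x' = real (Suc d) * x (Suc d)"
  have "\<exists>Q\<in>{1..M}. \<exists>z::int. \<bar>real Q * x' * real h - of_int z\<bar> \<le> \<epsilon>" if "h \<in> H" for h
  proof -
    obtain y where y: "\<And>u. (\<Sum>k\<le>Suc d. x k * (u + real h) ^ k) - (\<Sum>k\<le>Suc d. x k * u ^ k) = (\<Sum>k\<le>d. y k * u ^ k)"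
      and yd: "y d = x (Suc d) * real (Suc d) * real h"
      using poly_difference by metis
    have "f (n + h) * cnj (f n) = ue (\<Sum>k\<le>d. y k * real n ^ k)" for n
      using y[of "real n"] by (simp add: f_def flip: ue_diff)
    then have "real N \<le> D ^ 4 * norm (\<Sum>n=a..<b-h. ue (\<Sum>k\<le>d. y k * real n ^ k))"
      using that by (simp add: H_def S_def)
    moreover have "2 \<le> D ^ 4" using D pow_mono[of 1 4] by simp
    moreover have "b - h \<le> N" "1 \<le> N" using bN N1 by auto
    ultimately obtain Q :: nat where "1 \<le> Q" "real Q \<le> (D ^ 4) ^ C"
      and Qk: "\<forall>k\<in>{1..d}. \<exists>z::int. \<bar>real Q * y k - of_int z\<bar> * real N ^ k \<le> (D ^ 4) ^ C"
      using IH unfolding weyl_inverse_def by blast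
    from d have "d \<in> {1..d}" by simp
    with Qk obtain z :: int where z: "\<bar>real Q * y d - of_int z\<bar> * real N ^ d \<le> D ^ (4 * C)"
      unfolding power_mult by blast
    then have "\<bar>real Q * x' * real h - of_int z\<bar> \<le> \<epsilon>"
      using N1 by (simp add: \<epsilon>_def yd x'_def field_simps)
    with \<open>1 \<le> Q\<close> \<open>real Q \<le> (D ^ 4) ^ C\<close> M' show ?thesis
      by (intro bexI[of _ Q] exI[of _ z]) (auto simp flip: power_mult)
  qed
  then obtain Qf where Qf: "\<And>h. h \<in> H \<Longrightarrow> Qf h \<in> {1..M}"
    "\<And>h. h \<in> H \<Longrightarrow> \<exists>z::int. \<bar>real (Qf h) * x' * real h - of_int z\<bar> \<le> \<epsilon>"
    by metis
  \<comment> \<open>The denominators vary with h. A most popular one keeps a fraction 1 / M of H,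
    which lowers the density from D^-4 to 1 / K with K = D^(4 C + 4).\<close>
  obtain Q0 where Q0: "Q0 \<in> {1..M}" "card H \<le> card (Qf -` {Q0} \<inter> H) * card {1..M}"
    using pigeonhole_card[of Qf H "{1..M}"] Qf(1) finH M(2) by auto
  define H0 where "H0 = Qf -` {Q0} \<inter> H"
  define K where "K = D ^ (4 * C + 4)"
  have dens: "real N \<le> K * real (card H0)"
  proof -
    have "real N \<le> D ^ 4 * real (card H)" by (rule cardH)
    also have "real (card H) \<le> real (card H0) * real M"
      using Q0(2) unfolding H0_def by (metis card_atLeastAtMost diff_Suc_1' of_nat_le_iff of_nat_mult One_nat_def Suc_eq_plus1 diff_add_inverse2)
    also have "\<dots> \<le> real (card H0) * D ^ (4 * C)"
      using M(1) by (intro mult_left_mono) auto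
    finally show ?thesis using D1 by (simp add: K_def power_add mult_ac)
  qed
  have K1: "1 \<le> K" unfolding K_def by (rule pow1)
  have "K * \<epsilon> * real N \<le> D ^ (8 * C + 4)"
  proof -
    have "real N \<le> real N ^ d" using N1 d power_increasing[of 1 d "real N"] by simp
    then have "K * D ^ (4 * C) * real N \<le> K * D ^ (4 * C) * real N ^ d"
      using K1 D1 by (intro mult_left_mono) auto
    then have "K * \<epsilon> * real N \<le> K * D ^ (4 * C)"
      using N1 by (simp add: \<epsilon>_def pos_divide_le_eq)
    also have "\<dots> = D ^ (8 * C + 4)" by (simp add: K_def flip: power_add)
    finally show ?thesis .
  qed
  have "14 * D ^ (8 * C + 4) < D ^ (8 * C + 8)"
  proof -
    have "14 * D ^ (8 * C + 4) < 16 * D ^ (8 * C + 4)" using D1 by simp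
    also have "\<dots> \<le> D ^ 4 * D ^ (8 * C + 4)"
      using D D1 numeral_le_power[OF D, of 16 4] by (intro mult_right_mono) auto
    finally show ?thesis by (simp add: add.commute flip: power_add)
  qed
  with N \<open>K * \<epsilon> * real N \<le> D ^ (8 * C + 4)\<close> have "14 * (K * \<epsilon> * real N) < real N" by linarith
  then have small: "14 * K * \<epsilon> < 1"
    using N1 by (simp add: mult_ac)
  have large: "3 * K \<le> real N"
  proof -
    have "3 * K \<le> D ^ 4 * K"
      using K1 numeral_le_power[OF D, of 3 4] by (intro mult_right_mono) auto
    also have "\<dots> \<le> D ^ (8 * C + 8)"
      unfolding K_def power_add[symmetric] by (rule pow_mono) simp
    finally show ?thesis using N by simp
  qed
  have close: "\<exists>z::int. \<bar>(real Q0 * x') * real h - of_int z\<bar> \<le> \<epsilon>" if "h \<in> H0" for h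
    using Qf(2)[of h] that by (auto simp: H0_def)
  have "H0 \<subseteq> {..<N}" using HN by (auto simp: H0_def)
  from dense_almost_integral_multiples[OF this K1 dens close small large]
  obtain q :: nat and z :: int where q: "1 \<le> q" "real q \<le> 3 * K"
    and z: "\<bar>real q * (real Q0 * x') - of_int z\<bar> * real N \<le> 36 * K\<^sup>2 * \<epsilon>" .
  \<comment> \<open>The factor d + 1 comes from the leading coefficient of the difference,
    \<open>Q0\<close> from the pigeonhole and \<open>q\<close> from the dense multiples.\<close>
  define Q where "Q = q * Q0 * Suc d"
  show thesis
  proof (rule that[of Q z])
    show "1 \<le> Q" using q(1) Q0(1) by (simp add: Q_def Suc_le_eq)
    have "real q * real Q0 * real (Suc d) \<le> (D ^ 2 * K) * D ^ (4 * C) * D ^ d"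
    proof (intro mult_mono)
      show "real q \<le> D ^ 2 * K"
        using K1 numeral_le_power[OF D, of 3 2] by (intro order_trans[OF q(2)] mult_right_mono) auto
      show "real Q0 \<le> D ^ (4 * C)" using Q0(1) M(1) by force
      show "real (Suc d) \<le> D ^ d" by (rule numeral_le_power[OF D]) (metis Suc_leI less_exp)
    qed (use K1 D1 in auto)
    also have "\<dots> = D ^ (8 * C + d + 6)" by (simp add: K_def ac_simps flip: power_add)
    also have "\<dots> \<le> D ^ (12 * C + d + 14)" by (rule pow_mono) simp
    finally show "real Q \<le> D ^ (12 * C + d + 14)" by (simp only: Q_def of_nat_mult)
    have "real Q * x (Suc d) = real q * (real Q0 * x')" by (simp add: Q_def x'_def algebra_simps)
    then have "\<bar>real Q * x (Suc d) - of_int z\<bar> * real N ^ Suc d =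
        (\<bar>real q * (real Q0 * x') - of_int z\<bar> * real N) * real N ^ d" by (simp add: mult_ac)
    also have "\<dots> \<le> (36 * K\<^sup>2 * \<epsilon>) * real N ^ d"
      by (intro mult_right_mono z) auto
    also have "\<dots> = 36 * D ^ (12 * C + 8)"
      using N1 by (simp add: \<epsilon>_def K_def flip: power_add power_mult)
    also have "\<dots> \<le> D ^ 6 * D ^ (12 * C + 8)"
      using D D1 numeral_le_power[OF D, of 36 6] by (intro mult_right_mono) auto
    also have "\<dots> \<le> D ^ (12 * C + d + 14)"
      unfolding power_add[symmetric] by (rule pow_mono) simp
    finally show "\<bar>real Q * x (Suc d) - of_int z\<bar> * real N ^ Suc d \<le> D ^ (12 * C + d + 14)" .
  qed
qed

text \<open>
  Once the top coefficient is close to \<open>z1 / Q1\<close>, its fractional part is expanded into characters modulo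
  \<open>Q1\<close>, which only perturb the linear coefficient, and the slowly varying remainder is removed by summation by parts.
\<close>

lemma weyl_inverse_step:
  assumes IH: "weyl_inverse d C" and d: "1 \<le> d"
  shows "\<exists>C'. weyl_inverse (Suc d) C'"
proof -
  define F where "F = 12 * C + d + 14"
  define E where "E = 8 * C + 8"
  \<comment> \<open>D^F bounds the number of characters, D^(F + 3) the variation of the slowly
    varying factor, and D^2 is left for the contradiction.\<close>
  define G where "G = 2 * F + 5"
  define C' where "C' = E * Suc d + F + F + G * C"
  have "weyl_inverse (Suc d) C'"
    unfolding weyl_inverse_def
  proof (intro allI impI)
    fix x :: "nat \<Rightarrow> real" and D :: real and N a b :: nat
    assume D: "2 \<le> D" and bN: "b \<le> N" and N1: "1 \<le> N"
      and big: "real N \<le> D * norm (\<Sum>n=a..<b. ue (\<Sum>k\<le>Suc d. x k * real n ^ k))"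
    have D1: "1 \<le> D" using D by simp
    have pow_mono: "D ^ i \<le> D ^ j" if "i \<le> j" for i j
      using D1 that by (rule power_increasing[rotated])
    have pow1: "1 \<le> D ^ i" for i using D1 by (rule one_le_power)
    show "\<exists>Q::nat. 1 \<le> Q \<and> real Q \<le> D ^ C' \<and>
           (\<forall>k\<in>{1..Suc d}. \<exists>z::int. \<bar>real Q * x k - of_int z\<bar> * real N ^ k \<le> D ^ C')"
    proof (cases "D ^ E \<le> real N")
      \<comment> \<open>Below the length threshold of \<open>weyl_inverse_top\<close> each N^k is a
        bounded power of D, so Q = 1 and nearest integers suffice.\<close>
      case False
      have "\<bar>real 1 * x k - of_int (round (x k))\<bar> * real N ^ k \<le> D ^ C'" if "k \<in> {1..Suc d}" for k
      proof -
        have "\<bar>real 1 * x k - of_int (round (x k))\<bar> * real N ^ k \<le> 1 * (D ^ E) ^ k"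
          using of_int_round_abs_le[of "x k"] False
          by (intro mult_mono power_mono) (auto simp: abs_minus_commute)
        also have "\<dots> \<le> D ^ C'"
          using that mult_le_mono2[of k "Suc d" E] unfolding mult_1_left power_mult[symmetric]
          by (intro pow_mono) (auto simp: C'_def)
        finally show ?thesis .
      qed
      then show ?thesis using pow1 by (intro exI[of _ "1::nat"]) fastforce
    next
      case True
      obtain Q1 :: nat and z1 :: int where Q1: "1 \<le> Q1" "real Q1 \<le> D ^ F"
        and z1: "\<bar>real Q1 * x (Suc d) - of_int z1\<bar> * real N ^ Suc d \<le> D ^ F"
        using weyl_inverse_top[OF IH d D bN True[unfolded E_def] big] unfolding F_def .
      have Q1r: "real Q1 \<ge> 1" using Q1(1) by simp
      define \<beta> where "\<beta> = x (Suc d) - of_int z1 / real Q1"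
      have \<beta>: "\<bar>\<beta>\<bar> * real N ^ Suc d \<le> D ^ F"
      proof -
        have "\<bar>\<beta>\<bar> \<le> real Q1 * \<bar>\<beta>\<bar>" using Q1r by (simp add: mult_le_cancel_right1)
        also have "real Q1 * \<bar>\<beta>\<bar> = \<bar>real Q1 * \<beta>\<bar>" by (simp add: abs_mult)
        also have "real Q1 * \<beta> = real Q1 * x (Suc d) - of_int z1"
          using Q1r by (simp add: \<beta>_def field_simps)
        finally show ?thesis using z1
          by (meson mult_right_mono order_trans of_nat_0_le_iff zero_le_power)
      qed
      define w where "w = (\<lambda>n::nat. ue (\<beta> * real n ^ Suc d))"
      have var: "norm (w b) + (\<Sum>n=a..<b. norm (w (Suc n) - w n)) \<le> D ^ (F + 3)"
      proof (cases "a \<le> b")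
        case True
        have "norm (w (Suc n) - w n) \<le> 2 * pi * \<bar>\<beta>\<bar> * (real (Suc n) ^ Suc d - real n ^ Suc d)" for n
        proof -
          have "norm (w (Suc n) - w n) \<le> 2 * pi * \<bar>\<beta> * real (Suc n) ^ Suc d - \<beta> * real n ^ Suc d\<bar>"
            unfolding w_def by (rule norm_ue_diff_le)
          also have "\<beta> * real (Suc n) ^ Suc d - \<beta> * real n ^ Suc d = \<beta> * (real (Suc n) ^ Suc d - real n ^ Suc d)"
            by (simp only: right_diff_distrib)
          also have "\<bar>\<dots>\<bar> = \<bar>\<beta>\<bar> * (real (Suc n) ^ Suc d - real n ^ Suc d)"
            unfolding abs_mult using power_mono[of "real n" "real (Suc n)" "Suc d"] by (simp del: power_Suc)
          finally show ?thesis by (simp only: mult.assoc)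
        qed
        then have "(\<Sum>n=a..<b. norm (w (Suc n) - w n)) \<le> 2 * pi * \<bar>\<beta>\<bar> * (\<Sum>n=a..<b. real (Suc n) ^ Suc d - real n ^ Suc d)"
          unfolding sum_distrib_left by (rule sum_mono)
        also have "(\<Sum>n=a..<b. real (Suc n) ^ Suc d - real n ^ Suc d) = real b ^ Suc d - real a ^ Suc d"
          using True by (rule sum_Suc_diff')
        also have "\<dots> \<le> real N ^ Suc d"
        proof -
          have "real b ^ Suc d \<le> real N ^ Suc d" using bN by (intro power_mono) auto
          moreover have "0 \<le> real a ^ Suc d" by simp
          ultimately show ?thesis by linarith
        qed
        also have "2 * pi * \<bar>\<beta>\<bar> * real N ^ Suc d \<le> 2 * pi * D ^ F"
          using \<beta> by (simp add: mult.assoc del: power_Suc)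
        finally have "norm (w b) + (\<Sum>n=a..<b. norm (w (Suc n) - w n)) \<le> 1 + 2 * pi * D ^ F"
          by (simp add: w_def mult_left_mono)
        also have "\<dots> \<le> D ^ F + 7 * D ^ F"
          using pow1[of F] pi_approx by (intro add_mono mult_right_mono) auto
        also have "\<dots> \<le> D ^ 3 * D ^ F"
          using numeral_le_power[OF D, of 8 3] D1 mult_right_mono[of 8 "D ^ 3" "D ^ F"] by simp
        finally show ?thesis by (simp add: power_add mult.commute)
      next
        case False
        then show ?thesis using pow1 by (simp add: w_def)
      qed
      define f where "f = (\<lambda>l::int. ue (of_int (z1 * l ^ Suc d) / real Q1))"
      have "f (l + int Q1) = f l" for l
        unfolding f_def
      proof (rule ue_cong_int)
        have "of_int (z1 * (l + int Q1) ^ Suc d) / real Q1 - of_int (z1 * l ^ Suc d) / real Q1 =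
            of_int z1 / real Q1 * (of_int (l + int Q1) ^ Suc d - of_int l ^ Suc d)"
          by (simp only: of_int_mult of_int_power right_diff_distrib times_divide_eq_left)
        also have "\<dots> \<in> \<int>" using Q1(1) by (intro rational_power_shift_in_Ints) simp
        finally show "of_int (z1 * (l + int Q1) ^ Suc d) / real Q1 - of_int (z1 * l ^ Suc d) / real Q1 \<in> \<int>" .
      qed
      moreover have "norm (f l) \<le> 1" for l by (simp add: f_def)
      ultimately obtain c where c: "\<And>l. f l = (\<Sum>s<Q1. c s * ue (real s * of_int l / real Q1))" "\<And>s. norm (c s) \<le> 1"
        using finite_fourier_expansion[of Q1 f] Q1(1) by auto
      define x' where "x' = (\<lambda>s k. if k = 1 then x k + real s / real Q1 else x k)"
      define g where "g = (\<lambda>s (n::nat). ue (\<Sum>k\<le>d. x' s k * real n ^ k))"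
      have g: "g s n = ue (\<Sum>k\<le>d. x k * real n ^ k) * ue (real s * real n / real Q1)" for s n
      proof -
        have "(\<Sum>k\<le>d. x' s k * real n ^ k) = (\<Sum>k\<le>d. x k * real n ^ k + (if k = 1 then real s / real Q1 * real n else 0))"
          by (intro sum.cong) (auto simp: x'_def algebra_simps)
        also have "\<dots> = (\<Sum>k\<le>d. x k * real n ^ k) + real s * real n / real Q1"
          using d by (simp add: sum.distrib)
        finally show ?thesis by (simp add: g_def ue_add)
      qed
      have split: "ue (\<Sum>k\<le>Suc d. x k * real n ^ k) = (\<Sum>s<Q1. c s * (g s n * w n))" for n
      proof -
        have "(\<Sum>k\<le>Suc d. x k * real n ^ k) = (\<Sum>k\<le>d. x k * real n ^ k) + of_int (z1 * int n ^ Suc d) / real Q1 + \<beta> * real n ^ Suc d"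
          by (simp add: \<beta>_def algebra_simps)
        then have "ue (\<Sum>k\<le>Suc d. x k * real n ^ k) = ue (\<Sum>k\<le>d. x k * real n ^ k) * f (int n) * w n"
          by (simp only: ue_add f_def w_def)
        then show ?thesis by (simp add: c(1) g sum_distrib_left sum_distrib_right mult_ac)
      qed
      \<comment> \<open>Partial summation asks for all initial segments of each twisted sum to be
        small, so the large one may end at some e < b; the induction hypothesis admits any end up to
        N.\<close>
      have "\<exists>s e. e \<le> b \<and> real N \<le> D ^ G * norm (\<Sum>n=a..<e. g s n)"
      proof (rule ccontr)
        assume "\<not> ?thesis"
        then have sm: "norm (\<Sum>n=a..<e. g s n) \<le> real N / D ^ G" if "e \<le> b" for s e
        proof -
          have "D ^ G * norm (\<Sum>n=a..<e. g s n) < real N"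
            using that \<open>\<not> (\<exists>s e. e \<le> b \<and> real N \<le> D ^ G * norm (\<Sum>n=a..<e. g s n))\<close> by (metis not_le)
          then show ?thesis using D1 by (simp add: field_simps)
        qed
        have "a \<le> b"
        proof (rule ccontr)
          assume "\<not> a \<le> b"
          with big N1 show False by simp
        qed
        have "(\<Sum>n=a..<b. ue (\<Sum>k\<le>Suc d. x k * real n ^ k)) = (\<Sum>s<Q1. c s * (\<Sum>n=a..<b. g s n * w n))"
          unfolding split sum_distrib_left by (rule sum.swap)
        also have "norm \<dots> \<le> (\<Sum>s<Q1. real N / D ^ G * D ^ (F + 3))"
        proof (rule sum_norm_le)
          fix s
          have "norm (c s * (\<Sum>n=a..<b. g s n * w n)) \<le> 1 * norm (\<Sum>n=a..<b. g s n * w n)"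
            unfolding norm_mult using c(2) by (intro mult_right_mono) auto
          also have "\<dots> \<le> real N / D ^ G * (norm (w b) + (\<Sum>n=a..<b. norm (w (Suc n) - w n)))"
            unfolding mult_1_left by (rule abel_summation_bound[OF \<open>a \<le> b\<close> sm])
          also have "\<dots> \<le> real N / D ^ G * D ^ (F + 3)"
            using var D1 by (intro mult_left_mono) auto
          finally show "norm (c s * (\<Sum>n=a..<b. g s n * w n)) \<le> real N / D ^ G * D ^ (F + 3)" .
        qed
        also have "\<dots> \<le> D ^ F * (real N / D ^ G * D ^ (F + 3))"
          unfolding sum_constant card_lessThan using Q1(2) D1 by (intro mult_right_mono) auto
        also have "\<dots> = real N / D ^ 2"
        proof -
          have "D ^ G = D ^ F * D ^ (F + 3) * D ^ 2" by (simp add: G_def add.commute flip: power_add)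
          then show ?thesis using D1 by simp
        qed
        finally have "D * norm (\<Sum>n=a..<b. ue (\<Sum>k\<le>Suc d. x k * real n ^ k)) \<le> D * (real N / D ^ 2)"
          using D1 by (intro mult_left_mono) auto
        also have "\<dots> = real N / D" using D1 by (simp add: power2_eq_square)
        also have "\<dots> < real N" using D N1 by (simp add: divide_less_eq)
        finally show False using big by simp
      qed
      then obtain s e where "e \<le> b" and "real N \<le> D ^ G * norm (\<Sum>n=a..<e. g s n)" by blast
      moreover have "2 \<le> D ^ G" using D pow_mono[of 1 G] by (simp add: G_def)
      ultimately obtain Q2 :: nat where Q2: "1 \<le> Q2" "real Q2 \<le> D ^ (G * C)"
        "\<forall>k\<in>{1..d}. \<exists>z::int. \<bar>real Q2 * x' s k - of_int z\<bar> * real N ^ k \<le> D ^ (G * C)"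
        using IH bN N1 unfolding weyl_inverse_def g_def power_mult by (meson order_trans)
      have le1: "D ^ F * D ^ (G * C) \<le> D ^ C'"
        unfolding power_add[symmetric] by (rule pow_mono) (simp add: C'_def)
      have "\<exists>z::int. \<bar>real (Q1 * Q2) * x k - of_int z\<bar> * real N ^ k \<le> D ^ C'" if k: "k \<in> {1..Suc d}" for k
      proof (cases "k = Suc d")
        case True
        have "real (Q1 * Q2) * x k - of_int (int Q2 * z1) = real Q2 * (real Q1 * x (Suc d) - of_int z1)"
          by (simp add: True algebra_simps)
        then have "\<bar>real (Q1 * Q2) * x k - of_int (int Q2 * z1)\<bar> * real N ^ k =
           real Q2 * (\<bar>real Q1 * x (Suc d) - of_int z1\<bar> * real N ^ Suc d)"
          by (simp add: True abs_mult)
        also have "\<dots> \<le> D ^ (G * C) * D ^ F"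
          using Q2(2) z1 D1 by (intro mult_mono) auto
        finally show ?thesis using le1 by (intro exI[of _ "int Q2 * z1"]) (simp add: mult.commute)
      next
        case False
        with k have "k \<in> {1..d}" by auto
        then obtain z :: int where z: "\<bar>real Q2 * x' s k - of_int z\<bar> * real N ^ k \<le> D ^ (G * C)"
          using Q2(3) by blast
        \<comment> \<open>Multiplication by \<open>Q1\<close> makes the twist s / Q1 of the linear
          coefficient integral; it shifts the nearby integer by \<open>Q2 * s\<close>.\<close>
        define y where "y = int Q1 * z - (if k = 1 then int Q2 * int s else 0)"
        have "real (Q1 * Q2) * x k - of_int y = real Q1 * (real Q2 * x' s k - of_int z)"
          using Q1r by (simp add: y_def x'_def algebra_simps)
        then have "\<bar>real (Q1 * Q2) * x k - of_int y\<bar> * real N ^ k = real Q1 * (\<bar>real Q2 * x' s k - of_int z\<bar> * real N ^ k)"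
          by (simp add: abs_mult)
        also have "\<dots> \<le> D ^ F * D ^ (G * C)"
          using Q1(2) z D1 by (intro mult_mono) auto
        finally show ?thesis using le1 by (intro exI[of _ y]) simp
      qed
      moreover have "real (Q1 * Q2) \<le> D ^ C'"
        using mult_mono[OF Q1(2) Q2(2)] D1 le1 by simp
      ultimately show ?thesis using Q1(1) Q2(1) by (intro exI[of _ "Q1 * Q2"]) auto
    qed
  qed
  then show ?thesis by blast
qed

theorem weyl_inverse_exists:
  assumes "1 \<le> d"
  shows "\<exists>C. weyl_inverse d C"
  using assms
proof (induction d rule: dec_induct)
  case base
  then show ?case using weyl_inverse_linear by blast
next
  case (step d)
  then show ?case using weyl_inverse_step by blast
qed

section \<open>Dyadic blocks of symmetric exponential series\<close>

lemma sum_period_shift: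
  fixes h :: "int \<Rightarrow> complex"
  assumes per: "\<And>l. h (l + int Q) = h l"
  shows "(\<Sum>l=a..<a+Q. h (int l)) = (\<Sum>l<Q. h (int l))"
proof (induction a)
  case 0
  then show ?case by (simp add: lessThan_atLeast0)
next
  case (Suc a)
  have "(\<Sum>l=a..<Suc (a+Q). h (int l)) = h (int a) + (\<Sum>l=Suc a..<Suc (a+Q). h (int l))"
    by (rule sum.atLeast_Suc_lessThan) simp
  with Suc per[of "int a"] show ?case by simp
qed

text \<open>Reflection permutes the residues modulo Q, so both halves are the same complete sum.
  This is the cancellation of l and -l on major arcs.\<close>

lemma sum_period_reflect:
  fixes f :: "int \<Rightarrow> complex"
  assumes per: "\<And>l. f (l + int Q) = f l"
  shows "(\<Sum>l=a..<a+Q. f (int l) - f (- int l)) = 0"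
proof -
  have per': "f (- (l + int Q)) = f (- l)" for l
    using per[of "- (l + int Q)"] by simp
  have "(\<Sum>l=a..<a+Q. f (- int l)) = (\<Sum>l=1..<1+Q. f (- int l))"
    unfolding sum_period_shift[of "\<lambda>l. f (- l)", OF per'] by (rule refl)
  also have "\<dots> = (\<Sum>i<Q. f (- int (Suc i)))"
    by (rule sum.reindex_bij_witness[of _ Suc "\<lambda>l. l - 1"]) auto
  also have "\<dots> = (\<Sum>i<Q. f (int (Q - Suc i)))"
  proof (rule sum.cong[OF refl])
    fix i assume "i \<in> {..<Q}"
    then have "int (Q - Suc i) = - int (Suc i) + int Q" by (simp add: of_nat_diff)
    then show "f (- int (Suc i)) = f (int (Q - Suc i))" by (metis per)
  qed
  also have "\<dots> = (\<Sum>l<Q. f (int l))" by (rule sum.nat_diff_reindex)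
  finally show ?thesis
    using sum_period_shift[of f Q a, OF per] by (simp add: sum_subtractf)
qed

lemma norm_sum_period_zero:
  fixes g :: "nat \<Rightarrow> complex"
  assumes Q: "Q \<ge> 1" and zero: "\<And>a. (\<Sum>l=a..<a+Q. g l) = 0" and bound: "\<And>l. norm (g l) \<le> 2"
  shows "norm (\<Sum>l=a..<c. g l) \<le> 2 * real Q"
proof (induction "c - a" arbitrary: a rule: less_induct)
  case less
  show ?case
  proof (cases "c \<le> a + Q")
    case True
    have "norm (\<Sum>l=a..<c. g l) \<le> (\<Sum>l=a..<c. 2)"
      by (rule sum_norm_le) (rule bound)
    also have "\<dots> \<le> 2 * real Q" using True by simp
    finally show ?thesis .
  next
    case False
    then have "(\<Sum>l=a..<c. g l) = (\<Sum>l=a..<a+Q. g l) + (\<Sum>l=a+Q..<c. g l)"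
      by (intro sum.atLeastLessThan_concat[symmetric]) auto
    with zero less[of "a + Q"] False Q show ?thesis by simp
  qed
qed

text \<open>The weights 1 / l are monotone, so the last weight and the variation telescope to
  exactly 1 / M.\<close>

lemma abel_dyadic_inverse:
  fixes g :: "nat \<Rightarrow> complex"
  assumes M: "1 \<le> M" and B: "\<And>c. norm (\<Sum>l=M..<c. g l) \<le> B"
  shows "norm (\<Sum>l=M..<2*M. g l / of_nat l) \<le> B / real M"
proof -
  define w where "w = (\<lambda>l::nat. 1 / of_nat l :: complex)"
  have dw: "norm (w (Suc n) - w n) = (- 1 / real (Suc n)) - (- 1 / real n)" if "n \<in> {M..<2*M}" for n
  proof -
    have n: "n > 0" using that M by simp
    have "w (Suc n) - w n = of_real (1 / real (Suc n) - 1 / real n)"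
      by (simp add: w_def)
    then have "norm (w (Suc n) - w n) = \<bar>1 / real (Suc n) - 1 / real n\<bar>"
      by (simp only: norm_of_real)
    then show ?thesis using n by (simp add: frac_le)
  qed
  have "(\<Sum>n=M..<2*M. norm (w (Suc n) - w n)) = (\<Sum>n=M..<2*M. (- 1 / real (Suc n)) - (- 1 / real n))"
    by (rule sum.cong[OF refl]) (rule dw)
  also have "\<dots> = - 1 / real (2 * M) - (- 1 / real M)"
    by (rule sum_Suc_diff') simp
  finally have "norm (w (2 * M)) + (\<Sum>n=M..<2*M. norm (w (Suc n) - w n)) = 1 / real M"
    using M by (simp add: w_def norm_divide norm_mult)
  moreover have "norm (\<Sum>l=M..<2*M. g l * w l) \<le> B * (norm (w (2 * M)) + (\<Sum>n=M..<2*M. norm (w (Suc n) - w n)))"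
    by (rule abel_summation_bound) (use B in auto)
  ultimately show ?thesis by (simp add: w_def)
qed

definition pphase :: "(nat \<Rightarrow> real) \<Rightarrow> nat \<Rightarrow> int \<Rightarrow> real" where
  "pphase x d l = (\<Sum>k\<le>d. x k * of_int l ^ k)"

text \<open>The terms N <= |l| < 2 N of the symmetric series of e(P(l)) / l; the minus sign is that
  of 1 / (-l).\<close>

definition block :: "(nat \<Rightarrow> real) \<Rightarrow> nat \<Rightarrow> nat \<Rightarrow> complex" where
  "block x d N = (\<Sum>l=N..<2*N. (ue (pphase x d (int l)) - ue (pphase x d (- int l))) / of_nat l)"

text \<open>With \<open>z k / Q\<close> in place of \<open>x k\<close> the exponentials are
  Q-periodic, reflection cancels complete periods, and 2 Q / M remains. The replacement moves each
  of the two exponentials by at most 2 \<pi> d \<eta>, and 4 \<pi> < 13. The constant coefficient is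
  kept, since it does not affect periodicity.\<close>

lemma norm_block_major:
  assumes Q: "1 \<le> Q" and M: "1 \<le> M"
    and close: "\<And>k. k \<in> {1..d} \<Longrightarrow> \<bar>x k - of_int (z k) / real Q\<bar> * (2 * real M) ^ k \<le> \<eta>"
  shows "norm (block x d M) \<le> 2 * real Q / real M + 13 * real d * \<eta>"
proof -
  define y where "y = (\<lambda>k. if k = 0 then x 0 else of_int (z k) / real Q)"
  define f where "f = (\<lambda>l. ue (pphase y d l))"
  define g where "g = (\<lambda>l::nat. f (int l) - f (- int l))"
  have Q0: "real Q > 0" using Q by simp
  have per: "f (l + int Q) = f l" for l
    unfolding f_def
  proof (rule ue_cong_int)
    have "pphase y d (l + int Q) - pphase y d l = (\<Sum>k\<le>d. y k * (of_int (l + int Q) ^ k - of_int l ^ k))"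
      by (simp only: pphase_def right_diff_distrib sum_subtractf)
    moreover have "(\<Sum>k\<le>d. y k * (of_int (l + int Q) ^ k - of_int l ^ k)) \<in> \<int>"
    proof (rule Ints_sum)
      fix k
      show "y k * (of_int (l + int Q) ^ k - of_int l ^ k) \<in> \<int>"
        using rational_power_shift_in_Ints[of Q "z k" l k] Q by (cases "k = 0") (auto simp: y_def)
    qed
    ultimately show "pphase y d (l + int Q) - pphase y d l \<in> \<int>" by (simp only:)
  qed
  have "norm (g l) \<le> 2" for l
    unfolding g_def using norm_triangle_ineq4[of "f (int l)" "f (- int l)"] by (simp add: f_def)
  moreover have "(\<Sum>l=a..<a+Q. g l) = 0" for a
    unfolding g_def by (rule sum_period_reflect) (rule per)
  ultimately have "norm (\<Sum>l=M..<c. g l) \<le> 2 * real Q" for c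
    by (intro norm_sum_period_zero[OF Q])
  then have main: "norm (\<Sum>l=M..<2*M. g l / of_nat l) \<le> 2 * real Q / real M"
    by (rule abel_dyadic_inverse[OF M])
  have close': "norm (ue (pphase x d l) - f l) \<le> 2 * pi * (real d * \<eta>)" if "\<bar>l\<bar> \<le> 2 * int M" for l
  proof -
    have "pphase x d l - pphase y d l = (\<Sum>k\<le>d. (x k - y k) * of_int l ^ k)"
      by (simp add: pphase_def left_diff_distrib sum_subtractf)
    also have "\<dots> = (\<Sum>k=1..d. (x k - y k) * of_int l ^ k)"
      by (rule sum.mono_neutral_right) (auto simp: y_def)
    finally have eq: "pphase x d l - pphase y d l = (\<Sum>k=1..d. (x k - y k) * of_int l ^ k)" .
    have "\<bar>\<Sum>k=1..d. (x k - y k) * of_int l ^ k\<bar> \<le> (\<Sum>k=1..d. \<eta>)"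
    proof (rule order_trans[OF sum_abs sum_mono])
      fix k assume k: "k \<in> {1..d}"
      have "real_of_int \<bar>l\<bar> \<le> real_of_int (2 * int M)" using that by (simp only: of_int_le_iff)
      then have "\<bar>real_of_int l\<bar> ^ k \<le> (2 * real M) ^ k" by (intro power_mono) auto
      then have "\<bar>(x k - y k) * of_int l ^ k\<bar> \<le> \<bar>x k - y k\<bar> * (2 * real M) ^ k"
        unfolding abs_mult power_abs by (intro mult_left_mono) auto
      also have "\<dots> \<le> \<eta>" using close[OF k] k by (simp add: y_def)
      finally show "\<bar>(x k - y k) * of_int l ^ k\<bar> \<le> \<eta>" .
    qed
    then have "\<bar>pphase x d l - pphase y d l\<bar> \<le> real d * \<eta>" by (simp add: eq)
    then have "2 * pi * \<bar>pphase x d l - pphase y d l\<bar> \<le> 2 * pi * (real d * \<eta>)" by simp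
    with norm_ue_diff_le show ?thesis unfolding f_def by (rule order_trans)
  qed
  have "block x d M - (\<Sum>l=M..<2*M. g l / of_nat l) =
      (\<Sum>l=M..<2*M. ((ue (pphase x d (int l)) - f (int l)) - (ue (pphase x d (- int l)) - f (- int l))) / of_nat l)"
    unfolding block_def sum_subtractf[symmetric]
    by (intro sum.cong refl) (simp add: g_def diff_divide_distrib)
  also have "norm \<dots> \<le> (\<Sum>l=M..<2*M. 13 * real d * \<eta> / real M)"
  proof (rule sum_norm_le)
    fix l assume l: "l \<in> {M..<2*M}"
    let ?u = "ue (pphase x d (int l)) - f (int l)" and ?v = "ue (pphase x d (- int l)) - f (- int l)"
    have "norm (?u - ?v) \<le> norm ?u + norm ?v" by (rule norm_triangle_ineq4)
    also have "\<dots> \<le> 2 * pi * (real d * \<eta>) + 2 * pi * (real d * \<eta>)"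
      using l by (intro add_mono close') auto
    finally have 1: "norm (?u - ?v) \<le> 4 * pi * (real d * \<eta>)" by (simp add: mult_ac)
    then have "0 \<le> pi * (real d * \<eta>)" using norm_ge_zero[of "?u - ?v"] by linarith
    then have "0 \<le> real d * \<eta>" by (simp only: zero_le_mult_iff[of pi]) (use pi_gt_zero in linarith)
    then have "4 * pi * (real d * \<eta>) \<le> 13 * (real d * \<eta>)"
      using pi_approx by (intro mult_right_mono) auto
    with 1 have "norm (?u - ?v) \<le> 13 * real d * \<eta>" by simp
    then have "norm (?u - ?v) / real l \<le> 13 * real d * \<eta> / real M"
      using l M \<open>0 \<le> real d * \<eta>\<close> by (intro frac_le) (auto simp: mult_ac)
    then show "norm ((?u - ?v) / of_nat l) \<le> 13 * real d * \<eta> / real M"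
      by (simp add: norm_divide)
  qed
  also have "\<dots> = 13 * real d * \<eta>" using M by simp
  finally have "norm (block x d M - (\<Sum>l=M..<2*M. g l / of_nat l)) \<le> 13 * real d * \<eta>" .
  with main show ?thesis
    using norm_triangle_sub[of "block x d M" "\<Sum>l=M..<2*M. g l / of_nat l"] by linarith
qed

text \<open>Partial summation removes the weights 1 / l. The inverse theorem is applied with D^4: if
  all unweighted sums were below 2 N / D^4, the weighted one would be at most 2 / D^4, and 2 D * 2 /
  D^4 < 1.\<close>

lemma weyl_inverse_weighted:
  fixes D :: real
  assumes W: "weyl_inverse d C" and D: "2 \<le> D" and N: "1 \<le> N"
    and big: "1 \<le> 2 * D * norm (\<Sum>l=N..<2*N. ue (pphase x d (int l)) / of_nat l)"
  obtains Q :: nat and z :: "nat \<Rightarrow> int" where "1 \<le> Q" "real Q \<le> D ^ (4 * C)"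
    "\<And>k. k \<in> {1..d} \<Longrightarrow> \<bar>real Q * x k - of_int (z k)\<bar> * real N ^ k \<le> D ^ (4 * C)"
proof -
  have D1: "1 \<le> D" using D by simp
  have "\<exists>c\<le>2*N. real (2 * N) \<le> D ^ 4 * norm (\<Sum>l=N..<c. ue (pphase x d (int l)))"
  proof (rule ccontr)
    assume *: "\<not> ?thesis"
    \<comment> \<open>Cut off at 2 N, because \<open>abel_dyadic_inverse\<close> asks for a bound on
      partial sums with arbitrary end.\<close>
    define u where "u = (\<lambda>l. if l < 2 * N then ue (pphase x d (int l)) else 0)"
    have u: "norm (\<Sum>l=N..<c. u l) \<le> 2 * real N / D ^ 4" for c
    proof -
      have "(\<Sum>l=N..<c. u l) = (\<Sum>l=N..<min c (2*N). ue (pphase x d (int l)))"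
        unfolding u_def by (rule sum.mono_neutral_cong_right) auto
      moreover have "D ^ 4 * norm (\<Sum>l=N..<min c (2*N). ue (pphase x d (int l))) < real (2 * N)"
        using * by (meson min.cobounded2 not_le)
      ultimately show ?thesis using D1 by (simp add: field_simps)
    qed
    have "(\<Sum>l=N..<2*N. ue (pphase x d (int l)) / of_nat l) = (\<Sum>l=N..<2*N. u l / of_nat l)"
      by (rule sum.cong) (auto simp: u_def)
    then have "norm (\<Sum>l=N..<2*N. ue (pphase x d (int l)) / of_nat l) \<le> 2 * real N / D ^ 4 / real N"
      using abel_dyadic_inverse[OF N u] by simp
    then have "2 * D * norm (\<Sum>l=N..<2*N. ue (pphase x d (int l)) / of_nat l) \<le> 2 * D * (2 / D ^ 4)"
      using N D1 by (intro mult_left_mono) auto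
    also have "\<dots> = 4 / D ^ 3" using D1 by (simp add: eval_nat_numeral)
    also have "\<dots> < 1"
      using numeral_le_power[OF D, of 8 3] D1 by (simp add: divide_less_eq)
    finally show False using big by simp
  qed
  then obtain c where "c \<le> 2 * N"
    and "real (2 * N) \<le> D ^ 4 * norm (\<Sum>l=N..<c. ue (\<Sum>k\<le>d. x k * real l ^ k))"
    by (auto simp: pphase_def)
  moreover have "2 \<le> D ^ 4"
    using D power_increasing[of 1 4 D] by simp
  ultimately obtain Q :: nat where Q: "1 \<le> Q" "real Q \<le> D ^ (4 * C)"
    "\<forall>k\<in>{1..d}. \<exists>z::int. \<bar>real Q * x k - of_int z\<bar> * real (2 * N) ^ k \<le> D ^ (4 * C)"
    using W[unfolded weyl_inverse_def, THEN spec[of _ x], THEN spec[of _ "D ^ 4"], THEN spec[of _ "2 * N"],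
        THEN spec[of _ N], THEN spec[of _ c]] N unfolding power_mult by auto
  from Q(3) obtain z where z: "\<And>k. k \<in> {1..d} \<Longrightarrow> \<bar>real Q * x k - of_int (z k)\<bar> * real (2 * N) ^ k \<le> D ^ (4 * C)"
    by metis
  have "\<bar>real Q * x k - of_int (z k)\<bar> * real N ^ k \<le> D ^ (4 * C)" if "k \<in> {1..d}" for k
  proof -
    have "real N ^ k \<le> real (2 * N) ^ k" by (intro power_mono) auto
    then have "\<bar>real Q * x k - of_int (z k)\<bar> * real N ^ k \<le> \<bar>real Q * x k - of_int (z k)\<bar> * real (2 * N) ^ k"
      by (rule mult_left_mono) simp
    with z[OF that] show ?thesis by linarith
  qed
  with Q(1,2) show thesis by (rule that[of Q z])
qed

text \<open>One of the halves l > 0 and l < 0 has norm at least 1 / (2 D). Reflection changes only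
  the signs of the odd coefficients, so the negative half gives approximations to the same x after
  flipping signs of numerators.\<close>

lemma weyl_inverse_block:
  fixes D :: real
  assumes W: "weyl_inverse d C" and D: "2 \<le> D" and N: "1 \<le> N"
    and big: "1 \<le> D * norm (block x d N)"
  obtains Q :: nat and z :: "nat \<Rightarrow> int" where "1 \<le> Q" "real Q \<le> D ^ (4 * C)"
    "\<And>k. k \<in> {1..d} \<Longrightarrow> \<bar>real Q * x k - of_int (z k)\<bar> * real N ^ k \<le> D ^ (4 * C)"
proof -
  define x' where "x' = (\<lambda>k. (- 1) ^ k * x k)"
  let ?S = "\<lambda>y. \<Sum>l=N..<2*N. ue (pphase y d (int l)) / of_nat l"
  have x': "pphase x d (- l) = pphase x' d l" for l
    unfolding pphase_def x'_def by (intro sum.cong refl) (simp add: power_minus[of "of_int l"])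
  have "block x d N = ?S x - ?S x'"
    by (simp add: block_def x' diff_divide_distrib sum_subtractf)
  then have "norm (block x d N) \<le> norm (?S x) + norm (?S x')"
    using norm_triangle_ineq4 by metis
  then have "D * norm (block x d N) \<le> D * (norm (?S x) + norm (?S x'))"
    using D by (intro mult_left_mono) auto
  with big have "1 \<le> D * norm (?S x) + D * norm (?S x')"
    by (simp add: distrib_left)
  then consider "1 \<le> 2 * D * norm (?S x)" | "1 \<le> 2 * D * norm (?S x')" by linarith
  then show thesis
  proof cases
    case 1
    show thesis by (rule weyl_inverse_weighted[OF W D N 1]) (rule that)
  next
    case 2
    obtain Q :: nat and z :: "nat \<Rightarrow> int" where Q: "1 \<le> Q" "real Q \<le> D ^ (4 * C)"
      and z: "\<And>k. k \<in> {1..d} \<Longrightarrow> \<bar>real Q * x' k - of_int (z k)\<bar> * real N ^ k \<le> D ^ (4 * C)"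
      by (rule weyl_inverse_weighted[OF W D N 2]) (rule that)
    have "\<bar>real Q * x k - of_int ((- 1) ^ k * z k)\<bar> = \<bar>real Q * x' k - of_int (z k)\<bar>" for k
      by (cases "even k") (auto simp: x'_def)
    with z have "\<And>k. k \<in> {1..d} \<Longrightarrow> \<bar>real Q * x k - of_int ((- 1) ^ k * z k)\<bar> * real N ^ k \<le> D ^ (4 * C)" by simp
    with Q show thesis by (rule that)
  qed
qed

text \<open>
  The fractions found at the larger scale \<open>N\<close> are used in the major arc bound at the smaller scale \<open>M\<close>, so that
  no uniqueness of rational approximations is needed.
\<close>

lemma block_separation:
  fixes D :: real
  assumes W: "weyl_inverse d C" and d: "1 \<le> d" and D: "2 \<le> D" and M: "1 \<le> M" and MN: "M \<le> N"
    and bigM: "1 \<le> D * norm (block x d M)" and bigN: "1 \<le> D * norm (block x d N)"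
  shows "real M \<le> D ^ (4 * C + 2 * d + 6) \<or> real N \<le> D ^ (4 * C + 2 * d + 6) * real M"
proof (rule ccontr)
  \<comment> \<open>4 C comes from the denominator bound, 2 d + 4 absorbs the factor 2 + 13 d 2^d,
    and the remaining 2 leaves D / D^2 < 1 for the contradiction.\<close>
  define E where "E = 4 * C + 2 * d + 6"
  assume "\<not> ?thesis"
  then have M': "D ^ E < real M" and N': "D ^ E * real M < real N"
    by (auto simp: E_def not_le)
  have D1: "1 \<le> D" using D by simp
  have N: "1 \<le> N" using M MN by simp
  obtain Q :: nat and z :: "nat \<Rightarrow> int" where Q: "1 \<le> Q" "real Q \<le> D ^ (4 * C)"
    and z: "\<And>k. k \<in> {1..d} \<Longrightarrow> \<bar>real Q * x k - of_int (z k)\<bar> * real N ^ k \<le> D ^ (4 * C)"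
    by (rule weyl_inverse_block[OF W D N bigN]) (rule that)
  define \<eta> where "\<eta> = D ^ (4 * C) * 2 ^ d / D ^ E"
  have close: "\<bar>x k - of_int (z k) / real Q\<bar> * (2 * real M) ^ k \<le> \<eta>" if k: "k \<in> {1..d}" for k
  proof -
    have Q0: "real Q \<ge> 1" using Q(1) by simp
    have ratio: "(2 * real M) ^ k \<le> 2 ^ d / D ^ E * real N ^ k"
    proof -
      have "(real M * D ^ E) ^ k \<le> real N ^ k"
        using N' D1 by (intro power_mono) (auto simp: mult.commute)
      moreover have "D ^ E \<le> (D ^ E) ^ k"
        using k one_le_power[OF D1, of E] power_increasing[of 1 k "D ^ E"] by simp
      ultimately have "real M ^ k * D ^ E \<le> real N ^ k"
        unfolding power_mult_distrib by (meson mult_left_mono order_trans of_nat_0_le_iff zero_le_power)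
      moreover have "(2::real) ^ k \<le> 2 ^ d" using k by (intro power_increasing) auto
      ultimately have "2 ^ k * (real M ^ k * D ^ E) \<le> 2 ^ d * real N ^ k"
        using D1 by (intro mult_mono) auto
      then show ?thesis using D1 by (simp add: power_mult_distrib field_simps)
    qed
    have "\<bar>x k - of_int (z k) / real Q\<bar> \<le> real Q * \<bar>x k - of_int (z k) / real Q\<bar>"
      using Q0 by (simp add: mult_le_cancel_right1)
    also have "\<dots> = \<bar>real Q * x k - of_int (z k)\<bar>"
      using Q0 by (simp add: abs_if field_simps)
    finally have "\<bar>x k - of_int (z k) / real Q\<bar> * (2 * real M) ^ k \<le>
        \<bar>real Q * x k - of_int (z k)\<bar> * (2 ^ d / D ^ E * real N ^ k)"
      using ratio by (intro mult_mono) auto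
    also have "\<dots> = \<bar>real Q * x k - of_int (z k)\<bar> * real N ^ k * (2 ^ d / D ^ E)"
      by simp
    also have "\<dots> \<le> D ^ (4 * C) * (2 ^ d / D ^ E)"
      using z[OF k] D1 by (intro mult_right_mono) auto
    finally show ?thesis by (simp add: \<eta>_def)
  qed
  have "2 * real Q / real M \<le> 2 * D ^ (4 * C) / D ^ E"
    using Q(2) M' D1 by (intro frac_le) auto
  moreover have "norm (block x d M) \<le> 2 * real Q / real M + 13 * real d * \<eta>"
    by (rule norm_block_major[OF Q(1) M close])
  ultimately have "norm (block x d M) \<le> 2 * D ^ (4 * C) / D ^ E + 13 * real d * \<eta>"
    by linarith
  also have "\<dots> = (2 + 13 * real d * 2 ^ d) * D ^ (4 * C) / D ^ E"
    by (simp add: \<eta>_def add_divide_distrib algebra_simps)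
  also have "\<dots> \<le> D ^ (2 * d + 4) * D ^ (4 * C) / D ^ E"
  proof -
    have "d * 2 ^ d \<le> 2 ^ d * (2 ^ d :: nat)" using less_exp[of d] by (intro mult_right_mono) auto
    moreover have "(1::nat) \<le> 2 ^ d * 2 ^ d" by simp
    moreover have "(2::nat) ^ (2 * d + 4) = 16 * (2 ^ d * 2 ^ d)"
      by (simp add: power_add power_even_eq power2_eq_square)
    ultimately have "2 + 13 * d * 2 ^ d \<le> 2 ^ (2 * d + 4)"
      by linarith
    then have "real (2 + 13 * d * 2 ^ d) \<le> D ^ (2 * d + 4)"
      by (rule numeral_le_power[OF D])
    then show ?thesis using D1 by (intro divide_right_mono mult_right_mono) auto
  qed
  also have "\<dots> = 1 / D ^ 2"
  proof -
    have "D ^ E = D ^ (2 * d + 4) * D ^ (4 * C) * D ^ 2"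
      by (simp add: E_def ac_simps flip: power_add)
    then show ?thesis using D1 by simp
  qed
  finally have "D * norm (block x d M) \<le> D * (1 / D ^ 2)"
    using D1 by (intro mult_left_mono) auto
  also have "\<dots> < 1" using D by (simp add: power2_eq_square)
  finally show False using bigM by simp
qed

section \<open>Counting and summing the large blocks\<close>

lemma card_two_clusters:
  fixes J :: "nat set"
  assumes fin: "finite J" and sep: "\<And>i j. i \<in> J \<Longrightarrow> j \<in> J \<Longrightarrow> i \<le> j \<Longrightarrow> i \<le> m \<or> j \<le> i + m"
  shows "card J \<le> 2 * (m + 1)"
proof -
  \<comment> \<open>The least element beyond m starts the second window. If there is none,
    \<open>i0\<close> is an unspecified number and [0, m] already contains J.\<close>
  define i0 where "i0 = Min {i\<in>J. m < i}"
  have "J \<subseteq> {..m} \<union> {i0..i0+m}"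
  proof
    fix j assume j: "j \<in> J"
    show "j \<in> {..m} \<union> {i0..i0+m}"
    proof (cases "m < j")
      case True
      with j have "j \<in> {i\<in>J. m < i}" by simp
      moreover have "finite {i\<in>J. m < i}" using fin by simp
      ultimately have "i0 \<le> j" "i0 \<in> {i\<in>J. m < i}"
        unfolding i0_def using Min_le[of "{i\<in>J. m < i}" j] Min_in[of "{i\<in>J. m < i}"] by blast+
      then show ?thesis using sep[of i0 j] j by auto
    qed auto
  qed
  then have "card J \<le> card ({..m} \<union> {i0..i0+m})" by (intro card_mono) auto
  also have "\<dots> \<le> card {..m} + card {i0..i0+m}" by (rule card_Un_le)
  finally show ?thesis by simp
qed

text \<open>With D = 2^s the alternatives of \<open>block_separation\<close> become windows of
  length \<open>s * E\<close> for the exponents. The count is linear in s and independent of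
  x.\<close>

lemma card_large_blocks:
  assumes W: "weyl_inverse d C" and d: "1 \<le> d" and fin: "finite J" and s: "1 \<le> s"
  shows "card {j\<in>J. (1/2) ^ s \<le> norm (block x d (2 ^ j))} \<le> 2 * (4 * C + 2 * d + 7) * (s + 1)"
proof -
  define E where "E = 4 * C + 2 * d + 6"
  have "card {j\<in>J. (1/2) ^ s \<le> norm (block x d (2 ^ j))} \<le> 2 * (s * E + 1)"
  proof (rule card_two_clusters)
    fix i j assume ij: "i \<in> {j\<in>J. (1/2) ^ s \<le> norm (block x d (2 ^ j))}"
      "j \<in> {j\<in>J. (1/2) ^ s \<le> norm (block x d (2 ^ j))}" "i \<le> j"
    have D: "(2::real) \<le> 2 ^ s" using s power_increasing[of 1 s "2::real"] by simp
    have big: "1 \<le> 2 ^ s * norm (block x d (2 ^ k))" if "(1/2) ^ s \<le> norm (block x d (2 ^ k))" for k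
      using that by (simp add: power_one_over field_simps)
    have "real (2 ^ i) \<le> (2 ^ s) ^ E \<or> real (2 ^ j) \<le> (2 ^ s) ^ E * real (2 ^ i)"
      unfolding E_def by (rule block_separation[OF W d D]) (use ij big in auto)
    then have "(2::real) ^ i \<le> 2 ^ (s * E) \<or> (2::real) ^ j \<le> 2 ^ (i + s * E)"
      by (simp only: power_mult[symmetric] power_add[symmetric] of_nat_power of_nat_numeral add.commute)
    then show "i \<le> s * E \<or> j \<le> i + s * E" by simp
  qed (use fin in auto)
  also have "\<dots> \<le> 2 * (E + 1) * (s + 1)" by (simp add: algebra_simps)
  finally show ?thesis by (simp add: E_def algebra_simps)
qed

text \<open>Layer by layer: at most c (S + 2) values lie in [2^-(S+1), 2^-S), so this layer adds at
  most c (S + 2) 2^-S.\<close>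

lemma sum_from_level_counts:
  fixes b :: "'a \<Rightarrow> real"
  assumes fin: "finite J" and pos: "\<And>j. j \<in> J \<Longrightarrow> 0 \<le> b j"
    and count: "\<And>s. 1 \<le> s \<Longrightarrow> real (card {j\<in>J. (1/2) ^ s \<le> b j}) \<le> c * real (s + 1)"
    and small: "\<And>j. j \<in> J \<Longrightarrow> b j < (1/2) ^ s0"
  shows "sum b J \<le> c * (2 * real s0 + 6) * (1/2) ^ s0"
proof -
  have "0 \<le> c * real (1 + 1)" using count[of 1] by (meson of_nat_0_le_iff order_trans order_refl)
  then have c: "0 \<le> c" by simp
  \<comment> \<open>A discrete primitive of the layer bounds: \<open>T S - T (Suc S)\<close> equals
    (S + 2) / 2^S, so they telescope.\<close>
  define T where "T = (\<lambda>s. (2 * real s + 6) * (1/2) ^ s)"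
  have T: "T S - T (Suc S) = (real S + 2) * (1/2) ^ S" for S
    by (simp add: T_def algebra_simps)
  have lev: "(\<Sum>j | j \<in> J \<and> (1/2) ^ S \<le> b j. b j) \<le> c * (T s0 - T S)" if "s0 \<le> S" for S
    using that
  proof (induction S rule: dec_induct)
    case base
    have "{j\<in>J. (1/2) ^ s0 \<le> b j} = {}" using small by (auto simp: not_le)
    then show ?case by (simp only: sum.empty) simp
  next
    case (step S)
    let ?A = "{j. j \<in> J \<and> (1/2) ^ S \<le> b j}" and ?B = "{j. j \<in> J \<and> (1/2) ^ Suc S \<le> b j}"
    have AB: "?A \<subseteq> ?B"
    proof clarify
      fix j assume "(1/2) ^ S \<le> b j"
      moreover have "(1/2 :: real) ^ Suc S \<le> (1/2) ^ S" by simp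
      ultimately show "(1/2) ^ Suc S \<le> b j" by linarith
    qed
    have finB: "finite ?B" using fin by simp
    have "sum b ?B = sum b (?B - ?A) + sum b ?A" using AB finB by (rule sum.subset_diff)
    also have "sum b (?B - ?A) \<le> (\<Sum>j\<in>?B - ?A. (1/2) ^ S)" by (rule sum_mono) auto
    also have "\<dots> \<le> real (card ?B) * (1/2) ^ S"
      using card_mono[OF finB, of "?B - ?A"] by (simp add: mult_right_mono)
    also have "\<dots> \<le> (c * real (Suc S + 1)) * (1/2) ^ S"
      using count[of "Suc S"] by (intro mult_right_mono) auto
    also have "\<dots> = c * (T S - T (Suc S))" by (simp add: T)
    finally show ?case using step.IH by (simp add: algebra_simps)
  qed
  \<comment> \<open>J is finite, so some level lies below all nonzero values and the layers above it
    exhaust the sum.\<close>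
  obtain S where S: "s0 \<le> S" "\<And>j. j \<in> J \<Longrightarrow> b j \<noteq> 0 \<Longrightarrow> (1/2) ^ S \<le> b j"
  proof -
    have "\<exists>n. (1/2) ^ n \<le> b j" if "j \<in> J" "b j \<noteq> 0" for j
      using real_arch_pow_inv[of "b j" "1/2"] pos[OF that(1)] that(2) by (auto intro: less_imp_le)
    then obtain n where n: "\<And>j. j \<in> J \<Longrightarrow> b j \<noteq> 0 \<Longrightarrow> (1/2) ^ n j \<le> b j" by metis
    show thesis
    proof (rule that[of "s0 + sum n J"])
      fix j assume j: "j \<in> J" "b j \<noteq> 0"
      have "n j \<le> sum n J" using fin j(1) by (intro member_le_sum) auto
      then have "(1/2 :: real) ^ (s0 + sum n J) \<le> (1/2) ^ n j" by (intro power_decreasing) auto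
      with n[OF j] show "(1/2) ^ (s0 + sum n J) \<le> b j" by linarith
    qed simp
  qed
  have "sum b J = (\<Sum>j | j \<in> J \<and> (1/2) ^ S \<le> b j. b j)"
    using S(2) fin by (intro sum.mono_neutral_right) auto
  also have "\<dots> \<le> c * (T s0 - T S)" by (rule lev[OF S(1)])
  also have "\<dots> \<le> c * T s0" using c by (intro mult_left_mono) (auto simp: T_def)
  finally show ?thesis by (simp add: T_def mult.assoc)
qed

text \<open>A large block at scale 2^j yields some Q <= A with |Q \<xi> - z| <= A / 2^j. This is
  impossible once 2^j exceeds A / \<mu>, where \<mu> > 0 bounds the distances of these finitely many
  Q \<xi> to the integers from below. Only the coefficient \<open>k0\<close> is fixed, so the bound
  is uniform in the others, in particular in the linear one that carries u.\<close>

lemma blocks_uniformly_small: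
  assumes W: "weyl_inverse d C" and k0: "1 \<le> k0" "k0 \<le> d" and irr: "\<xi> \<notin> \<rat>" and s: "1 \<le> s"
  shows "\<exists>j0. \<forall>j\<ge>j0. \<forall>x. x k0 = \<xi> \<longrightarrow> norm (block x d (2 ^ j)) < (1/2) ^ s"
proof -
  define D :: real where "D = 2 ^ s"
  have D: "2 \<le> D" using s power_increasing[of 1 s "2::real"] by (simp add: D_def)
  define A where "A = D ^ (4 * C)"
  define m where "m = (\<lambda>Q::nat. \<bar>real Q * \<xi> - of_int (round (real Q * \<xi>))\<bar>)"
  define \<mu> where "\<mu> = Min (insert 1 (m ` {1..nat \<lfloor>A\<rfloor>}))"
  have "0 < m Q" if "1 \<le> Q" for Q
  proof -
    have "real Q * \<xi> \<noteq> of_int z" for z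
    proof
      assume "real Q * \<xi> = of_int z"
      then have "\<xi> = of_int z / of_nat Q" using that by (simp add: field_simps)
      then have "\<xi> \<in> \<rat>" by simp
      with irr show False by simp
    qed
    then show ?thesis by (simp add: m_def)
  qed
  then have \<mu>: "0 < \<mu>" unfolding \<mu>_def by (subst Min_gr_iff) auto
  have \<mu>_le: "\<mu> \<le> m Q" if "1 \<le> Q" "real Q \<le> A" for Q
    unfolding \<mu>_def using that by (intro Min_le) (auto simp: le_nat_floor)
  obtain j0 where j0: "A / \<mu> < 2 ^ j0"
    using real_arch_pow[of 2 "A / \<mu>"] by auto
  have "norm (block x d (2 ^ j)) < (1/2) ^ s" if "j \<ge> j0" "x k0 = \<xi>" for j x
  proof (rule ccontr)
    assume "\<not> ?thesis"
    then have "1 \<le> D * norm (block x d (2 ^ j))"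
      by (simp add: D_def power_one_over field_simps)
    then obtain Q :: nat and z :: "nat \<Rightarrow> int" where Q: "1 \<le> Q" "real Q \<le> A"
      and z: "\<And>k. k \<in> {1..d} \<Longrightarrow> \<bar>real Q * x k - of_int (z k)\<bar> * real (2 ^ j) ^ k \<le> A"
      unfolding A_def by (rule weyl_inverse_block[OF W D, rotated]) (auto intro: that)
    have "\<mu> * 2 ^ j0 \<le> m Q * (2 ^ j) ^ k0"
    proof (rule mult_mono)
      have "(2::real) ^ j0 \<le> 2 ^ j" using that by (intro power_increasing) auto
      also have "\<dots> \<le> (2 ^ j) ^ k0" using k0 power_increasing[of 1 k0 "2 ^ j :: real"] by simp
      finally show "(2::real) ^ j0 \<le> (2 ^ j) ^ k0" .
    qed (use \<mu>_le Q in \<open>auto simp: m_def\<close>)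
    also have "m Q \<le> \<bar>real Q * x k0 - of_int (z k0)\<bar>"
      unfolding m_def using round_diff_minimal[of "real Q * \<xi>" "z k0"] that(2) by simp
    then have "m Q * (2 ^ j) ^ k0 \<le> \<bar>real Q * x k0 - of_int (z k0)\<bar> * real (2 ^ j) ^ k0"
      by (simp add: mult_right_mono)
    also have "\<dots> \<le> A" using k0 by (intro z) auto
    finally show False using j0 \<mu> by (simp add: pos_divide_less_eq mult.commute)
  qed
  then show ?thesis by blast
qed

theorem sum_blocks_uniformly_small:
  assumes k0: "1 \<le> k0" "k0 \<le> d" and irr: "\<xi> \<notin> \<rat>" and \<epsilon>: "0 < \<epsilon>"
  shows "\<exists>j0. \<forall>x J. x k0 = \<xi> \<longrightarrow> finite J \<longrightarrow> J \<subseteq> {j0..} \<longrightarrow>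
           (\<Sum>j\<in>J. norm (block x d (2 ^ j))) \<le> \<epsilon>"
proof -
  from k0 have d: "1 \<le> d" by simp
  obtain C where W: "weyl_inverse d C" using weyl_inverse_exists[OF d] by blast
  define c where "c = real (2 * (4 * C + 2 * d + 7))"
  have "(\<lambda>s. c * (2 * real s + 6) * (1/2) ^ s) \<longlonglongrightarrow> 0" by real_asymp
  then have "\<forall>\<^sub>F s in sequentially. c * (2 * real s + 6) * (1/2) ^ s < \<epsilon>"
    using \<epsilon> by (rule order_tendstoD)
  then have "\<forall>\<^sub>F s in sequentially. c * (2 * real s + 6) * (1/2) ^ s < \<epsilon> \<and> 1 \<le> s"
    using eventually_ge_at_top[of "1::nat"] by eventually_elim simp
  then obtain s where s: "c * (2 * real s + 6) * (1/2) ^ s < \<epsilon>" "1 \<le> s"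
    by (auto simp: eventually_sequentially)
  obtain j0 where j0: "\<And>j x. j \<ge> j0 \<Longrightarrow> x k0 = \<xi> \<Longrightarrow> norm (block x d (2 ^ j)) < (1/2) ^ s"
    using blocks_uniformly_small[OF W k0 irr s(2)] by blast
  have "(\<Sum>j\<in>J. norm (block x d (2 ^ j))) \<le> \<epsilon>" if "x k0 = \<xi>" "finite J" "J \<subseteq> {j0..}" for x J
  proof -
    have "(\<Sum>j\<in>J. norm (block x d (2 ^ j))) \<le> c * (2 * real s + 6) * (1/2) ^ s"
    proof (rule sum_from_level_counts)
      fix s' :: nat assume "1 \<le> s'"
      from card_large_blocks[OF W d that(2) this]
      have "real (card {j\<in>J. (1/2) ^ s' \<le> norm (block x d (2 ^ j))}) \<le> real (2 * (4 * C + 2 * d + 7) * (s' + 1))"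
        by (rule of_nat_mono)
      then show "real (card {j\<in>J. (1/2) ^ s' \<le> norm (block x d (2 ^ j))}) \<le> c * real (s' + 1)"
        unfolding c_def of_nat_mult .
    qed (use that j0 in auto)
    with s(1) show ?thesis by simp
  qed
  then show ?thesis by blast
qed

section \<open>Fourier series in the mean\<close>

lemma L2_on_iff:
  "L2_on {a..b} f \<longleftrightarrow> f \<in> borel_measurable (lebesgue_on {a..b}) \<and> (\<lambda>x. (norm (f x))\<^sup>2) integrable_on {a..b}"
  by (simp add: L2_on_def measurable_on_iff_borel_measurable)

lemma L2_on_bounded_by:
  assumes "f \<in> borel_measurable (lebesgue_on {a..b})" "g integrable_on {a..b}"
    and "\<And>x. x \<in> {a..b} \<Longrightarrow> (norm (f x))\<^sup>2 \<le> g x"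
  shows "L2_on {a..b} f"
  unfolding L2_on_iff
proof
  have "(\<lambda>x. (norm (f x))\<^sup>2) \<in> borel_measurable (lebesgue_on {a..b})"
    using assms(1) by measurable
  then show "(\<lambda>x. (norm (f x))\<^sup>2) integrable_on {a..b}"
    by (rule measurable_bounded_by_integrable_imp_integrable) (use assms in auto)
qed fact

lemma L2_on_mult_integrable:
  assumes "L2_on {a..b} f" "L2_on {a..b} g"
  shows "(\<lambda>x. f x * g x) absolutely_integrable_on {a..b}"
proof (rule measurable_bounded_by_integrable_imp_absolutely_integrable)
  have [measurable]: "f \<in> borel_measurable (lebesgue_on {a..b})" "g \<in> borel_measurable (lebesgue_on {a..b})"
    using assms by (auto simp: L2_on_iff)
  show "(\<lambda>x. f x * g x) \<in> borel_measurable (lebesgue_on {a..b})" by measurable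
  show "(\<lambda>x. (norm (f x))\<^sup>2 + (norm (g x))\<^sup>2) integrable_on {a..b}"
    using assms by (auto simp: L2_on_iff intro: integrable_add)
  show "norm (f x * g x) \<le> (norm (f x))\<^sup>2 + (norm (g x))\<^sup>2" for x
    using sum_squares_bound[of "norm (f x)" "norm (g x)"] mult_nonneg_nonneg[OF norm_ge_zero[of "f x"] norm_ge_zero[of "g x"]]
    unfolding norm_mult by linarith
qed auto

lemma L2_on_cnj: "L2_on {a..b} f \<Longrightarrow> L2_on {a..b} (\<lambda>x. cnj (f x))"
  unfolding L2_on_iff
  by (auto intro: measurable_compose[OF _ borel_measurable_continuous_onI] continuous_intros)

lemma L2_on_cmult:
  assumes "L2_on {a..b} f"
  shows "L2_on {a..b} (\<lambda>x. c * f x)"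
proof -
  have [measurable]: "f \<in> borel_measurable (lebesgue_on {a..b})" using assms by (simp add: L2_on_iff)
  have "(\<lambda>x. (norm c)\<^sup>2 * (norm (f x))\<^sup>2) integrable_on {a..b}"
    using assms by (intro integrable_on_mult_right) (simp add: L2_on_iff)
  then show ?thesis by (simp add: L2_on_iff norm_mult power_mult_distrib)
qed

lemma norm_add_power2_le: "(norm (u + v))\<^sup>2 \<le> 2 * (norm u)\<^sup>2 + 2 * (norm v)\<^sup>2"
proof -
  have "(norm (u + v))\<^sup>2 \<le> (norm u + norm v)\<^sup>2"
    by (intro power_mono norm_triangle_ineq) auto
  also have "\<dots> \<le> 2 * (norm u)\<^sup>2 + 2 * (norm v)\<^sup>2"
    using sum_squares_bound[of "norm u" "norm v"] by (simp add: power2_sum)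
  finally show ?thesis .
qed

lemma L2_on_add:
  assumes "L2_on {a..b} f" "L2_on {a..b} g"
  shows "L2_on {a..b} (\<lambda>x. f x + g x)"
proof (rule L2_on_bounded_by)
  have [measurable]: "f \<in> borel_measurable (lebesgue_on {a..b})" "g \<in> borel_measurable (lebesgue_on {a..b})"
    using assms by (auto simp: L2_on_iff)
  show "(\<lambda>x. f x + g x) \<in> borel_measurable (lebesgue_on {a..b})" by measurable
  show "(\<lambda>x. 2 * (norm (f x))\<^sup>2 + 2 * (norm (g x))\<^sup>2) integrable_on {a..b}"
    using assms by (auto simp: L2_on_iff intro!: integrable_add integrable_on_mult_right)
qed (rule norm_add_power2_le)

lemma L2_on_diff:
  assumes "L2_on {a..b} f" "L2_on {a..b} g"
  shows "L2_on {a..b} (\<lambda>x. f x - g x)"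
  using L2_on_add[OF assms(1) L2_on_cmult[OF assms(2), of "- 1"]] by simp

lemma L2_on_sum:
  assumes "\<And>i. i \<in> F \<Longrightarrow> L2_on {a..b} (f i)"
  shows "L2_on {a..b} (\<lambda>x. \<Sum>i\<in>F. f i x)"
  using assms
proof (induction F rule: infinite_finite_induct)
  case (insert i F)
  then show ?case by (simp add: L2_on_add)
qed (auto simp: L2_on_iff)

lemma L2_on_continuous:
  assumes "continuous_on {a..b} f"
  shows "L2_on {a..b} f"
  unfolding L2_on_iff
proof
  show "f \<in> borel_measurable (lebesgue_on {a..b})"
    using assms by (rule continuous_imp_measurable_on_sets_lebesgue) simp
  show "(\<lambda>x. (norm (f x))\<^sup>2) integrable_on {a..b}"
    by (intro integrable_continuous_interval continuous_intros assms)
qed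

section \<open>Orthonormality and best approximation\<close>

lemma e_basis_cis: "e_basis j x = cis (of_int j * x) / of_real (sqrt (2 * pi))"
  by (simp add: e_basis_def cis_conv_exp mult_ac)

lemma continuous_e_basis: "continuous_on A (e_basis j)"
  unfolding e_basis_def by (intro continuous_intros) auto

lemma L2_on_e_basis: "L2_on {a..b} (e_basis j)"
  by (intro L2_on_continuous continuous_e_basis)

lemma e_basis_mult_cnj:
  "e_basis j x * cnj (e_basis k y) = cis (of_int j * x - of_int k * y) / of_real (2 * pi)"
proof -
  have "of_real (sqrt (2 * pi)) * of_real (sqrt (2 * pi)) = (of_real (2 * pi) :: complex)"
    by (subst of_real_mult[symmetric]) simp
  moreover have "e_basis j x * cnj (e_basis k y) =
      (cis (of_int j * x) * cis (- (of_int k * y))) / (of_real (sqrt (2 * pi)) * of_real (sqrt (2 * pi)))"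
    by (simp add: e_basis_cis cis_cnj)
  ultimately show ?thesis by (simp only: cis_mult diff_conv_add_uminus)
qed

lemma e_basis_orthonormal:
  "((\<lambda>x. e_basis j x * cnj (e_basis k x)) has_integral (if j = k then 1 else 0)) {0..2*pi}"
proof (cases "j = k")
  case True
  have "((\<lambda>x::real. 1 / of_real (2 * pi) :: complex) has_integral (2 * pi - 0) *\<^sub>R (1 / of_real (2 * pi))) {0..2*pi}"
    using has_integral_const_real[of "1 / of_real (2 * pi) :: complex" 0 "2 * pi"] by simp
  then show ?thesis using True by (simp add: e_basis_mult_cnj scaleR_conv_of_real)
next
  case False
  define a where "a = \<i> * of_int (j - k)"
  have a: "a \<noteq> 0" using False by (simp add: a_def)
  have "exp (a * of_real (2 * pi)) = 1"
    unfolding a_def exp_eq_1 by (auto intro!: exI[of _ "j - k"])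
  then have "integral {0..2*pi} (\<lambda>x. exp (a * of_real x)) = 0"
    using a by (simp add: integral_exp)
  moreover have "(\<lambda>x. exp (a * of_real x)) integrable_on {0..2*pi}"
    by (intro integrable_continuous_interval continuous_intros)
  ultimately have "((\<lambda>x. exp (a * of_real x)) has_integral 0) {0..2*pi}"
    by (simp add: has_integral_integrable_integral)
  then have "((\<lambda>x. exp (a * of_real x) / of_real (2 * pi)) has_integral 0 / of_real (2 * pi)) {0..2*pi}"
    by (rule has_integral_divide)
  moreover have "cis (of_int j * x - of_int k * x) = exp (a * of_real x)" for x
    by (simp add: cis_conv_exp a_def algebra_simps)
  ultimately show ?thesis using False by (simp add: e_basis_mult_cnj)
qed

lemma fourier_coeff_has_integral:
  assumes "L2_on {0..2*pi} f"
  shows "((\<lambda>x. f x * cnj (e_basis j x)) has_integral fourier_coeff f j) {0..2*pi}"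
  unfolding fourier_coeff_def
  using L2_on_mult_integrable[OF assms L2_on_cnj[OF L2_on_e_basis]]
  by (intro integrable_integral) (auto simp: absolutely_integrable_on_def)

lemma has_integral_norm_power2:
  assumes "((\<lambda>x. f x * cnj (f x)) has_integral c) A"
  shows "((\<lambda>x. (norm (f x))\<^sup>2) has_integral Re c) A"
proof -
  have "((\<lambda>x. Re (f x * cnj (f x))) has_integral Re c) A"
    using has_integral_linear[OF assms bounded_linear_Re] by (simp add: o_def)
  moreover have "Re (f x * cnj (f x)) = (norm (f x))\<^sup>2" for x
    by (metis Re_complex_of_real complex_norm_square)
  ultimately show ?thesis by simp
qed

text \<open>Expansion of the square by orthonormality. Only the last sum depends on
  \<open>t\<close>, so the Fourier partial sum is the best approximation from its span.\<close>

lemma L2_dist_trig_poly: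
  assumes G: "L2_on {0..2*pi} G" and F: "finite F"
  shows "integral {0..2*pi} (\<lambda>x. (norm (G x - (\<Sum>j\<in>F. t j * e_basis j x)))\<^sup>2) =
    integral {0..2*pi} (\<lambda>x. (norm (G x))\<^sup>2) - (\<Sum>j\<in>F. (norm (fourier_coeff G j))\<^sup>2)
      + (\<Sum>j\<in>F. (norm (t j - fourier_coeff G j))\<^sup>2)"
proof -
  define T where "T = (\<lambda>x. \<Sum>j\<in>F. t j * e_basis j x)"
  define g where "g = fourier_coeff G"
  define n where "n = integral {0..2*pi} (\<lambda>x. G x * cnj (G x))"
  have GG: "((\<lambda>x. G x * cnj (G x)) has_integral n) {0..2*pi}"
    unfolding n_def using L2_on_mult_integrable[OF G L2_on_cnj[OF G]]
    by (intro integrable_integral) (auto simp: absolutely_integrable_on_def)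
  have GT: "((\<lambda>x. G x * cnj (T x)) has_integral (\<Sum>j\<in>F. cnj (t j) * g j)) {0..2*pi}"
  proof -
    have "((\<lambda>x. \<Sum>j\<in>F. cnj (t j) * (G x * cnj (e_basis j x))) has_integral (\<Sum>j\<in>F. cnj (t j) * g j)) {0..2*pi}"
      unfolding g_def by (intro has_integral_sum F has_integral_mult_right fourier_coeff_has_integral G)
    then show ?thesis by (simp add: T_def cnj_sum sum_distrib_left mult_ac)
  qed
  have "((\<lambda>x. cnj (G x * cnj (T x))) has_integral cnj (\<Sum>j\<in>F. cnj (t j) * g j)) {0..2*pi}"
    using has_integral_linear[OF GT bounded_linear_cnj] by (simp add: o_def)
  then have TG: "((\<lambda>x. T x * cnj (G x)) has_integral (\<Sum>j\<in>F. t j * cnj (g j))) {0..2*pi}"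
    by (simp add: cnj_sum mult_ac)
  have TT: "((\<lambda>x. T x * cnj (T x)) has_integral (\<Sum>j\<in>F. t j * cnj (t j))) {0..2*pi}"
  proof -
    have "((\<lambda>x. \<Sum>j\<in>F. \<Sum>k\<in>F. (t j * cnj (t k)) * (e_basis j x * cnj (e_basis k x))) has_integral
       (\<Sum>j\<in>F. \<Sum>k\<in>F. (t j * cnj (t k)) * (if j = k then 1 else 0))) {0..2*pi}"
      by (intro has_integral_sum F has_integral_mult_right e_basis_orthonormal)
    moreover have "(\<Sum>j\<in>F. \<Sum>k\<in>F. (t j * cnj (t k)) * (e_basis j x * cnj (e_basis k x))) = T x * cnj (T x)" for x
      by (simp add: T_def cnj_sum sum_product mult_ac)
    moreover have "(\<Sum>j\<in>F. \<Sum>k\<in>F. (t j * cnj (t k)) * (if j = k then 1 else 0)) = (\<Sum>j\<in>F. t j * cnj (t j))"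
      using F by (intro sum.cong) (auto simp: if_distrib cong: if_cong)
    ultimately show ?thesis by simp
  qed
  have eq: "(G x - T x) * cnj (G x - T x) = G x * cnj (G x) - G x * cnj (T x) - T x * cnj (G x) + T x * cnj (T x)" for x
    by (simp add: algebra_simps)
  have "((\<lambda>x. (G x - T x) * cnj (G x - T x)) has_integral
      (n - (\<Sum>j\<in>F. cnj (t j) * g j) - (\<Sum>j\<in>F. t j * cnj (g j)) + (\<Sum>j\<in>F. t j * cnj (t j)))) {0..2*pi}"
    unfolding eq by (intro has_integral_add has_integral_diff GG GT TG TT)
  from has_integral_norm_power2[OF this]
  have "integral {0..2*pi} (\<lambda>x. (norm (G x - T x))\<^sup>2) =
     Re (n - (\<Sum>j\<in>F. cnj (t j) * g j) - (\<Sum>j\<in>F. t j * cnj (g j)) + (\<Sum>j\<in>F. t j * cnj (t j)))"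
    by (rule integral_unique)
  also have "\<dots> = Re n + (\<Sum>j\<in>F. Re (t j * cnj (t j) - cnj (t j) * g j - t j * cnj (g j)))"
  proof -
    have "n - (\<Sum>j\<in>F. cnj (t j) * g j) - (\<Sum>j\<in>F. t j * cnj (g j)) + (\<Sum>j\<in>F. t j * cnj (t j)) =
        n + (\<Sum>j\<in>F. t j * cnj (t j) - cnj (t j) * g j - t j * cnj (g j))"
      by (simp add: sum_subtractf)
    then show ?thesis by (simp only: plus_complex.sel Re_sum)
  qed
  also have "(\<Sum>j\<in>F. Re (t j * cnj (t j) - cnj (t j) * g j - t j * cnj (g j))) =
      (\<Sum>j\<in>F. (norm (t j - g j))\<^sup>2 - (norm (g j))\<^sup>2)"
  proof -
    have "Re (u * cnj u - cnj u * v - u * cnj v) = (norm (u - v))\<^sup>2 - (norm v)\<^sup>2" for u v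
      unfolding cmod_power2 by (simp add: power2_eq_square algebra_simps)
    then show ?thesis by (simp only:)
  qed
  also have "Re n = integral {0..2*pi} (\<lambda>x. (norm (G x))\<^sup>2)"
    using integral_unique[OF has_integral_norm_power2[OF GG]] by simp
  finally show ?thesis by (simp add: T_def g_def sum_subtractf)
qed

section \<open>Density of trigonometric polynomials in mean square\<close>

inductive trig_poly :: "(real \<Rightarrow> complex) \<Rightarrow> bool" where
  cis: "trig_poly (\<lambda>x. c * cis (of_int j * x))"
| add: "trig_poly f \<Longrightarrow> trig_poly g \<Longrightarrow> trig_poly (\<lambda>x. f x + g x)"

lemma trig_poly_const: "trig_poly (\<lambda>x. c)"
  using trig_poly.cis[of c 0] by simp

lemma trig_poly_cis_mult:
  assumes "trig_poly g"
  shows "trig_poly (\<lambda>x. c * cis (of_int j * x) * g x)"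
  using assms
proof induction
  case (cis d k)
  have "c * cis (of_int j * x) * (d * cis (of_int k * x)) = (c * d) * cis (of_int (j + k) * x)" for x
  proof -
    have "cis (of_int (j + k) * x) = cis (of_int j * x) * cis (of_int k * x)"
      by (simp add: cis_mult distrib_right)
    then show ?thesis by simp
  qed
  then show ?case by (simp only: trig_poly.cis)
next
  case (add f g)
  then show ?case unfolding distrib_left by (intro trig_poly.add)
qed

lemma trig_poly_mult:
  assumes "trig_poly f" "trig_poly g"
  shows "trig_poly (\<lambda>x. f x * g x)"
  using assms(1)
proof induction
  case (cis c j)
  show ?case by (rule trig_poly_cis_mult) fact
next
  case (add f1 f2)
  then show ?case unfolding distrib_right by (intro trig_poly.add)
qed

lemma trig_poly_expansion:
  assumes "trig_poly f"
  obtains M t where "\<And>N. M \<le> N \<Longrightarrow> f = (\<lambda>x. \<Sum>j\<in>{-int N..int N}. t j * e_basis j x)"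
proof -
  have "\<exists>M t. \<forall>N\<ge>M. f = (\<lambda>x. \<Sum>j\<in>{-int N..int N}. t j * e_basis j x)"
    using assms
  proof induction
    case (cis c k)
    have "(\<lambda>x. c * cis (of_int k * x)) = (\<lambda>x. \<Sum>j\<in>{-int N..int N}. (if j = k then c * of_real (sqrt (2 * pi)) else 0) * e_basis j x)"
      if "nat \<bar>k\<bar> \<le> N" for N
    proof
      fix x
      have "(\<Sum>j\<in>{-int N..int N}. (if j = k then c * of_real (sqrt (2 * pi)) else 0) * e_basis j x) =
         (\<Sum>j\<in>{k}. c * of_real (sqrt (2 * pi)) * e_basis j x)"
        using that by (intro sum.mono_neutral_cong_right) auto
      then show "c * cis (of_int k * x) = (\<Sum>j\<in>{-int N..int N}. (if j = k then c * of_real (sqrt (2 * pi)) else 0) * e_basis j x)"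
        by (simp add: e_basis_cis)
    qed
    then show ?case
      by (intro exI[of _ "nat \<bar>k\<bar>"] exI[of _ "\<lambda>j. if j = k then c * of_real (sqrt (2 * pi)) else 0"] allI impI)
  next
    case (add f g)
    from add.IH(1) obtain M1 t1 where 1: "\<forall>N\<ge>M1. f = (\<lambda>x. \<Sum>j\<in>{-int N..int N}. t1 j * e_basis j x)"
      by (elim exE)
    from add.IH(2) obtain M2 t2 where 2: "\<forall>N\<ge>M2. g = (\<lambda>x. \<Sum>j\<in>{-int N..int N}. t2 j * e_basis j x)"
      by (elim exE)
    have "(\<lambda>x. f x + g x) = (\<lambda>x. \<Sum>j\<in>{-int N..int N}. (t1 j + t2 j) * e_basis j x)" if "max M1 M2 \<le> N" for N
    proof
      fix x
      have "f x = (\<Sum>j\<in>{-int N..int N}. t1 j * e_basis j x)" "g x = (\<Sum>j\<in>{-int N..int N}. t2 j * e_basis j x)"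
        using fun_cong[OF 1[rule_format, of N]] fun_cong[OF 2[rule_format, of N]] that by auto
      then show "f x + g x = (\<Sum>j\<in>{-int N..int N}. (t1 j + t2 j) * e_basis j x)"
        by (simp only: distrib_right sum.distrib)
    qed
    then show ?case by (intro exI[of _ "max M1 M2"] exI[of _ "\<lambda>j. t1 j + t2 j"] allI impI)
  qed
  then obtain M t where *: "\<forall>N\<ge>M. f = (\<lambda>x. \<Sum>j\<in>{-int N..int N}. t j * e_basis j x)"
    by (elim exE)
  show thesis by (rule that) (rule *[rule_format])
qed

text \<open>A real-linear function f on the plane restricts to the circle as f(1) cos x + f(\<i>)
  sin x, which Euler's formulas turn into a combination of \<open>cis x\<close> and
  \<open>cis (- x)\<close>; products and sums follow by induction.\<close>

lemma trig_poly_of_real_polynomial: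
  assumes "real_polynomial_function r"
  shows "trig_poly (\<lambda>x. of_real (r (cis x)))"
  using assms
proof induction
  case (linear f)
  have eq: "of_real (f (cis x)) = of_real (f 1 / 2) * (cis (of_int 1 * x) + cis (of_int (- 1) * x))
      + (- \<i> * of_real (f \<i> / 2)) * (cis (of_int 1 * x) + (- 1) * cis (of_int (- 1) * x))" for x
  proof -
    have "f (cis x) = f (cos x *\<^sub>R 1 + sin x *\<^sub>R \<i>)"
      by (rule arg_cong[of _ _ f]) (simp add: complex_eq_iff)
    also have "\<dots> = cos x * f 1 + sin x * f \<i>"
      using linear by (simp add: linear_simps)
    finally show ?thesis by (simp add: complex_eq_iff)
  qed
  show ?case unfolding eq
    by (intro trig_poly.add trig_poly_mult trig_poly_const) (rule trig_poly.cis[of 1, simplified mult_1] trig_poly.cis)+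
next
  case (add f g)
  then show ?case unfolding of_real_add by (intro trig_poly.add)
next
  case (mult f g)
  then show ?case unfolding of_real_mult by (intro trig_poly_mult)
qed (rule trig_poly_const)

text \<open>Equal end values let h descend to the unit circle, where Stone-Weierstrass supplies a
  polynomial in the real and imaginary parts.\<close>

lemma trig_poly_dense_continuous:
  fixes h :: "real \<Rightarrow> complex"
  assumes h: "continuous_on {0..2*pi} h" "h 0 = h (2*pi)" and e: "0 < e"
  obtains T where "trig_poly T" "\<And>x. x \<in> {0..2*pi} \<Longrightarrow> norm (h x - T x) < e"
proof -
  define p where "p = (\<lambda>t::real. h (2 * pi * t))"
  have "path p"
    unfolding path_def p_def
    by (rule continuous_on_compose2[OF h(1)]) (auto intro!: continuous_intros)
  moreover have "pathfinish p = pathstart p"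
    using h(2) by (simp add: p_def pathfinish_def pathstart_def)
  \<comment> \<open>The constant homotopy from p to itself serves to obtain continuity of the
    induced map on the circle, across the jump of \<open>Arg2pi\<close> at 1.\<close>
  ultimately have "homotopic_loops UNIV p p"
    by (simp add: homotopic_loops_refl)
  from homotopic_with_imp_continuous[OF homotopic_loops_imp_homotopic_circlemaps[OF this]]
  have "continuous_on (sphere 0 1) (p \<circ> (\<lambda>z. Arg2pi z / (2 * pi)))" ..
  from Stone_Weierstrass_polynomial_function[OF compact_sphere this e] obtain g where g: "polynomial_function g"
    "\<And>z. z \<in> sphere 0 1 \<Longrightarrow> norm ((p \<circ> (\<lambda>z. Arg2pi z / (2 * pi))) z - g z) < e"
    by blast
  define T where "T = (\<lambda>x. of_real (Re (g (cis x))) + \<i> * of_real (Im (g (cis x))))"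
  have "real_polynomial_function (Re \<circ> g)" "real_polynomial_function (Im \<circ> g)"
    using g(1) bounded_linear_Re bounded_linear_Im unfolding polynomial_function_def by simp_all
  then have "trig_poly T"
    unfolding T_def using trig_poly_of_real_polynomial[of "Re \<circ> g"] trig_poly_of_real_polynomial[of "Im \<circ> g"]
    by (intro trig_poly.add trig_poly_mult trig_poly_const) (auto simp: o_def)
  moreover have "norm (h x - T x) < e" if "x \<in> {0..2*pi}" for x
  proof -
    have T: "T x = g (cis x)" by (simp add: T_def complex_eq_iff)
    have "(p \<circ> (\<lambda>z. Arg2pi z / (2 * pi))) (cis x) = h x"
    proof (cases "x = 2 * pi")
      case True
      have "Arg2pi 1 = 0" using Arg2pi_unique[of 1 0 1] by simp
      then show ?thesis using h(2) True by (simp add: p_def)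
    next
      case False
      then have "Arg2pi (cis x) = x" using that Arg2pi_unique[of 1 x "cis x"] by (simp add: cis_conv_exp)
      then show ?thesis by (simp add: p_def)
    qed
    with g(2)[of "cis x"] T show ?thesis by simp
  qed
  ultimately show thesis by (rule that)
qed

text \<open>The radial retraction onto the disc of radius K. The form with \<open>max\<close> has no
  case split, so continuity follows by composition.\<close>

definition clamp_norm :: "real \<Rightarrow> complex \<Rightarrow> complex" where
  "clamp_norm K w = w /\<^sub>R max 1 (norm w / K)"

lemma continuous_clamp_norm: "K > 0 \<Longrightarrow> continuous_on A (clamp_norm K)"
  unfolding clamp_norm_def by (intro continuous_intros) auto

lemma norm_clamp_norm_le:
  assumes "K > 0"
  shows "norm (clamp_norm K w) \<le> K" "norm (w - clamp_norm K w) \<le> norm w"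
proof -
  define m where "m = max 1 (norm w / K)"
  have m: "m \<ge> 1" "norm w \<le> K * m"
    using assms by (auto simp: m_def max_def field_simps)
  then show "norm (clamp_norm K w) \<le> K"
    by (simp add: clamp_norm_def m_def[symmetric] field_simps)
  have "w - clamp_norm K w = (1 - inverse m) *\<^sub>R w"
    by (simp add: clamp_norm_def m_def[symmetric] algebra_simps)
  then have "norm (w - clamp_norm K w) = (1 - inverse m) * norm w"
    using m(1) by (simp add: inverse_le_1_iff)
  also have "\<dots> \<le> 1 * norm w"
    using m(1) by (intro mult_right_mono) auto
  finally show "norm (w - clamp_norm K w) \<le> norm w" by simp
qed

lemma clamp_norm_eq: "0 < K \<Longrightarrow> norm w \<le> K \<Longrightarrow> clamp_norm K w = w"
  by (simp add: clamp_norm_def max_def field_simps)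

text \<open>
  The definition of \<open>measurable_on\<close> already provides continuous functions converging almost everywhere;
  clamping makes them dominated, and the cut-off \<open>\<phi>\<close> makes them vanish at the endpoints.
\<close>

lemma continuous_dense_bounded:
  fixes f :: "real \<Rightarrow> complex"
  assumes f: "f measurable_on {0..2*pi}" and K: "K > 0" and bound: "\<And>x. norm (f x) \<le> K" and e: "e > 0"
  obtains h where "continuous_on UNIV h" "h 0 = 0" "h (2*pi) = 0" "(\<lambda>x. (norm (f x - h x))\<^sup>2) integrable_on {0..2*pi}"
    "integral {0..2*pi} (\<lambda>x. (norm (f x - h x))\<^sup>2) < e"
proof -
  obtain N g where N: "negligible N" and g: "\<And>n. continuous_on UNIV (g n)"
    and lim: "\<And>x. x \<notin> N \<Longrightarrow> (\<lambda>n. g n x) \<longlonglongrightarrow> (if x \<in> {0..2*pi} then f x else 0)"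
    using f unfolding measurable_on_def by blast
  define \<phi> where "\<phi> = (\<lambda>(n::nat) x::real. min 1 (max 0 (real n * (x * (2 * pi - x)))))"
  define h where "h = (\<lambda>n x. \<phi> n x *\<^sub>R clamp_norm K (g n x))"
  have h_cont: "continuous_on UNIV (h n)" for n
    unfolding h_def \<phi>_def
    by (intro continuous_intros continuous_on_compose2[OF continuous_clamp_norm[OF K] g]) auto
  have h_le: "norm (h n x) \<le> K" for n x
  proof -
    have "\<bar>\<phi> n x\<bar> * norm (clamp_norm K (g n x)) \<le> 1 * K"
      using norm_clamp_norm_le(1)[OF K] by (intro mult_mono) (auto simp: \<phi>_def)
    then show ?thesis by (simp add: h_def)
  qed
  have meas: "f \<in> borel_measurable (lebesgue_on {0..2*pi})"
    using f by (simp add: measurable_on_iff_borel_measurable)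
  have "L2_on {0..2*pi} f"
    using meas by (rule L2_on_bounded_by[of _ _ _ "\<lambda>_. K\<^sup>2"]) (use bound in \<open>auto intro: power_mono\<close>)
  then have "L2_on {0..2*pi} (\<lambda>x. f x - h n x)" for n
    by (rule L2_on_diff[OF _ L2_on_continuous[OF continuous_on_subset[OF h_cont subset_UNIV]]])
  then have int: "(\<lambda>x. (norm (f x - h n x))\<^sup>2) integrable_on {0..2*pi}" for n
    by (simp add: L2_on_def)
  define N' where "N' = N \<union> {0, 2*pi}"
  have N': "negligible N'" using N by (simp add: N'_def)
  \<comment> \<open>The convergence theorem is used with convergence at every point, so the
    exceptional set is zeroed out; it includes the endpoints, where the cut-off vanishes.\<close>
  define d where "d = (\<lambda>n x. if x \<in> N' then 0 else (norm (f x - h n x))\<^sup>2)"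
  have d_int: "d n integrable_on {0..2*pi}" for n
    by (rule integrable_spike[OF int N']) (simp add: d_def)
  have d_eq: "integral {0..2*pi} (d n) = integral {0..2*pi} (\<lambda>x. (norm (f x - h n x))\<^sup>2)" for n
    by (rule integral_spike[OF N']) (simp add: d_def)
  have "(\<lambda>n. integral {0..2*pi} (d n)) \<longlonglongrightarrow> integral {0..2*pi} (\<lambda>x. 0::real)"
  proof (rule dominated_convergence(2))
    show "(\<lambda>x::real. (2 * K)\<^sup>2) integrable_on {0..2*pi}" by (rule integrable_const_ivl)
    show "norm (d n x) \<le> (2 * K)\<^sup>2" if "x \<in> {0..2*pi}" for n x
    proof -
      have "norm (f x - h n x) \<le> K + K"
        using norm_triangle_ineq4[of "f x" "h n x"] bound[of x] h_le[of n x] by linarith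
      then have "(norm (f x - h n x))\<^sup>2 \<le> (2 * K)\<^sup>2" by (intro power_mono) auto
      then show ?thesis by (simp add: d_def)
    qed
    show "(\<lambda>n. d n x) \<longlonglongrightarrow> 0" if x: "x \<in> {0..2*pi}" for x
    proof (cases "x \<in> N'")
      case False
      then have x': "0 < x" "x < 2 * pi" and "x \<notin> N" using x by (auto simp: N'_def)
      have "(\<lambda>n. g n x) \<longlonglongrightarrow> f x" using lim[OF \<open>x \<notin> N\<close>] x by simp
      moreover have "isCont (clamp_norm K) (f x)"
        using continuous_clamp_norm[OF K, of UNIV] by (simp add: continuous_on_eq_continuous_at)
      ultimately have 1: "(\<lambda>n. clamp_norm K (g n x)) \<longlonglongrightarrow> f x"
        using isCont_tendsto_compose[of "f x" "clamp_norm K"] clamp_norm_eq[OF K bound] by metis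
      have "0 < x * (2 * pi - x)" using x' by simp
      then obtain n0 :: nat where n0: "1 < real n0 * (x * (2 * pi - x))"
        using reals_Archimedean3 by blast
      have "\<phi> n x = 1" if "n \<ge> n0" for n
      proof -
        have "real n0 * (x * (2 * pi - x)) \<le> real n * (x * (2 * pi - x))"
          using that \<open>0 < x * (2 * pi - x)\<close> by (intro mult_right_mono) auto
        then show ?thesis using n0 by (simp add: \<phi>_def)
      qed
      then have "\<forall>\<^sub>F n in sequentially. clamp_norm K (g n x) = h n x"
        by (intro eventually_sequentiallyI[of n0]) (simp add: h_def)
      with 1 have "(\<lambda>n. h n x) \<longlonglongrightarrow> f x" by (rule Lim_transform_eventually)
      then have "(\<lambda>n. (norm (f x - h n x))\<^sup>2) \<longlonglongrightarrow> (norm (f x - f x))\<^sup>2"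
        by (intro tendsto_intros)
      then show ?thesis using False by (simp add: d_def)
    qed (simp add: d_def)
  qed (rule d_int)
  then have "\<forall>\<^sub>F n in sequentially. integral {0..2*pi} (d n) < e"
    using e by (intro order_tendstoD) auto
  then obtain n where "integral {0..2*pi} (d n) < e" by (auto simp: eventually_sequentially)
  then show thesis
    using that[of "h n"] h_cont int by (auto simp: d_eq h_def \<phi>_def)
qed

text \<open>Truncations of G converge to it in mean square, dominated by |G|^2, and a truncation
  falls under the bounded case. The quarters of e pay for the factor 2 in
  \<open>norm_add_power2_le\<close>.\<close>

lemma continuous_dense_L2:
  assumes G: "L2_on {0..2*pi} G" and e: "e > 0"
  obtains h where "continuous_on {0..2*pi} h" "h 0 = h (2*pi)"
    "integral {0..2*pi} (\<lambda>x. (norm (G x - h x))\<^sup>2) < e"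
proof -
  define c where "c = (\<lambda>n x. clamp_norm (real (Suc n)) (G x))"
  have Gm: "G \<in> borel_measurable (lebesgue_on {0..2*pi})" using G by (simp add: L2_on_iff)
  have cm: "c n \<in> borel_measurable (lebesgue_on {0..2*pi})" for n
    unfolding c_def using Gm
    by (rule measurable_compose[OF _ borel_measurable_continuous_onI]) (simp add: continuous_clamp_norm)
  have cb: "norm (c n x) \<le> real (Suc n)" for n x
    unfolding c_def by (rule norm_clamp_norm_le) simp
  have c2: "L2_on {0..2*pi} (c n)" for n
    using cm by (rule L2_on_bounded_by[of _ _ _ "\<lambda>_. (real (Suc n))\<^sup>2"]) (use cb in \<open>auto intro: power_mono simp del: of_nat_Suc\<close>)
  have int: "(\<lambda>x. (norm (G x - c n x))\<^sup>2) integrable_on {0..2*pi}" for n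
    using L2_on_diff[OF G c2] by (simp add: L2_on_def)
  have "(\<lambda>n. integral {0..2*pi} (\<lambda>x. (norm (G x - c n x))\<^sup>2)) \<longlonglongrightarrow> integral {0..2*pi} (\<lambda>x. 0::real)"
  proof (rule dominated_convergence(2)[OF int])
    show "(\<lambda>x. (norm (G x))\<^sup>2) integrable_on {0..2*pi}" using G by (simp add: L2_on_def)
    show "norm ((norm (G x - c n x))\<^sup>2) \<le> (norm (G x))\<^sup>2" for n x
      using norm_clamp_norm_le(2)[of "real (Suc n)" "G x"] by (simp add: c_def power_mono del: of_nat_Suc)
    show "(\<lambda>n. (norm (G x - c n x))\<^sup>2) \<longlonglongrightarrow> 0" for x
    proof (rule tendsto_eventually)
      obtain n0 :: nat where n0: "norm (G x) \<le> real n0" using real_arch_simple by blast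
      have "c n x = G x" if "n \<ge> n0" for n
        unfolding c_def using n0 that by (intro clamp_norm_eq) auto
      then show "\<forall>\<^sub>F n in sequentially. (norm (G x - c n x))\<^sup>2 = 0"
        by (intro eventually_sequentiallyI[of n0]) simp
    qed
  qed
  then have "\<forall>\<^sub>F n in sequentially. integral {0..2*pi} (\<lambda>x. (norm (G x - c n x))\<^sup>2) < e / 4"
    using e by (intro order_tendstoD) auto
  then obtain n where n: "integral {0..2*pi} (\<lambda>x. (norm (G x - c n x))\<^sup>2) < e / 4"
    by (auto simp: eventually_sequentially)
  have "c n measurable_on {0..2*pi}" using cm by (simp add: measurable_on_iff_borel_measurable)
  then obtain h where h: "continuous_on UNIV h" "h 0 = 0" "h (2*pi) = 0"
    "(\<lambda>x. (norm (c n x - h x))\<^sup>2) integrable_on {0..2*pi}"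
    "integral {0..2*pi} (\<lambda>x. (norm (c n x - h x))\<^sup>2) < e / 4"
    by (rule continuous_dense_bounded[OF _ _ cb[of n], where e = "e / 4"]) (use e in auto)
  have hc: "continuous_on {0..2*pi} h" using h(1) continuous_on_subset by blast
  have "integral {0..2*pi} (\<lambda>x. (norm (G x - h x))\<^sup>2) \<le>
      integral {0..2*pi} (\<lambda>x. 2 * (norm (G x - c n x))\<^sup>2 + 2 * (norm (c n x - h x))\<^sup>2)"
  proof (rule integral_le)
    show "(\<lambda>x. (norm (G x - h x))\<^sup>2) integrable_on {0..2*pi}"
      using L2_on_diff[OF G L2_on_continuous[OF hc]] by (simp add: L2_on_def)
    show "(\<lambda>x. 2 * (norm (G x - c n x))\<^sup>2 + 2 * (norm (c n x - h x))\<^sup>2) integrable_on {0..2*pi}"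
      by (intro integrable_add integrable_on_mult_right int h(4))
    show "(norm (G x - h x))\<^sup>2 \<le> 2 * (norm (G x - c n x))\<^sup>2 + 2 * (norm (c n x - h x))\<^sup>2" for x
      using norm_add_power2_le[of "G x - c n x" "c n x - h x"] by simp
  qed
  also have "\<dots> = 2 * integral {0..2*pi} (\<lambda>x. (norm (G x - c n x))\<^sup>2) + 2 * integral {0..2*pi} (\<lambda>x. (norm (c n x - h x))\<^sup>2)"
    by (subst Henstock_Kurzweil_Integration.integral_add) (auto intro: int h(4) integrable_on_mult_right)
  also have "\<dots> < e" using n h(5) by simp
  finally show thesis using that[OF hc] h(2,3) by simp
qed

lemma trig_poly_dense_L2:
  assumes G: "L2_on {0..2*pi} G" and e: "e > 0"
  obtains T where "trig_poly T" "integral {0..2*pi} (\<lambda>x. (norm (G x - T x))\<^sup>2) < e"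
proof -
  obtain h where h: "continuous_on {0..2*pi} h" "h 0 = h (2*pi)"
    "integral {0..2*pi} (\<lambda>x. (norm (G x - h x))\<^sup>2) < e / 4"
    by (rule continuous_dense_L2[OF G, of "e / 4"]) (use e in auto)
  \<comment> \<open>A uniform error r adds 2 \<pi> * 2 r^2 = e / 4.\<close>
  define r where "r = sqrt (e / (16 * pi))"
  have r: "0 < r" "r\<^sup>2 = e / (16 * pi)" using e by (simp_all add: r_def)
  obtain T where T: "trig_poly T" "\<And>x. x \<in> {0..2*pi} \<Longrightarrow> norm (h x - T x) < r"
    using trig_poly_dense_continuous[OF h(1,2) r(1)] by blast
  obtain M t where t: "\<And>N. M \<le> N \<Longrightarrow> T = (\<lambda>x. \<Sum>j\<in>{-int N..int N}. t j * e_basis j x)"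
    by (rule trig_poly_expansion[OF T(1)]) (rule that)
  have T2: "L2_on {0..2*pi} T"
    unfolding t[OF order_refl] by (intro L2_on_sum L2_on_cmult L2_on_e_basis)
  have Gh: "(\<lambda>x. (norm (G x - h x))\<^sup>2) integrable_on {0..2*pi}"
    using L2_on_diff[OF G L2_on_continuous[OF h(1)]] by (simp add: L2_on_def)
  have "integral {0..2*pi} (\<lambda>x. (norm (G x - T x))\<^sup>2) \<le> integral {0..2*pi} (\<lambda>x. 2 * (norm (G x - h x))\<^sup>2 + 2 * r\<^sup>2)"
  proof (rule integral_le)
    show "(\<lambda>x. (norm (G x - T x))\<^sup>2) integrable_on {0..2*pi}"
      using L2_on_diff[OF G T2] by (simp add: L2_on_def)
    show "(\<lambda>x. 2 * (norm (G x - h x))\<^sup>2 + 2 * r\<^sup>2) integrable_on {0..2*pi}"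
      by (intro integrable_add integrable_on_mult_right Gh integrable_const_ivl)
    show "(norm (G x - T x))\<^sup>2 \<le> 2 * (norm (G x - h x))\<^sup>2 + 2 * r\<^sup>2" if "x \<in> {0..2*pi}" for x
    proof -
      have "(norm (h x - T x))\<^sup>2 \<le> r\<^sup>2" using T(2)[OF that] by (intro power_mono) auto
      with norm_add_power2_le[of "G x - h x" "h x - T x"] show ?thesis by simp
    qed
  qed
  also have "\<dots> = 2 * integral {0..2*pi} (\<lambda>x. (norm (G x - h x))\<^sup>2) + integral {0..2*pi} (\<lambda>x. 2 * r\<^sup>2)"
    by (subst Henstock_Kurzweil_Integration.integral_add) (auto intro: Gh integrable_on_mult_right integrable_const_ivl)
  also have "integral {0..2*pi} (\<lambda>x::real. 2 * r\<^sup>2) = 2 * pi * (2 * r\<^sup>2)" by simp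
  also have "2 * pi * (2 * r\<^sup>2) = e / 4" by (simp add: r(2))
  also have "2 * integral {0..2*pi} (\<lambda>x. (norm (G x - h x))\<^sup>2) + e / 4 < e" using h(3) e by simp
  finally show thesis using that[OF T(1)] by simp
qed

text \<open>A trigonometric polynomial close to G lies in the span for every N >= M, and there the
  Fourier partial sum is at least as close by \<open>L2_dist_trig_poly\<close>.\<close>

theorem fourier_series_L2_convergence:
  assumes G: "L2_on {0..2*pi} G"
  shows "(\<lambda>N. integral {0..2*pi} (\<lambda>x. (norm (G x - (\<Sum>j\<in>{-int N..int N}. fourier_coeff G j * e_basis j x)))\<^sup>2)) \<longlonglongrightarrow> 0"
proof (rule LIMSEQ_I)
  fix e :: real assume e: "0 < e"
  obtain T where T: "trig_poly T" "integral {0..2*pi} (\<lambda>x. (norm (G x - T x))\<^sup>2) < e"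
    using trig_poly_dense_L2[OF G e] .
  obtain M t where t: "\<And>N. M \<le> N \<Longrightarrow> T = (\<lambda>x. \<Sum>j\<in>{-int N..int N}. t j * e_basis j x)"
    by (rule trig_poly_expansion[OF T(1)]) (rule that)
  have "norm (integral {0..2*pi} (\<lambda>x. (norm (G x - (\<Sum>j\<in>{-int N..int N}. fourier_coeff G j * e_basis j x)))\<^sup>2) - 0) < e"
    if "M \<le> N" for N
  proof -
    let ?I = "\<lambda>c. integral {0..2*pi} (\<lambda>x. (norm (G x - (\<Sum>j\<in>{-int N..int N}. c j * e_basis j x)))\<^sup>2)"
    have "?I (fourier_coeff G) \<le> ?I t"
      by (simp add: L2_dist_trig_poly[OF G] sum_nonneg)
    also have "\<dots> < e" using T(2) unfolding t[OF that] .
    finally have "?I (fourier_coeff G) < e" .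
    moreover have "0 \<le> ?I (fourier_coeff G)"
    proof (rule integral_nonneg)
      have "L2_on {0..2*pi} (\<lambda>x. G x - (\<Sum>j\<in>{-int N..int N}. fourier_coeff G j * e_basis j x))"
        by (intro L2_on_diff[OF G L2_on_sum] L2_on_cmult L2_on_e_basis)
      then show "(\<lambda>x. (norm (G x - (\<Sum>j\<in>{-int N..int N}. fourier_coeff G j * e_basis j x)))\<^sup>2) integrable_on {0..2*pi}"
        by (simp add: L2_on_def)
    qed auto
    ultimately show ?thesis by simp
  qed
  then show "\<exists>M. \<forall>N\<ge>M. norm (integral {0..2*pi} (\<lambda>x. (norm (G x - (\<Sum>j\<in>{-int N..int N}. fourier_coeff G j * e_basis j x)))\<^sup>2) - 0) < e"
    by (intro exI[of _ M] allI impI)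
qed

text \<open>Both cases reduce to a computation of Fourier coefficients: the partial sums of the
  solution are then the Fourier partial sums of g.\<close>

lemma PP_solution_atI:
  assumes g: "L2_on {0..2*pi} g"
    and coeff: "\<And>j. fourier_coeff g j = fourier_coeff z0 j * exp (- \<i> * of_real (A_sym \<alpha> \<theta> n (of_int j) * t))"
  shows "PP_solution_at \<alpha> \<theta> n z0 t g"
  unfolding PP_solution_at_def PP_partial_def coeff[symmetric]
  using g fourier_series_L2_convergence[OF g] by (simp add: norm_minus_commute)

section \<open>Rational revivals\<close>

text \<open>Cut the interval at \<open>c - \<sigma>\<close> and exchange the two pieces.\<close>

lemma has_integral_rotate:
  fixes H :: "real \<Rightarrow> 'a::banach"
  assumes H: "(H has_integral I) {0..c}" and \<sigma>: "0 \<le> \<sigma>" "\<sigma> \<le> c"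
  shows "((\<lambda>x. if x < \<sigma> then H (x - \<sigma> + c) else H (x - \<sigma>)) has_integral I) {0..c}"
proof -
  obtain I1 I2 where I1: "(H has_integral I1) {0..c-\<sigma>}" and I2: "(H has_integral I2) {c-\<sigma>..c}"
  proof -
    have "H integrable_on {0..c-\<sigma>}" "H integrable_on {c-\<sigma>..c}"
      using \<sigma> by (auto intro: integrable_subinterval_real[OF has_integral_integrable[OF H]])
    then show thesis using that by (meson integrable_integral)
  qed
  have I: "I = I2 + I1"
    using has_integral_unique[OF H has_integral_combine[OF _ _ I1 I2]] \<sigma> by (simp add: add.commute)
  have J1: "((\<lambda>x. H (x - \<sigma>)) has_integral I1) {\<sigma>..c}"
    using has_integral_affinity'[of H I1 0 "c - \<sigma>" 1 "- \<sigma>"] I1 by simp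
  have J2: "((\<lambda>x. H (x - \<sigma> + c)) has_integral I2) {0..\<sigma>}"
    using has_integral_affinity'[of H I2 "c - \<sigma>" c 1 "c - \<sigma>"] I2 by (simp add: algebra_simps)
  have K1: "((\<lambda>x. if x < \<sigma> then H (x - \<sigma> + c) else H (x - \<sigma>)) has_integral I1) {\<sigma>..c}"
    using J1 by (rule has_integral_eq[rotated]) auto
  have K2: "((\<lambda>x. if x < \<sigma> then H (x - \<sigma> + c) else H (x - \<sigma>)) has_integral I2) {0..\<sigma>}"
    using J2 by (rule has_integral_spike_finite[of "{\<sigma>}", rotated 2]) auto
  from has_integral_combine[OF \<sigma> K2 K1] show ?thesis by (simp add: I)
qed

lemma per_ext_shift:
  assumes \<sigma>: "0 \<le> \<sigma>" "\<sigma> \<le> 2*pi" and x: "0 \<le> x" "x < 2*pi"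
  shows "per_ext f (x - \<sigma>) = (if x < \<sigma> then f (x - \<sigma> + 2*pi) else f (x - \<sigma>))"
proof (cases "x < \<sigma>")
  case True
  then have "\<lfloor>(x - \<sigma>) / (2 * pi)\<rfloor> = - 1"
    using \<sigma> x by (subst floor_eq_iff) (simp add: field_simps)
  then show ?thesis using True by (simp add: per_ext_def)
next
  case False
  then have "\<lfloor>(x - \<sigma>) / (2 * pi)\<rfloor> = 0"
    using \<sigma> x by (subst floor_eq_iff) (simp add: field_simps)
  then show ?thesis using False by (simp add: per_ext_def)
qed

text \<open>\<open>G\<close> takes the point and the value separately, so that one statement covers
  f, |f|^2 and f times a conjugate exponential. Only the endpoint 2 \<pi>, where the extension wraps
  around, has to be excepted.\<close>

lemma has_integral_per_ext_shift:
  fixes G :: "real \<Rightarrow> complex \<Rightarrow> 'b::banach"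
  assumes H: "((\<lambda>x. G x (f x)) has_integral I) {0..2*pi}" and \<sigma>: "0 \<le> \<sigma>" "\<sigma> \<le> 2*pi"
    and per: "\<And>x y. G (x + 2*pi) y = G x y"
  shows "((\<lambda>x. G (x - \<sigma>) (per_ext f (x - \<sigma>))) has_integral I) {0..2*pi}"
  using has_integral_rotate[OF H \<sigma>]
  by (rule has_integral_spike_finite[of "{2*pi}", rotated 2]) (use \<sigma> in \<open>auto simp: per_ext_shift per\<close>)

lemma L2_on_per_ext_shift:
  assumes f: "L2_on {0..2*pi} f" and \<sigma>: "0 \<le> \<sigma>" "\<sigma> \<le> 2*pi"
  shows "L2_on {0..2*pi} (\<lambda>x. per_ext f (x - \<sigma>))"
  unfolding L2_on_iff
proof
  \<comment> \<open>Measurability of the translate will be read off from its integrability.\<close>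
  have "f integrable_on {0..2*pi}"
    using L2_on_mult_integrable[OF f L2_on_continuous[of _ _ "\<lambda>_. 1"]] by (simp add: absolutely_integrable_on_def)
  then obtain I where "(f has_integral I) {0..2*pi}" by blast
  from has_integral_per_ext_shift[of "\<lambda>x y. y", OF this \<sigma>]
  have "(\<lambda>x. per_ext f (x - \<sigma>)) integrable_on {0..2*pi}" by auto
  then show "(\<lambda>x. per_ext f (x - \<sigma>)) \<in> borel_measurable (lebesgue_on {0..2*pi})"
    by (rule integrable_imp_measurable)
  obtain J where "((\<lambda>x. (norm (f x))\<^sup>2) has_integral J) {0..2*pi}"
    using f unfolding L2_on_def by blast
  from has_integral_per_ext_shift[of "\<lambda>x y. (norm y)\<^sup>2", OF this \<sigma>]
  show "(\<lambda>x. (norm (per_ext f (x - \<sigma>)))\<^sup>2) integrable_on {0..2*pi}" by auto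
qed

lemma e_basis_add: "e_basis j (x + y) = cis (of_int j * y) * e_basis j x"
proof -
  have "cis (of_int j * (x + y)) = cis (of_int j * y) * cis (of_int j * x)"
    by (simp add: cis_mult algebra_simps)
  then show ?thesis by (simp add: e_basis_cis)
qed

lemma cis_int_2pi: "cis (of_int j * (2 * pi)) = 1"
  using cis_multiple_2pi[of "of_int j"] by (simp add: mult_ac)

lemma fourier_coeff_per_ext_shift:
  assumes f: "L2_on {0..2*pi} f" and \<sigma>: "0 \<le> \<sigma>" "\<sigma> \<le> 2*pi"
  shows "fourier_coeff (\<lambda>x. per_ext f (x - \<sigma>)) j = fourier_coeff f j * cis (- (of_int j * \<sigma>))"
proof -
  have "((\<lambda>x. per_ext f (x - \<sigma>) * cnj (e_basis j (x - \<sigma>))) has_integral fourier_coeff f j) {0..2*pi}"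
    using has_integral_per_ext_shift[of "\<lambda>x y. y * cnj (e_basis j x)", OF fourier_coeff_has_integral[OF f] \<sigma>]
    by (simp add: e_basis_add cis_int_2pi)
  then have "((\<lambda>x. per_ext f (x - \<sigma>) * cnj (e_basis j (x - \<sigma>)) * cis (- (of_int j * \<sigma>)))
      has_integral fourier_coeff f j * cis (- (of_int j * \<sigma>))) {0..2*pi}"
    by (rule has_integral_mult_left)
  moreover have "cnj (e_basis j (x - \<sigma>)) * cis (- (of_int j * \<sigma>)) = cnj (e_basis j x)" for x
    using arg_cong[OF e_basis_add[of j "x - \<sigma>" \<sigma>], of cnj] by (simp add: cis_cnj mult.commute)
  ultimately show ?thesis
    unfolding fourier_coeff_def[of "\<lambda>x. per_ext f (x - \<sigma>)"] by (intro integral_unique) (simp add: mult.assoc)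
qed

lemma fourier_coeff_sum:
  assumes "finite F" "\<And>s. s \<in> F \<Longrightarrow> L2_on {0..2*pi} (f s)"
  shows "fourier_coeff (\<lambda>x. \<Sum>s\<in>F. c s * f s x) j = (\<Sum>s\<in>F. c s * fourier_coeff (f s) j)"
proof -
  have "((\<lambda>x. \<Sum>s\<in>F. c s * (f s x * cnj (e_basis j x))) has_integral (\<Sum>s\<in>F. c s * fourier_coeff (f s) j)) {0..2*pi}"
    by (intro has_integral_sum has_integral_mult_right fourier_coeff_has_integral assms)
  then show ?thesis
    unfolding fourier_coeff_def[of "\<lambda>x. \<Sum>s\<in>F. c s * f s x"]
    by (intro integral_unique) (simp add: sum_distrib_right mult.assoc)
qed

lemma PP_multiplier_ue:
  "exp (- \<i> * of_real (A_sym \<alpha> \<theta> n (of_int j) * (2 * pi * of_int p / of_int q))) =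
     ue (- (A_sym \<alpha> \<theta> n (of_int j) * of_int p / of_int q))"
  unfolding ue_def cis_conv_exp by (rule arg_cong[of _ _ exp]) simp

text \<open>The period is q b^n: a k-th power changes by a multiple of it, q cancels the denominator
  of the time, and b^n clears that of \<open>\<theta> ^ (m - k)\<close> since m - k <= n.\<close>

lemma A_sym_periodic_mod_Ints:
  fixes p q a b :: int
  assumes q: "q > 0" and b: "b > 0" and \<theta>: "\<theta> = of_int a / of_int b"
  shows "A_sym \<alpha> \<theta> n (of_int (j + q * b ^ n)) * of_int p / of_int q - A_sym \<alpha> \<theta> n (of_int j) * of_int p / of_int q \<in> \<int>"
proof -
  let ?M = "q * b ^ n"
  have summand: "\<theta> ^ (m - k) * ((of_int (j + ?M)) ^ k - of_int j ^ k) / of_int q \<in> \<int>" if m: "m \<in> {2..n}" for m k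
  proof -
    have "?M dvd (j + ?M) ^ k - j ^ k"
      using power_diff_sumr2[of "j + ?M" k j] by simp
    then obtain i where i: "(j + ?M) ^ k - j ^ k = ?M * i" by (rule dvdE)
    have "(of_int (j + ?M)) ^ k - of_int j ^ k = (of_int ((j + ?M) ^ k - j ^ k) :: real)" by simp
    also have "\<dots> = of_int q * of_int b ^ n * of_int i" unfolding i by simp
    finally have eq: "(of_int (j + ?M)) ^ k - of_int j ^ k = (of_int q * of_int b ^ n * of_int i :: real)" .
    have "n = (m - k) + (n - (m - k))" using m by auto
    then have "(of_int b :: real) ^ n = of_int b ^ (m - k) * of_int b ^ (n - (m - k))"
      by (metis power_add)
    then have "\<theta> ^ (m - k) * of_int b ^ n = of_int (a ^ (m - k) * b ^ (n - (m - k)))"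
      using b by (simp add: \<theta> power_divide)
    then have "\<theta> ^ (m - k) * ((of_int (j + ?M)) ^ k - of_int j ^ k) / of_int q = of_int (a ^ (m - k) * b ^ (n - (m - k)) * i)"
      unfolding eq using q by (simp add: mult_ac)
    then show ?thesis by (simp only: Ints_of_int)
  qed
  have "A_sym \<alpha> \<theta> n (of_int (j + ?M)) * of_int p / of_int q - A_sym \<alpha> \<theta> n (of_int j) * of_int p / of_int q =
     (\<Sum>m=2..n. of_int (\<alpha> m) * (\<Sum>k=2..m. of_nat (m choose k) *
        (\<theta> ^ (m - k) * ((of_int (j + ?M)) ^ k - of_int j ^ k) / of_int q))) * of_int p"
    unfolding A_sym_def sum_distrib_left sum_distrib_right sum_divide_distrib sum_subtractf[symmetric]
    by (intro sum.cong refl) (simp add: diff_divide_distrib algebra_simps)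
  also have "\<dots> \<in> \<int>"
    by (intro Ints_mult Ints_sum Ints_of_int Ints_of_nat summand)
  finally show ?thesis .
qed

theorem PP_solution_rational:
  fixes p q :: int
  assumes \<theta>: "\<theta> \<in> \<rat>" and q: "q > 0" and z0: "L2_on {0..2*pi} z0"
  shows "\<exists>(N::nat) (c::nat \<Rightarrow> complex) (\<sigma>::nat \<Rightarrow> real).
           PP_solution_at \<alpha> \<theta> n z0 (2 * pi * of_int p / of_int q) (\<lambda>x. \<Sum>j=1..N. c j * per_ext z0 (x - \<sigma> j))"
proof -
  obtain a b :: int where ab: "b > 0" "\<theta> = of_int a / of_int b"
    using \<theta> by (rule Rats_cases')
  define M where "M = nat (q * b ^ n)"
  have M: "int M = q * b ^ n" "M > 0" using q ab(1) by (auto simp: M_def)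
  define m where "m = (\<lambda>j. ue (- (A_sym \<alpha> \<theta> n (of_int j) * of_int p / of_int q)))"
  have "m (l + int M) = m l" for l
    unfolding m_def M(1)
    using Ints_minus[OF A_sym_periodic_mod_Ints[OF q ab, of \<alpha> n l p]] by (intro ue_cong_int) simp
  then obtain c where c: "\<And>l. m l = (\<Sum>s<M. c s * ue (real s * of_int l / real M))"
    by (rule finite_fourier_expansion[OF M(2)]) (auto simp: m_def intro: that)
  \<comment> \<open>Translation by \<sigma> multiplies the l-th coefficient by exp (-i l \<sigma>),
    so the character with index s = j - 1 needs the shift -2 \<pi> s / M, moved into [0, 2 \<pi>] by
    one full period.\<close>
  define \<sigma> where "\<sigma> = (\<lambda>j. 2 * pi * (1 - real (j - 1) / real M))"
  have \<sigma>: "0 \<le> \<sigma> j" "\<sigma> j \<le> 2 * pi" if "j \<in> {1..M}" for j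
  proof -
    have "0 \<le> 1 - real (j - 1) / real M" "1 - real (j - 1) / real M \<le> 1"
      using that M(2) by auto
    then show "0 \<le> \<sigma> j" "\<sigma> j \<le> 2 * pi"
      unfolding \<sigma>_def by (auto intro: mult_nonneg_nonneg mult_left_le)
  qed
  have shift: "cis (- (of_int l * \<sigma> j)) = ue (real (j - 1) * of_int l / real M)" for l j
  proof -
    have "- (of_int l * \<sigma> j) = 2 * pi * (real (j - 1) * of_int l / real M) + 2 * pi * of_int (- l)"
      using M(2) by (simp add: \<sigma>_def algebra_simps)
    then show ?thesis by (simp only: ue_add[unfolded ue_def] ue_def flip: distrib_left) (simp flip: ue_def del: of_int_minus)
  qed
  have "PP_solution_at \<alpha> \<theta> n z0 (2 * pi * of_int p / of_int q) (\<lambda>x. \<Sum>j=1..M. c (j - 1) * per_ext z0 (x - \<sigma> j))"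
  proof (rule PP_solution_atI)
    show "L2_on {0..2*pi} (\<lambda>x. \<Sum>j=1..M. c (j - 1) * per_ext z0 (x - \<sigma> j))"
      by (intro L2_on_sum L2_on_cmult L2_on_per_ext_shift z0 \<sigma>)
    fix l
    have "fourier_coeff (\<lambda>x. \<Sum>j=1..M. c (j - 1) * per_ext z0 (x - \<sigma> j)) l =
        (\<Sum>j=1..M. c (j - 1) * fourier_coeff (\<lambda>x. per_ext z0 (x - \<sigma> j)) l)"
      by (rule fourier_coeff_sum) (auto intro!: L2_on_per_ext_shift z0 \<sigma>)
    also have "\<dots> = (\<Sum>j=1..M. c (j - 1) * (fourier_coeff z0 l * ue (real (j - 1) * of_int l / real M)))"
      by (intro sum.cong refl) (simp add: fourier_coeff_per_ext_shift[OF z0 \<sigma>] shift)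
    also have "\<dots> = fourier_coeff z0 l * m l"
      by (simp add: c sum.atLeast1_atMost_eq sum_distrib_left mult_ac)
    finally show "fourier_coeff (\<lambda>x. \<Sum>j=1..M. c (j - 1) * per_ext z0 (x - \<sigma> j)) l =
        fourier_coeff z0 l * exp (- \<i> * of_real (A_sym \<alpha> \<theta> n (of_int l) * (2 * pi * of_int p / of_int q)))"
      unfolding m_def PP_multiplier_ue .
  qed
  then show ?thesis
    by (intro exI[of _ M] exI[of _ "\<lambda>j. c (j - 1)"] exI[of _ \<sigma>])
qed

section \<open>Continuity for initial data of bounded variation\<close>

definition variation_sums :: "(real \<Rightarrow> complex) \<Rightarrow> real \<Rightarrow> real \<Rightarrow> real set" where
  "variation_sums f a x = {\<Sum>i<k. norm (f (xs (Suc i)) - f (xs i)) | (k::nat) xs.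
     xs 0 = a \<and> xs k = x \<and> (\<forall>i<k. xs i \<le> xs (Suc i))}"

lemma variation_sums_extend:
  assumes "v \<in> variation_sums f a x" "x \<le> y"
  shows "v + norm (f y - f x) \<in> variation_sums f a y"
proof -
  obtain k xs where xs: "v = (\<Sum>i<k. norm (f (xs (Suc i)) - f (xs i)))"
    "xs 0 = a" "xs k = x" "\<forall>i<k. xs i \<le> xs (Suc i)"
    using assms(1) unfolding variation_sums_def by blast
  define ys where "ys = xs(Suc k := y)"
  have "v + norm (f y - f x) = (\<Sum>i<Suc k. norm (f (ys (Suc i)) - f (ys i)))"
    by (simp add: ys_def xs(1,3))
  moreover have "ys 0 = a" "ys (Suc k) = y" "\<forall>i<Suc k. ys i \<le> ys (Suc i)"
    using xs assms(2) by (auto simp: ys_def less_Suc_eq)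
  ultimately show ?thesis unfolding variation_sums_def by blast
qed

text \<open>\<open>V\<close> is the total variation on [a, x]. In this form the inequality makes V,
  Re f + V and Im f + V increasing at once.\<close>

lemma jordan_decomposition:
  assumes bv: "bounded_variation_on f a b" and ab: "a \<le> b"
  obtains V :: "real \<Rightarrow> real" where
    "\<And>x y. a \<le> x \<Longrightarrow> x \<le> y \<Longrightarrow> y \<le> b \<Longrightarrow> V x + norm (f y - f x) \<le> V y"
proof -
  define V where "V = (\<lambda>x. Sup (variation_sums f a x))"
  obtain B where B: "\<And>(k::nat) (xs::nat \<Rightarrow> real). xs 0 = a \<and> xs k = b \<and> (\<forall>i<k. xs i \<le> xs (Suc i)) \<Longrightarrow>
      (\<Sum>i<k. norm (f (xs (Suc i)) - f (xs i))) \<le> B"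
    using bv unfolding bounded_variation_on_def by blast
  then have Bb: "v \<le> B" if "v \<in> variation_sums f a b" for v
    using that unfolding variation_sums_def by blast
  have bdd: "bdd_above (variation_sums f a x)" if "x \<le> b" for x
  proof (rule bdd_aboveI)
    fix v assume "v \<in> variation_sums f a x"
    from Bb[OF variation_sums_extend[OF this that]] norm_ge_zero[of "f b - f x"] show "v \<le> B" by linarith
  qed
  have zero: "0 \<in> variation_sums f a a"
    unfolding variation_sums_def by (rule CollectI, rule exI[of _ 0], rule exI[of _ "\<lambda>_. a"]) simp
  have "V x + norm (f y - f x) \<le> V y" if "a \<le> x" "x \<le> y" "y \<le> b" for x y
  proof -
    have "V x \<le> V y - norm (f y - f x)"
      unfolding V_def
    proof (rule cSup_least)
      show "variation_sums f a x \<noteq> {}" using variation_sums_extend[OF zero that(1)] by blast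
      fix v assume "v \<in> variation_sums f a x"
      from cSup_upper[OF variation_sums_extend[OF this that(2)] bdd[OF that(3)]]
      show "v \<le> Sup (variation_sums f a y) - norm (f y - f x)" by simp
    qed
    then show ?thesis by simp
  qed
  then show thesis by (rule that)
qed

text \<open>Takes the place of integration by parts against dg: the second mean value theorem turns
  the integral into g(a) and g(b) times integrals of \<phi> over subintervals, and each of these is
  a difference of two values of \<Phi>.\<close>

lemma monotone_integral_bound_real:
  fixes g \<Phi> \<phi> :: "real \<Rightarrow> real"
  assumes ab: "a \<le> b" and g: "\<And>x y. a \<le> x \<Longrightarrow> x \<le> y \<Longrightarrow> y \<le> b \<Longrightarrow> g x \<le> g y"
    and d: "\<And>x. x \<in> {a..b} \<Longrightarrow> (\<Phi> has_vector_derivative \<phi> x) (at x within {a..b})"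
    and e: "\<And>x. x \<in> {a..b} \<Longrightarrow> \<bar>\<Phi> x\<bar> \<le> \<epsilon>"
  obtains J where "((\<lambda>x. g x * \<phi> x) has_integral J) {a..b}" "\<bar>J\<bar> \<le> 2 * (\<bar>g a\<bar> + \<bar>g b\<bar>) * \<epsilon>"
proof -
  have int: "(\<phi> has_integral \<Phi> v - \<Phi> u) {u..v}" if "a \<le> u" "u \<le> v" "v \<le> b" for u v
    using that by (intro fundamental_theorem_of_calculus) (auto intro: has_vector_derivative_within_subset[OF d])
  obtain c where c: "c \<in> {a..b}" and J: "((\<lambda>x. g x * \<phi> x) has_integral (g a * integral {a..c} \<phi> + g b * integral {c..b} \<phi>)) {a..b}"
    by (rule second_mean_value_theorem_full[OF has_integral_integrable[OF int] ab g]) (use ab in auto)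
  have 1: "\<bar>integral {u..v} \<phi>\<bar> \<le> 2 * \<epsilon>" if "a \<le> u" "u \<le> v" "v \<le> b" for u v
    using integral_unique[OF int[OF that]] e[of u] e[of v] that by auto
  have "\<bar>g a * integral {a..c} \<phi> + g b * integral {c..b} \<phi>\<bar> \<le> \<bar>g a\<bar> * \<bar>integral {a..c} \<phi>\<bar> + \<bar>g b\<bar> * \<bar>integral {c..b} \<phi>\<bar>"
    using abs_triangle_ineq[of "g a * integral {a..c} \<phi>" "g b * integral {c..b} \<phi>"] by (simp add: abs_mult)
  also have "\<dots> \<le> \<bar>g a\<bar> * (2 * \<epsilon>) + \<bar>g b\<bar> * (2 * \<epsilon>)"
    using c by (intro add_mono mult_left_mono 1) auto
  finally show thesis using J that by (simp add: algebra_simps)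
qed

lemma monotone_integral_bound:
  fixes g :: "real \<Rightarrow> real" and \<Phi> \<phi> :: "real \<Rightarrow> complex"
  assumes ab: "a \<le> b" and g: "\<And>x y. a \<le> x \<Longrightarrow> x \<le> y \<Longrightarrow> y \<le> b \<Longrightarrow> g x \<le> g y"
    and d: "\<And>x. x \<in> {a..b} \<Longrightarrow> (\<Phi> has_vector_derivative \<phi> x) (at x within {a..b})"
    and e: "\<And>x. x \<in> {a..b} \<Longrightarrow> norm (\<Phi> x) \<le> \<epsilon>"
  obtains J where "((\<lambda>x. of_real (g x) * \<phi> x) has_integral J) {a..b}" "norm J \<le> 4 * (\<bar>g a\<bar> + \<bar>g b\<bar>) * \<epsilon>"
proof -
  obtain J1 where J1: "((\<lambda>x. g x * Re (\<phi> x)) has_integral J1) {a..b}" "\<bar>J1\<bar> \<le> 2 * (\<bar>g a\<bar> + \<bar>g b\<bar>) * \<epsilon>"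
  proof (rule monotone_integral_bound_real[OF ab g, where \<Phi> = "\<lambda>x. Re (\<Phi> x)" and \<phi> = "\<lambda>x. Re (\<phi> x)" and \<epsilon> = \<epsilon>])
    show "((\<lambda>x. Re (\<Phi> x)) has_vector_derivative Re (\<phi> x)) (at x within {a..b})" if "x \<in> {a..b}" for x
      by (rule bounded_linear.has_vector_derivative[OF bounded_linear_Re d[OF that]])
    show "\<bar>Re (\<Phi> x)\<bar> \<le> \<epsilon>" if "x \<in> {a..b}" for x
      using abs_Re_le_cmod[of "\<Phi> x"] e[OF that] by linarith
  qed auto
  obtain J2 where J2: "((\<lambda>x. g x * Im (\<phi> x)) has_integral J2) {a..b}" "\<bar>J2\<bar> \<le> 2 * (\<bar>g a\<bar> + \<bar>g b\<bar>) * \<epsilon>"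
  proof (rule monotone_integral_bound_real[OF ab g, where \<Phi> = "\<lambda>x. Im (\<Phi> x)" and \<phi> = "\<lambda>x. Im (\<phi> x)" and \<epsilon> = \<epsilon>])
    show "((\<lambda>x. Im (\<Phi> x)) has_vector_derivative Im (\<phi> x)) (at x within {a..b})" if "x \<in> {a..b}" for x
      by (rule bounded_linear.has_vector_derivative[OF bounded_linear_Im d[OF that]])
    show "\<bar>Im (\<Phi> x)\<bar> \<le> \<epsilon>" if "x \<in> {a..b}" for x
      using abs_Im_le_cmod[of "\<Phi> x"] e[OF that] by linarith
  qed auto
  have "((\<lambda>x. of_real (g x * Re (\<phi> x)) + \<i> * of_real (g x * Im (\<phi> x))) has_integral (of_real J1 + \<i> * of_real J2)) {a..b}"
    using has_integral_linear[OF J1(1) bounded_linear_of_real] has_integral_linear[OF J2(1) bounded_linear_of_real]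
    by (intro has_integral_add has_integral_mult_right) (simp_all add: o_def)
  moreover have "of_real (g x * Re (\<phi> x)) + \<i> * of_real (g x * Im (\<phi> x)) = of_real (g x) * \<phi> x" for x
    by (simp add: complex_eq_iff)
  ultimately have "((\<lambda>x. of_real (g x) * \<phi> x) has_integral (of_real J1 + \<i> * of_real J2)) {a..b}" by simp
  moreover have "norm (of_real J1 + \<i> * of_real J2) \<le> \<bar>J1\<bar> + \<bar>J2\<bar>"
    using norm_triangle_ineq[of "of_real J1" "\<i> * of_real J2"] by (simp add: norm_mult)
  ultimately show thesis using that J1(2) J2(2) by (smt (verit) mult_2 ring_class.ring_distribs(2))
qed

text \<open>Write f = (u - V) + \<i> (v - V) with increasing u, v, V. The constant involves only
  their end values, so it serves all \<Phi>.\<close>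

lemma bounded_variation_integral_bound:
  assumes bv: "bounded_variation_on f a b" and ab: "a \<le> b"
  obtains C :: real where "0 \<le> C" "\<And>\<Phi> \<phi> \<epsilon>. (\<And>x. x \<in> {a..b} \<Longrightarrow> (\<Phi> has_vector_derivative \<phi> x) (at x within {a..b})) \<Longrightarrow>
     (\<And>x. x \<in> {a..b} \<Longrightarrow> norm (\<Phi> x) \<le> \<epsilon>) \<Longrightarrow> norm (integral {a..b} (\<lambda>x. f x * \<phi> x)) \<le> C * \<epsilon>"
proof -
  obtain V where V: "\<And>x y. a \<le> x \<Longrightarrow> x \<le> y \<Longrightarrow> y \<le> b \<Longrightarrow> V x + norm (f y - f x) \<le> V y"
    by (rule jordan_decomposition[OF bv ab]) (rule that)
  define u where "u = (\<lambda>x. Re (f x) + V x)"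
  define v where "v = (\<lambda>x. Im (f x) + V x)"
  have u: "u x \<le> u y" and v: "v x \<le> v y" and V': "V x \<le> V y" if "a \<le> x" "x \<le> y" "y \<le> b" for x y
    using V[OF that] abs_Re_le_cmod[of "f y - f x"] abs_Im_le_cmod[of "f y - f x"]
    unfolding u_def v_def by (auto simp: abs_le_iff)
  define K where "K = (\<lambda>g::real \<Rightarrow> real. 4 * (\<bar>g a\<bar> + \<bar>g b\<bar>))"
  have "norm (integral {a..b} (\<lambda>x. f x * \<phi> x)) \<le> (K u + K v + 2 * K V) * \<epsilon>"
    if d: "\<And>x. x \<in> {a..b} \<Longrightarrow> (\<Phi> has_vector_derivative \<phi> x) (at x within {a..b})"
      and e: "\<And>x. x \<in> {a..b} \<Longrightarrow> norm (\<Phi> x) \<le> \<epsilon>" for \<Phi> \<phi> \<epsilon>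
  proof -
    obtain J1 where J1: "((\<lambda>x. of_real (u x) * \<phi> x) has_integral J1) {a..b}" "norm J1 \<le> K u * \<epsilon>"
      unfolding K_def by (rule monotone_integral_bound[OF ab u d e]) (auto intro: that)
    obtain J2 where J2: "((\<lambda>x. of_real (v x) * \<phi> x) has_integral J2) {a..b}" "norm J2 \<le> K v * \<epsilon>"
      unfolding K_def by (rule monotone_integral_bound[OF ab v d e]) (auto intro: that)
    obtain J3 where J3: "((\<lambda>x. of_real (V x) * \<phi> x) has_integral J3) {a..b}" "norm J3 \<le> K V * \<epsilon>"
      unfolding K_def by (rule monotone_integral_bound[OF ab V' d e]) (auto intro: that)
    have "((\<lambda>x. (of_real (u x) * \<phi> x - of_real (V x) * \<phi> x) + \<i> * (of_real (v x) * \<phi> x - of_real (V x) * \<phi> x))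
        has_integral ((J1 - J3) + \<i> * (J2 - J3))) {a..b}"
      by (intro has_integral_add has_integral_diff has_integral_mult_right J1(1) J2(1) J3(1))
    moreover have "(of_real (u x) * \<phi> x - of_real (V x) * \<phi> x) + \<i> * (of_real (v x) * \<phi> x - of_real (V x) * \<phi> x) = f x * \<phi> x" for x
      by (simp add: u_def v_def complex_eq_iff algebra_simps)
    ultimately have "integral {a..b} (\<lambda>x. f x * \<phi> x) = (J1 - J3) + \<i> * (J2 - J3)"
      by (simp add: integral_unique)
    also have "norm \<dots> \<le> norm (J1 - J3) + norm (\<i> * (J2 - J3))" by (rule norm_triangle_ineq)
    also have "\<dots> \<le> (norm J1 + norm J3) + (norm J2 + norm J3)"
      by (intro add_mono norm_triangle_ineq4) (simp add: norm_mult norm_triangle_ineq4)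
    also have "\<dots> \<le> (K u * \<epsilon> + K V * \<epsilon>) + (K v * \<epsilon> + K V * \<epsilon>)"
      by (intro add_mono J1 J2 J3)
    finally show ?thesis by (simp add: algebra_simps)
  qed
  moreover have "0 \<le> K u + K v + 2 * K V" by (simp add: K_def)
  ultimately show thesis using that by blast
qed

section \<open>The polynomial phase and the dyadic partial sums\<close>

definition A_coeff :: "(nat \<Rightarrow> int) \<Rightarrow> real \<Rightarrow> nat \<Rightarrow> nat \<Rightarrow> real" where
  "A_coeff \<alpha> \<theta> n k = (if k < 2 then 0 else \<Sum>m=2..n. if k \<le> m then of_int (\<alpha> m) * of_nat (m choose k) * \<theta> ^ (m - k) else 0)"

lemma A_sym_eq_poly: "A_sym \<alpha> \<theta> n lam = (\<Sum>k\<le>n. A_coeff \<alpha> \<theta> n k * lam ^ k)"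
proof -
  have "(\<Sum>k\<le>n. A_coeff \<alpha> \<theta> n k * lam ^ k) =
    (\<Sum>k\<le>n. \<Sum>m=2..n. if 2 \<le> k \<and> k \<le> m then of_int (\<alpha> m) * (of_nat (m choose k) * \<theta> ^ (m - k) * lam ^ k) else 0)"
    unfolding A_coeff_def by (intro sum.cong refl) (auto simp: sum_distrib_right intro!: sum.cong)
  also have "\<dots> = (\<Sum>m=2..n. \<Sum>k\<le>n. if 2 \<le> k \<and> k \<le> m then of_int (\<alpha> m) * (of_nat (m choose k) * \<theta> ^ (m - k) * lam ^ k) else 0)"
    by (rule sum.swap)
  also have "\<dots> = A_sym \<alpha> \<theta> n lam"
    unfolding A_sym_def sum_distrib_left
    by (intro sum.cong refl sum.mono_neutral_cong_right) auto
  finally show ?thesis by simp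
qed

text \<open>The leading coefficient is an integer; this is the highest degree in which \<theta>
  appears, and it appears linearly with nonzero integer factor when \<alpha>_n is nonzero, so
  irrationality of \<theta> is inherited.\<close>

lemma A_coeff_subleading:
  assumes "3 \<le> n"
  shows "A_coeff \<alpha> \<theta> n (n - 1) = of_int (\<alpha> (n - 1)) + of_int (\<alpha> n) * of_nat n * \<theta>"
proof -
  have "(\<Sum>m=2..n. if n - 1 \<le> m then of_int (\<alpha> m) * of_nat (m choose (n - 1)) * \<theta> ^ (m - (n - 1)) else 0) =
      (\<Sum>m\<in>{n-1, n}. of_int (\<alpha> m) * of_nat (m choose (n - 1)) * \<theta> ^ (m - (n - 1)))"
    using assms by (intro sum.mono_neutral_cong_right) auto
  also have "\<dots> = of_int (\<alpha> (n - 1)) + of_int (\<alpha> n) * of_nat n * \<theta>"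
    using assms binomial_symmetric[of "n - 1" n] by simp
  moreover have "\<not> n - 1 < 2" using assms by simp
  ultimately show ?thesis by (simp only: A_coeff_def if_False)
qed

lemma sum_dyadic_symmetric:
  fixes F :: "int \<Rightarrow> complex"
  assumes "1 \<le> N"
  shows "(\<Sum>l\<in>{- int (2 * N)<..<int (2 * N)}. F l) =
    (\<Sum>l\<in>{- int N<..<int N}. F l) + (\<Sum>l=N..<2*N. F (int l) + F (- int l))"
proof -
  let ?A = "int ` {N..<2*N}" and ?B = "(\<lambda>l. - int l) ` {N..<2*N}"
  have "{- int (2 * N)<..<int (2 * N)} = {- int N<..<int N} \<union> (?A \<union> ?B)"
  proof (intro equalityI subsetI)
    fix l assume l: "l \<in> {- int (2 * N)<..<int (2 * N)}"
    show "l \<in> {- int N<..<int N} \<union> (?A \<union> ?B)"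
    proof (cases "\<bar>l\<bar> < int N")
      case False
      then have "nat \<bar>l\<bar> \<in> {N..<2*N}" using l by auto
      then have "int (nat \<bar>l\<bar>) \<in> ?A" "- int (nat \<bar>l\<bar>) \<in> ?B" by blast+
      then show ?thesis by (cases "l \<ge> 0") auto
    qed auto
  qed (use assms in auto)
  moreover have "sum F ({- int N<..<int N} \<union> (?A \<union> ?B)) = sum F {- int N<..<int N} + (sum F ?A + sum F ?B)"
    using assms by (subst sum.union_disjoint sum.union_disjoint, simp, simp, force)+ simp
  moreover have "sum F ?A = (\<Sum>l=N..<2*N. F (int l))" "sum F ?B = (\<Sum>l=N..<2*N. F (- int l))"
    by (subst sum.reindex; simp add: inj_on_def)+
  ultimately show ?thesis by (simp add: sum.distrib)
qed

text \<open>The exponential \<open>cis (l * u)\<close> is stored as part of the linear coefficient,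
  so that estimates uniform in the linear coefficient are uniform in u.\<close>

definition PP_phase :: "(nat \<Rightarrow> int) \<Rightarrow> real \<Rightarrow> nat \<Rightarrow> real \<Rightarrow> real \<Rightarrow> nat \<Rightarrow> real" where
  "PP_phase \<alpha> \<theta> n r u k = - (A_coeff \<alpha> \<theta> n k * r) + (if k = 1 then u / (2 * pi) else 0)"

lemma ue_PP_phase:
  assumes "1 \<le> n"
  shows "ue (pphase (PP_phase \<alpha> \<theta> n r u) n l) = ue (- (A_sym \<alpha> \<theta> n (of_int l) * r)) * cis (of_int l * u)"
proof -
  have "pphase (PP_phase \<alpha> \<theta> n r u) n l =
      (\<Sum>k\<le>n. - (A_coeff \<alpha> \<theta> n k * of_int l ^ k * r) + (if k = 1 then u / (2 * pi) * of_int l else 0))"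
    unfolding pphase_def PP_phase_def by (intro sum.cong refl) (simp add: algebra_simps)
  also have "\<dots> = - (A_sym \<alpha> \<theta> n (of_int l) * r) + u / (2 * pi) * of_int l"
    unfolding sum.distrib using assms by (simp add: A_sym_eq_poly sum_negf sum_distrib_right)
  finally have "ue (pphase (PP_phase \<alpha> \<theta> n r u) n l) = ue (- (A_sym \<alpha> \<theta> n (of_int l) * r)) * ue (u / (2 * pi) * of_int l)"
    by (simp only: ue_add)
  moreover have "ue (u / (2 * pi) * of_int l) = cis (of_int l * u)"
    by (simp add: ue_def mult.commute)
  ultimately show ?thesis by (simp only:)
qed

lemma cis_has_vector_derivative:
  "((\<lambda>y. cis (c * (x - y))) has_vector_derivative (- \<i> * of_real c * cis (c * (x - y)))) (at y within S)"
  unfolding has_vector_derivative_complex_iff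
  by (auto intro!: derivative_eq_intros simp: has_real_derivative_iff_has_vector_derivative[symmetric])

text \<open>Up to the factor -2 \<pi> \<i>, the sum is the integral of z0(y) against a kernel \<phi>
  in x - y, and the hypothesis bounds the primitive \<Phi> of \<phi> in y. Integration divides by l
  or -l, which turns the sum over a pair into the difference found in \<open>block\<close>. Bounded
  variation supplies one C for all m, J and x.\<close>

lemma fourier_dyadic_bound:
  fixes z0 :: "real \<Rightarrow> complex"
  assumes z0: "L2_on {0..2*pi} z0" and bv: "bounded_variation_on z0 0 (2*pi)"
  shows "\<exists>C\<ge>0. \<forall>m J x \<epsilon>. finite J \<longrightarrow>
     (\<forall>u. norm (\<Sum>j\<in>J. \<Sum>l=2^j..<2*2^j. (m (int l) * cis (of_int (int l) * u) - m (- int l) * cis (of_int (- int l) * u)) / of_nat l) \<le> \<epsilon>) \<longrightarrow>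
     norm (\<Sum>j\<in>J. \<Sum>l=2^j..<2*2^j. fourier_coeff z0 (int l) * m (int l) * e_basis (int l) x
        + fourier_coeff z0 (- int l) * m (- int l) * e_basis (- int l) x) \<le> C * \<epsilon>"
proof -
  obtain C :: real where C: "0 \<le> C" "\<And>\<Phi> \<phi> \<epsilon>. (\<And>x. x \<in> {0..2*pi} \<Longrightarrow> (\<Phi> has_vector_derivative \<phi> x) (at x within {0..2*pi})) \<Longrightarrow>
     (\<And>x. x \<in> {0..2*pi} \<Longrightarrow> norm (\<Phi> x) \<le> \<epsilon>) \<Longrightarrow> norm (integral {0..2*pi} (\<lambda>x. z0 x * \<phi> x)) \<le> C * \<epsilon>"
    by (rule bounded_variation_integral_bound[OF bv]) (auto intro: that)
  have "norm (\<Sum>j\<in>J. \<Sum>l=2^j..<2*2^j. fourier_coeff z0 (int l) * m (int l) * e_basis (int l) x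
        + fourier_coeff z0 (- int l) * m (- int l) * e_basis (- int l) x) \<le> C * \<epsilon>"
    if J: "finite J" and small: "\<And>u. norm (\<Sum>j\<in>J. \<Sum>l=2^j..<2*2^j. (m (int l) * cis (of_int (int l) * u) - m (- int l) * cis (of_int (- int l) * u)) / of_nat l) \<le> \<epsilon>"
    for m J x \<epsilon>
  proof -
    define \<phi> where "\<phi> = (\<lambda>y. \<Sum>j\<in>J. \<Sum>l=2^j..<2*2^j. - \<i> * (m (int l) * cis (of_int (int l) * (x - y)) + m (- int l) * cis (of_int (- int l) * (x - y))))"
    define T where "T = (\<Sum>j\<in>J. \<Sum>l=2^j..<2*2^j. fourier_coeff z0 (int l) * m (int l) * e_basis (int l) x
        + fourier_coeff z0 (- int l) * m (- int l) * e_basis (- int l) x)"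
    have pos: "l > 0" if "l \<in> {2^j..<2*2^j}" for l :: nat and j :: nat
      using that by (metis atLeastLessThan_iff less_le_trans pos2 zero_less_power)
    have "norm (integral {0..2*pi} (\<lambda>y. z0 y * \<phi> y)) \<le> C * \<epsilon>"
    proof (rule C(2))
      let ?\<Phi> = "\<lambda>y. \<Sum>j\<in>J. \<Sum>l=2^j..<2*2^j. (m (int l) * cis (of_int (int l) * (x - y)) - m (- int l) * cis (of_int (- int l) * (x - y))) / of_nat l"
      show "(?\<Phi> has_vector_derivative \<phi> y) (at y within {0..2*pi})" for y
        unfolding \<phi>_def
      proof (intro has_vector_derivative_sum)
        fix j l :: nat assume "l \<in> {2^j..<2*2^j}"
        then have l: "l > 0" by (rule pos)
        have "((\<lambda>y. (m (int l) * cis (of_int (int l) * (x - y)) - m (- int l) * cis (of_int (- int l) * (x - y))) * (1 / of_nat l))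
          has_vector_derivative (m (int l) * (- \<i> * of_real (of_int (int l)) * cis (of_int (int l) * (x - y)))
             - m (- int l) * (- \<i> * of_real (of_int (- int l)) * cis (of_int (- int l) * (x - y)))) * (1 / of_nat l)) (at y within {0..2*pi})"
          by (intro has_vector_derivative_mult_left has_vector_derivative_diff has_vector_derivative_mult_right cis_has_vector_derivative)
        moreover have "(m (int l) * (- \<i> * of_real (of_int (int l)) * cis (of_int (int l) * (x - y)))
             - m (- int l) * (- \<i> * of_real (of_int (- int l)) * cis (of_int (- int l) * (x - y)))) * (1 / of_nat l) =
             - \<i> * (m (int l) * cis (of_int (int l) * (x - y)) + m (- int l) * cis (of_int (- int l) * (x - y)))"
          using l by (simp add: field_simps)
        ultimately show "((\<lambda>y. (m (int l) * cis (of_int (int l) * (x - y)) - m (- int l) * cis (of_int (- int l) * (x - y))) / of_nat l)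
          has_vector_derivative - \<i> * (m (int l) * cis (of_int (int l) * (x - y)) + m (- int l) * cis (of_int (- int l) * (x - y)))) (at y within {0..2*pi})"
          by (simp only: times_divide_eq_right mult_1_right)
      qed
      show "norm (?\<Phi> y) \<le> \<epsilon>" for y by (rule small)
    qed
    moreover have "integral {0..2*pi} (\<lambda>y. z0 y * \<phi> y) = - \<i> * of_real (2 * pi) * T"
    proof (rule integral_unique)
      have one: "((\<lambda>y. z0 y * (m k * cis (of_int k * (x - y)))) has_integral of_real (2 * pi) * (fourier_coeff z0 k * m k * e_basis k x)) {0..2*pi}" for k
      proof -
        have "((\<lambda>y. of_real (2 * pi) * (m k * e_basis k x) * (z0 y * cnj (e_basis k y))) has_integral
            of_real (2 * pi) * (m k * e_basis k x) * fourier_coeff z0 k) {0..2*pi}"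
          by (intro has_integral_mult_right fourier_coeff_has_integral z0)
        moreover have "of_real (2 * pi) * (m k * e_basis k x) * (z0 y * cnj (e_basis k y)) = z0 y * (m k * cis (of_int k * (x - y)))" for y
        proof -
          have "of_real (2 * pi) * (m k * e_basis k x) * (z0 y * cnj (e_basis k y)) =
              of_real (2 * pi) * m k * z0 y * (e_basis k x * cnj (e_basis k y))" by (simp add: mult_ac)
          then show ?thesis unfolding e_basis_mult_cnj right_diff_distrib by simp
        qed
        moreover have "of_real (2 * pi) * (m k * e_basis k x) * fourier_coeff z0 k = of_real (2 * pi) * (fourier_coeff z0 k * m k * e_basis k x)"
          by simp
        ultimately show ?thesis by (simp only:)
      qed
      have "((\<lambda>y. \<Sum>j\<in>J. \<Sum>l=2^j..<2*2^j. - \<i> * (z0 y * (m (int l) * cis (of_int (int l) * (x - y))) + z0 y * (m (- int l) * cis (of_int (- int l) * (x - y)))))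
         has_integral (\<Sum>j\<in>J. \<Sum>l=2^j..<2*2^j. - \<i> * (of_real (2 * pi) * (fourier_coeff z0 (int l) * m (int l) * e_basis (int l) x)
            + of_real (2 * pi) * (fourier_coeff z0 (- int l) * m (- int l) * e_basis (- int l) x)))) {0..2*pi}"
        by (intro has_integral_sum has_integral_mult_right has_integral_add one J) auto
      moreover have "(\<Sum>j\<in>J. \<Sum>l=2^j..<2*2^j. - \<i> * (of_real (2 * pi) * (fourier_coeff z0 (int l) * m (int l) * e_basis (int l) x)
            + of_real (2 * pi) * (fourier_coeff z0 (- int l) * m (- int l) * e_basis (- int l) x))) = - \<i> * of_real (2 * pi) * T"
        unfolding T_def sum_distrib_left by (intro sum.cong refl) (simp add: algebra_simps)
      moreover have "(\<Sum>j\<in>J. \<Sum>l=2^j..<2*2^j. - \<i> * (z0 y * (m (int l) * cis (of_int (int l) * (x - y))) + z0 y * (m (- int l) * cis (of_int (- int l) * (x - y)))))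
          = z0 y * \<phi> y" for y
        unfolding \<phi>_def sum_distrib_left by (intro sum.cong refl) (simp add: algebra_simps)
      ultimately show "((\<lambda>y. z0 y * \<phi> y) has_integral - \<i> * of_real (2 * pi) * T) {0..2*pi}" by (simp only:)
    qed
    ultimately have "2 * pi * norm T \<le> C * \<epsilon>" by (simp add: norm_mult)
    moreover have "1 * norm T \<le> 2 * pi * norm T"
      using pi_ge_two by (intro mult_right_mono) auto
    ultimately show ?thesis unfolding T_def by linarith
  qed
  with C(1) show ?thesis by (intro exI[of _ C]) simp
qed

theorem PP_solution_irrational:
  fixes p q :: int
  assumes n: "3 \<le> n" and \<alpha>: "\<alpha> n \<noteq> 0" and \<theta>: "\<theta> \<notin> \<rat>" and p: "p > 0" and q: "q > 0"
    and z0: "L2_on {0..2*pi} z0" and bv: "bounded_variation_on z0 0 (2*pi)"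
  shows "\<exists>g. continuous_on {0..2*pi} g \<and> g 0 = g (2*pi) \<and>
           PP_solution_at \<alpha> \<theta> n z0 (2 * pi * of_int p / of_int q) g"
proof -
  define r where "r = real_of_int p / of_int q"
  define m where "m = (\<lambda>l. ue (- (A_sym \<alpha> \<theta> n (of_int l) * r)))"
  define X where "X = PP_phase \<alpha> \<theta> n r"
  define \<xi> where "\<xi> = - (A_coeff \<alpha> \<theta> n (n - 1) * r)"
  have X: "X u (n - 1) = \<xi>" for u using n by (simp add: X_def PP_phase_def \<xi>_def)
  have r: "r \<in> \<rat>" "r \<noteq> 0" using p q by (auto simp: r_def)
  have irr: "\<xi> \<notin> \<rat>"
  proof
    assume "\<xi> \<in> \<rat>"
    moreover have "\<theta> = (- \<xi> / r - of_int (\<alpha> (n - 1))) / (of_int (\<alpha> n) * of_nat n)"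
      unfolding \<xi>_def A_coeff_subleading[OF n] using r n \<alpha> by simp
    ultimately have "\<theta> \<in> \<rat>" using r(1) by auto
    with \<theta> show False by simp
  qed
  have block_eq: "block (X u) n N = (\<Sum>l=N..<2*N. (m (int l) * cis (of_int (int l) * u) - m (- int l) * cis (of_int (- int l) * u)) / of_nat l)" for u N
    using n unfolding block_def X_def m_def by (simp add: ue_PP_phase)
  obtain C :: real where C: "0 \<le> C" "\<forall>m J x \<epsilon>. finite J \<longrightarrow>
     (\<forall>u. norm (\<Sum>j\<in>J. \<Sum>l=2^j..<2*2^j. (m (int l) * cis (of_int (int l) * u) - m (- int l) * cis (of_int (- int l) * u)) / of_nat l) \<le> \<epsilon>) \<longrightarrow>
     norm (\<Sum>j\<in>J. \<Sum>l=2^j..<2*2^j. fourier_coeff z0 (int l) * m (int l) * e_basis (int l) x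
        + fourier_coeff z0 (- int l) * m (- int l) * e_basis (- int l) x) \<le> C * \<epsilon>"
    using fourier_dyadic_bound[OF z0 bv] by (elim exE conjE)
  define F where "F = (\<lambda>x l. fourier_coeff z0 l * m l * e_basis l x)"
  \<comment> \<open>Open ranges, so that consecutive sums differ exactly by the terms with 2^J <=
    |l| < 2^(J+1).\<close>
  define S where "S = (\<lambda>(J::nat) x. \<Sum>l\<in>{- (2 ^ J)<..<2 ^ J}. F x l)"
  have S_diff: "S J' x - S J x = (\<Sum>j=J..<J'. \<Sum>l=2^j..<2*2^j. F x (int l) + F x (- int l))" if "J \<le> J'" for J J' x
    using that
  proof (induction J' rule: dec_induct)
    case (step k)
    have "S (Suc k) x = S k x + (\<Sum>l=2^k..<2*2^k. F x (int l) + F x (- int l))"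
      using sum_dyadic_symmetric[of "2 ^ k" "F x"] by (simp add: S_def)
    with step show ?case by simp
  qed simp
  have "uniformly_Cauchy_on UNIV S"
    unfolding uniformly_Cauchy_on_def
  proof (intro allI impI)
    fix e :: real assume e: "0 < e"
    \<comment> \<open>\<open>C + 1\<close> keeps the divisor positive when C = 0.\<close>
    define \<epsilon> where "\<epsilon> = e / ((C + 1) * 2)"
    have \<epsilon>: "0 < \<epsilon>" using e C(1) by (simp add: \<epsilon>_def)
    have "1 \<le> n - 1" "n - 1 \<le> n" using n by auto
    from sum_blocks_uniformly_small[OF this irr \<epsilon>] obtain j0 where
      j0: "\<And>x J. x (n - 1) = \<xi> \<Longrightarrow> finite J \<Longrightarrow> J \<subseteq> {j0..} \<Longrightarrow> (\<Sum>j\<in>J. norm (block x n (2 ^ j))) \<le> \<epsilon>"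
      by blast
    have le: "norm (S J' x - S J x) < e" if "j0 \<le> J" "J \<le> J'" for J J' x
    proof -
      have "norm (S J' x - S J x) \<le> C * \<epsilon>"
        unfolding S_diff[OF that(2)] F_def
      proof (rule C(2)[rule_format])
        fix u
        have "norm (\<Sum>j=J..<J'. block (X u) n (2 ^ j)) \<le> (\<Sum>j=J..<J'. norm (block (X u) n (2 ^ j)))"
          by (rule norm_sum)
        also have "\<dots> \<le> \<epsilon>" using that by (intro j0 X) auto
        finally show "norm (\<Sum>j=J..<J'. \<Sum>l=2^j..<2*2^j. (m (int l) * cis (of_int (int l) * u) - m (- int l) * cis (of_int (- int l) * u)) / of_nat l) \<le> \<epsilon>"
          unfolding block_eq .
      qed simp
      also have "\<dots> \<le> (C + 1) * \<epsilon>" using \<epsilon> by simp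
      also have "\<dots> = e / 2"
        unfolding \<epsilon>_def times_divide_eq_right
        by (rule nonzero_mult_divide_mult_cancel_left) (use C(1) in simp)
      finally show ?thesis using e by simp
    qed
    have "dist (S J x) (S J' x) < e" if "j0 \<le> J" "j0 \<le> J'" for J J' x
      using le[of J J' x] le[of J' J x] that by (cases "J \<le> J'") (auto simp: dist_norm norm_minus_commute)
    then show "\<exists>M. \<forall>x\<in>UNIV. \<forall>J\<ge>M. \<forall>J'\<ge>M. dist (S J x) (S J' x) < e"
      by (intro exI[of _ j0]) blast
  qed
  then obtain g where g: "uniform_limit UNIV S g sequentially"
    using Cauchy_uniformly_convergent unfolding uniformly_convergent_on_def by blast
  have S_cont: "continuous_on A (S J)" for A J
    unfolding S_def F_def by (intro continuous_intros continuous_e_basis)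
  have g_cont: "continuous_on UNIV g"
    by (rule uniform_limit_theorem[OF _ g]) (auto simp: S_cont)
  have g_lim: "(\<lambda>J. S J x) \<longlonglongrightarrow> g x" for x
    using tendsto_uniform_limitI[OF g] by simp
  have "e_basis l (2 * pi) = e_basis l 0" for l
    using e_basis_add[of l 0 "2 * pi"] by (simp add: cis_int_2pi)
  then have "S J (2 * pi) = S J 0" for J by (simp add: S_def F_def)
  then have g_per: "g 0 = g (2 * pi)" using g_lim[of 0] g_lim[of "2 * pi"] by (simp add: LIMSEQ_unique)
  have g2: "L2_on {0..2*pi} g"
    by (intro L2_on_continuous continuous_on_subset[OF g_cont]) auto
  have "PP_solution_at \<alpha> \<theta> n z0 (2 * pi * of_int p / of_int q) g"
  proof (rule PP_solution_atI[OF g2])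
    fix k
    have S_coeff: "fourier_coeff (S J) k = fourier_coeff z0 k * m k" if "k \<in> {- (2 ^ J)<..<2 ^ J}" for J
    proof -
      have delta: "fourier_coeff (e_basis l) k = (if l = k then 1 else 0)" for l
        unfolding fourier_coeff_def by (rule integral_unique[OF e_basis_orthonormal])
      have "fourier_coeff (S J) k = (\<Sum>l\<in>{- (2 ^ J)<..<2 ^ J}. fourier_coeff z0 l * m l * fourier_coeff (e_basis l) k)"
        unfolding S_def F_def by (rule fourier_coeff_sum) (auto intro: L2_on_e_basis)
      also have "\<dots> = (\<Sum>l\<in>{- (2 ^ J)<..<2 ^ J}. if l = k then fourier_coeff z0 l * m l else 0)"
        by (intro sum.cong refl) (simp add: delta)
      also have "\<dots> = fourier_coeff z0 k * m k" using that by simp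
      finally show ?thesis .
    qed
    \<comment> \<open>Fourier coefficients pass to the uniform limit, and for fixed k they are
      constant in J as soon as 2^J > |k|.\<close>
    have "uniform_limit {0..2*pi} (\<lambda>J x. S J x * cnj (e_basis k x)) (\<lambda>x. g x * cnj (e_basis k x)) sequentially"
    proof (rule uniform_limitI)
      fix e :: real assume "0 < e"
      from uniform_limitD[OF g this] show "\<forall>\<^sub>F J in sequentially. \<forall>x\<in>{0..2*pi}. dist (S J x * cnj (e_basis k x)) (g x * cnj (e_basis k x)) < e"
      proof eventually_elim
        case (elim J)
        show ?case
        proof
          fix x
          have "norm (e_basis k x) \<le> 1"
            using pi_ge_two by (simp add: e_basis_cis norm_divide)
          then have "norm ((S J x - g x) * cnj (e_basis k x)) \<le> norm (S J x - g x)"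
            by (simp add: norm_mult mult_left_le)
          also have "\<dots> < e" using elim by (simp add: dist_norm)
          finally show "dist (S J x * cnj (e_basis k x)) (g x * cnj (e_basis k x)) < e"
            by (simp add: dist_norm left_diff_distrib)
        qed
      qed
    qed
    then obtain I K where IK: "\<And>J. ((\<lambda>x. S J x * cnj (e_basis k x)) has_integral I J) {0..2*pi}"
      "((\<lambda>x. g x * cnj (e_basis k x)) has_integral K) {0..2*pi}" "I \<longlonglongrightarrow> K"
      by (rule uniform_limit_integral) (auto intro!: continuous_intros S_cont continuous_e_basis)
    have "I = (\<lambda>J. fourier_coeff (S J) k)"
      unfolding fourier_coeff_def using integral_unique[OF IK(1)] by (intro ext) simp
    moreover have "K = fourier_coeff g k"
      unfolding fourier_coeff_def using integral_unique[OF IK(2)] by simp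
    ultimately have lim: "(\<lambda>J. fourier_coeff (S J) k) \<longlonglongrightarrow> fourier_coeff g k"
      using IK(3) by simp
    have "fourier_coeff (S J) k = fourier_coeff z0 k * m k" if "nat \<bar>k\<bar> \<le> J" for J
    proof (rule S_coeff)
      have "\<bar>k\<bar> < 2 ^ nat \<bar>k\<bar>" using less_exp[of "nat \<bar>k\<bar>"] by (metis int_nat_eq abs_ge_zero of_nat_less_iff of_nat_numeral of_nat_power)
      also have "(2::int) ^ nat \<bar>k\<bar> \<le> 2 ^ J" using that by (intro power_increasing) auto
      finally show "k \<in> {- (2 ^ J)<..<2 ^ J}" by auto
    qed
    then have "\<forall>\<^sub>F J in sequentially. fourier_coeff (S J) k = fourier_coeff z0 k * m k"
      by (intro eventually_sequentiallyI[of "nat \<bar>k\<bar>"])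
    then have "(\<lambda>J. fourier_coeff (S J) k) \<longlonglongrightarrow> fourier_coeff z0 k * m k"
      by (rule tendsto_eventually)
    from LIMSEQ_unique[OF lim this]
    show "fourier_coeff g k = fourier_coeff z0 k * exp (- \<i> * of_real (A_sym \<alpha> \<theta> n (of_int k) * (2 * pi * of_int p / of_int q)))"
      unfolding PP_multiplier_ue by (simp add: m_def r_def)
  qed
  then show ?thesis
    using g_per continuous_on_subset[OF g_cont, of "{0..2*pi}"] by blast
qed

theorem theorem2p2:
  fixes \<theta> :: real and n :: nat and \<alpha> :: "nat \<Rightarrow> int" and p q :: int
    and z0 :: "real \<Rightarrow> complex"
  assumes "0 < \<theta>" "\<theta> < 1" "n \<ge> 3" "\<alpha> n \<noteq> 0"
    and "p > 0" "q > 0" "coprime p q"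
    and "L2_on {0..2*pi} z0"
  shows "(\<theta> \<in> \<rat> \<longrightarrow>
           (\<exists>(N::nat) (c::nat \<Rightarrow> complex) (\<sigma>::nat \<Rightarrow> real).
              PP_solution_at \<alpha> \<theta> n z0 (2 * pi * of_int p / of_int q)
                (\<lambda>x. \<Sum>j=1..N. c j * per_ext z0 (x - \<sigma> j))))
       \<and> (\<theta> \<notin> \<rat> \<and> bounded_variation_on z0 0 (2*pi) \<longrightarrow>
           (\<exists>g. continuous_on {0..2*pi} g \<and> g 0 = g (2*pi) \<and>
              PP_solution_at \<alpha> \<theta> n z0 (2 * pi * of_int p / of_int q) g))"
  using PP_solution_rational[of \<theta> q z0 \<alpha> n p] PP_solution_irrational[of n \<alpha> \<theta> p q z0] assms by blast

end
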